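(* There exist a dismantlable constraint graph $H$ and a constant $\gamma_0>0$ such that: (1) the set of nearest-neighbour interactions $\Phi$ for which the Gibbs $(\mathbb{Z}^2,H,\Phi)$-specification satisfies exponential strong spatial mixing (with some decay rate) is nonempty; (2) there is no nearest-neighbour interaction $\Phi$ for which the Gibbs $(\mathbb{Z}^2,H,\Phi)$-specification satisfies exponential strong spatial mixing with decay rate greater than $\gamma_0$; (3) $\mathrm{Hom}(\mathbb{Z}^2,H)$ satisfies single-site fillability (in particular, it satisfies topological strong spatial mixing (TSSM)); and (4) for every $\gamma>0$ there exists a nearest-neighbour interaction $\Phi$ for which the Gibbs $(\mathbb{Z}^2,H,\Phi)$-specification satisfies exponential weak spatial mixing with decay function $f(n)=Ce^{-\gamma n}$ (for some $C>0$). Moreover, there exists a family $\{H^q\}_{q\in\mathbb{N}}$ of dismantlable graphs, each having this property (i.e. (1)–(4) hold for $H=H^q$ with some constant $\gamma_0=\gamma_0(q)>0$), with $|H^q|\to\infty$ as $q\to\infty$.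
   Context: Graphs are undirected; $u\sim v$ denotes adjacency, $N(v)=\{u:u\sim v\}$ (so $v\in N(v)$ iff $v$ has a loop). A constraint graph is a finite graph $H=(V,E)$, loops allowed; $|H|=|V|$. $\mathbb{Z}^2$ denotes the simple graph with vertex set $\mathcal{V}=\mathbb{Z}^2$ and $x\sim y$ iff $\|x-y\|_1=1$. $\mathrm{Hom}(\mathbb{Z}^2,H)$ is the set of graph homomorphisms $\omega:\mathcal{V}\to V$ (points). $\mathrm{dist}$ is graph distance in $\mathbb{Z}^2$, $\mathrm{dist}(A,B)=\min_{x\in A,y\in B}\mathrm{dist}(x,y)$, $\mathrm{dist}(\cdot,\emptyset)=\infty$ (decay functions take the value $0$ at $\infty$), $\partial A=\{x:\mathrm{dist}(x,A)=1\}$, $\Sigma_B(\alpha_1,\alpha_2)=\{x\in B:\alpha_1(x)\ne\alpha_2(x)\}$. For $A\subseteq\mathcal{V}$, $\alpha\in V^A$ is globally admissible if $\alpha=\omega|_A$ for some point $\omega$. Concatenations such as $\alpha\beta$ denote the common extension of configurations on disjoint sets. Dismantlable: if $u\neq v$ in $V$ satisfy $N(u)\subseteq N(v)$, a fold is the homomorphism from $H$ to the induced subgraph $H[V\setminus\{u\}]$ sending $u$ to $v$ and fixing all other vertices. $H$ is dismantlable if some (possibly empty) sequence of folds reduces $H$ to a graph with a single vertex (with or without a loop). Single-site fillable (SSF): for every $x\in\mathcal{V}$ and $B\subseteq\partial\{x\}$, any homomorphism from the induced subgraph $\mathbb{Z}^2[B]$ to $H$ extends to a homomorphism $\mathbb{Z}^2[B\cup\{x\}]\to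 H$. TSSM: there is $g\in\mathbb{N}$ such that for all pairwise disjoint finite $A,B,S\subseteq\mathcal{V}$ with $\mathrm{dist}(A,B)\ge g$ and all $\alpha\in V^A,\beta\in V^B,\sigma\in V^S$, if $\alpha\sigma$ and $\sigma\beta$ are globally admissible then $\alpha\sigma\beta$ is globally admissible. Gibbs specification: a nearest-neighbour interaction for $H$ is a function $\Phi:V\cup E\to(-\infty,0]$; write $\Phi(u,v)=\Phi(\{u,v\})$. For finite $A\subseteq\mathcal{V}$, a point $\omega$ and $\alpha\in V^A$ such that $\alpha\,\omega|_{A^c}\in\mathrm{Hom}(\mathbb{Z}^2,H)$, let $$E^\Phi_{A,\omega}(\alpha)=\sum_{x\in A}\Big(\Phi(\alpha(x))+\tfrac12\sum_{y\in A:\,y\sim x}\Phi(\alpha(x),\alpha(y))+\sum_{y\in\partial A:\,y\sim x}\Phi(\alpha(x),\omega(y))\Big).$$ Let $\pi^\omega_A$ be the probability measure on $V^A$ with $\pi^\omega_A(\alpha)$ proportional to $e^{-E^\Phi_{A,\omega}(\alpha)}$ if $\alpha\,\omega|_{A^c}\in\mathrm{Hom}(\mathbb{Z}^2,H)$, and $0$ otherwise; $\pi^\omega_A(\beta)=\sum_{\alpha:\alpha|_B=\beta}\pi^\omega_A(\alpha)$ for $\beta\in V^B$, $B\subseteq A$. The Gibbs $(\mathbb{Z}^2,H,\Phi)$-specification is $\pi=\{\pi^\omega_A\}$ over finite $A$ and points $\omega$. It satisfies exponential strong spatial mixing (resp. exponential weak spatial mixing) with decay rate $\gamma>0$ if there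 is $C>0$ such that for all finite $A$, $B\subseteq A$, $\beta\in V^B$ and points $\omega_1,\omega_2$, $|\pi^{\omega_1}_A(\beta)-\pi^{\omega_2}_A(\beta)|\le|B|Ce^{-\gamma d}$ with $d=\mathrm{dist}(B,\Sigma_{\partial A}(\omega_1,\omega_2))$ (resp. $d=\mathrm{dist}(B,\partial A)$). *)

theory Defs
  imports Complex_Main "HOL-Library.FuncSet" "HOL-Library.Extended_Nat"
begin

subsection \<open>Undirected graphs with loops\<close>

text \<open>An edge is an unordered pair \<open>{u, v}\<close>; a loop at \<open>v\<close> is the singleton \<open>{v}\<close>.\<close>

record 'v ugraph =
  nodes :: "'v set"
  links :: "'v set set"

definition adj :: "'v ugraph \<Rightarrow> 'v \<Rightarrow> 'v \<Rightarrow> bool" where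
  "adj G u v \<longleftrightarrow> {u, v} \<in> links G"

definition nbhd :: "'v ugraph \<Rightarrow> 'v \<Rightarrow> 'v set" where
  "nbhd G v = {u. adj G u v}"

definition constraint_graph :: "'v ugraph \<Rightarrow> bool" where
  "constraint_graph H \<longleftrightarrow> finite (nodes H) \<and> links H \<subseteq> {{u, v} | u v. u \<in> nodes H \<and> v \<in> nodes H}"

definition induced :: "'v ugraph \<Rightarrow> 'v set \<Rightarrow> 'v ugraph" where
  "induced G W = \<lparr>nodes = W, links = {e \<in> links G. e \<subseteq> W}\<rparr>"

definition graph_hom :: "'u ugraph \<Rightarrow> 'v ugraph \<Rightarrow> ('u \<Rightarrow> 'v) set" where
  "graph_hom G H = {f \<in> nodes G \<rightarrow>\<^sub>E nodes H. \<forall>x y. adj G x y \<longrightarrow> adj H (f x) (f y)}"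

text \<open>Length of a shortest walk; \<open>\<infinity>\<close> if there is none.\<close>

definition gdist :: "'v ugraph \<Rightarrow> 'v \<Rightarrow> 'v \<Rightarrow> enat" where
  "gdist G x y = (INF n \<in> {n. (x, y) \<in> {(u, v). adj G u v} ^^ n}. enat n)"

text \<open>The infimum of the empty set in \<^typ>\<open>enat\<close> is \<open>\<infinity>\<close>, so the distance to \<open>{}\<close> is \<open>\<infinity>\<close>.\<close>

definition set_gdist :: "'v ugraph \<Rightarrow> 'v set \<Rightarrow> 'v set \<Rightarrow> enat" where
  "set_gdist G A B = (INF x \<in> A. INF y \<in> B. gdist G x y)"


subsection \<open>Dismantlable graphs\<close>

text \<open>The target of a fold sending \<open>u\<close> to \<open>v\<close>.\<close>

definition folds_to :: "'v ugraph \<Rightarrow> 'v ugraph \<Rightarrow> bool" where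
  "folds_to H H' \<longleftrightarrow> (\<exists>u \<in> nodes H. \<exists>v \<in> nodes H.
     u \<noteq> v \<and> nbhd H u \<subseteq> nbhd H v \<and> H' = induced H (nodes H - {u}))"

definition dismantlable :: "'v ugraph \<Rightarrow> bool" where
  "dismantlable H \<longleftrightarrow> (\<exists>H'. folds_to\<^sup>*\<^sup>* H H' \<and> card (nodes H') = 1)"


subsection \<open>The square lattice and its homomorphism spaces\<close>

type_synonym site = "int \<times> int"

definition Z2 :: "site ugraph" where
  "Z2 = \<lparr>nodes = UNIV,
         links = {{x, y} | x y. \<bar>fst x - fst y\<bar> + \<bar>snd x - snd y\<bar> = 1}\<rparr>"

abbreviation points :: "'v ugraph \<Rightarrow> (site \<Rightarrow> 'v) set" where
  "points H \<equiv> graph_hom Z2 H"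

definition bdry :: "site set \<Rightarrow> site set" where
  "bdry A = {x. set_gdist Z2 {x} A = 1}"

definition disagreement :: "site set \<Rightarrow> (site \<Rightarrow> 'v) \<Rightarrow> (site \<Rightarrow> 'v) \<Rightarrow> site set" where
  "disagreement B \<alpha>1 \<alpha>2 = {x \<in> B. \<alpha>1 x \<noteq> \<alpha>2 x}"

text \<open>Configurations on \<open>A\<close> are the elements of \<open>A \<rightarrow>\<^sub>E nodes H\<close>. The concatenation of
  \<open>\<alpha>\<close> on \<open>A\<close> with a configuration \<open>\<beta>\<close> on a set disjoint from \<open>A\<close> is
  \<open>override_on \<beta> \<alpha> A\<close>; likewise \<open>override_on \<omega> \<alpha> A\<close> is \<open>\<alpha>\<close> on \<open>A\<close> and \<open>\<omega>\<close> off \<open>A\<close>.\<close>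

definition globally_admissible :: "'v ugraph \<Rightarrow> site set \<Rightarrow> (site \<Rightarrow> 'v) \<Rightarrow> bool" where
  "globally_admissible H A \<alpha> \<longleftrightarrow> (\<exists>\<omega> \<in> points H. \<alpha> = restrict \<omega> A)"

definition SSF :: "'v ugraph \<Rightarrow> bool" where
  "SSF H \<longleftrightarrow> (\<forall>x B. B \<subseteq> bdry {x} \<longrightarrow>
     (\<forall>f \<in> graph_hom (induced Z2 B) H.
        \<exists>g \<in> graph_hom (induced Z2 (insert x B)) H. restrict g B = f))"

definition TSSM :: "'v ugraph \<Rightarrow> bool" where
  "TSSM H \<longleftrightarrow> (\<exists>g::nat. \<forall>A B S.
     finite A \<and> finite B \<and> finite S \<and> A \<inter> B = {} \<and> A \<inter> S = {} \<and> B \<inter> S = {} \<and>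
     set_gdist Z2 A B \<ge> enat g \<longrightarrow>
     (\<forall>\<alpha> \<in> A \<rightarrow>\<^sub>E nodes H. \<forall>\<beta> \<in> B \<rightarrow>\<^sub>E nodes H. \<forall>\<sigma> \<in> S \<rightarrow>\<^sub>E nodes H.
        globally_admissible H (A \<union> S) (override_on \<sigma> \<alpha> A) \<and>
        globally_admissible H (S \<union> B) (override_on \<beta> \<sigma> S) \<longrightarrow>
        globally_admissible H (A \<union> S \<union> B) (override_on (override_on \<beta> \<sigma> S) \<alpha> A)))"


subsection \<open>Gibbs specifications\<close>

text \<open>A function on the disjoint union of vertices and edges, so that a vertex \<open>v\<close> and a
  loop \<open>{v}\<close> carry independent values.\<close>

type_synonym 'v interaction = "'v + 'v set \<Rightarrow> real"

definition nn_interactions :: "'v ugraph \<Rightarrow> 'v interaction set" where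
  "nn_interactions H = (nodes H <+> links H) \<rightarrow>\<^sub>E {..0}"

definition energy ::
  "'v interaction \<Rightarrow> site set \<Rightarrow> (site \<Rightarrow> 'v) \<Rightarrow> (site \<Rightarrow> 'v) \<Rightarrow> real" where
  "energy \<Phi> A \<omega> \<alpha> = (\<Sum>x\<in>A. \<Phi> (Inl (\<alpha> x))
     + 1 / 2 * (\<Sum>y \<in> {y \<in> A. adj Z2 y x}. \<Phi> (Inr {\<alpha> x, \<alpha> y}))
     + (\<Sum>y \<in> {y \<in> bdry A. adj Z2 y x}. \<Phi> (Inr {\<alpha> x, \<omega> y})))"

definition gibbs_weight ::
  "'v ugraph \<Rightarrow> 'v interaction \<Rightarrow> site set \<Rightarrow> (site \<Rightarrow> 'v) \<Rightarrow> (site \<Rightarrow> 'v) \<Rightarrow> real" where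
  "gibbs_weight H \<Phi> A \<omega> \<alpha> =
     (if override_on \<omega> \<alpha> A \<in> points H then exp (- energy \<Phi> A \<omega> \<alpha>) else 0)"

definition gibbs ::
  "'v ugraph \<Rightarrow> 'v interaction \<Rightarrow> site set \<Rightarrow> (site \<Rightarrow> 'v) \<Rightarrow> (site \<Rightarrow> 'v) \<Rightarrow> real" where
  "gibbs H \<Phi> A \<omega> \<alpha> =
     gibbs_weight H \<Phi> A \<omega> \<alpha> / (\<Sum>\<alpha>' \<in> A \<rightarrow>\<^sub>E nodes H. gibbs_weight H \<Phi> A \<omega> \<alpha>')"

definition gibbs_marginal ::
  "'v ugraph \<Rightarrow> 'v interaction \<Rightarrow> site set \<Rightarrow> (site \<Rightarrow> 'v) \<Rightarrow> site set \<Rightarrow> (site \<Rightarrow> 'v) \<Rightarrow> real" where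
  "gibbs_marginal H \<Phi> A \<omega> B \<beta> =
     (\<Sum>\<alpha> \<in> {\<alpha> \<in> A \<rightarrow>\<^sub>E nodes H. restrict \<alpha> B = \<beta>}. gibbs H \<Phi> A \<omega> \<alpha>)"

lemma gibbs_nonneg: "gibbs H \<Phi> A \<omega> \<alpha> \<ge> 0"
  unfolding gibbs_def gibbs_weight_def by (intro divide_nonneg_nonneg sum_nonneg) auto

lemma gibbs_sum_eq_1:
  assumes "constraint_graph H" "finite A" "\<omega> \<in> points H"
  shows "(\<Sum>\<alpha> \<in> A \<rightarrow>\<^sub>E nodes H. gibbs H \<Phi> A \<omega> \<alpha>) = 1"
proof -
  have fin: "finite (A \<rightarrow>\<^sub>E nodes H)"
    using assms by (auto simp: constraint_graph_def intro: finite_PiE)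
  have mem: "restrict \<omega> A \<in> A \<rightarrow>\<^sub>E nodes H"
    using assms(3) by (auto simp: graph_hom_def Z2_def PiE_def Pi_def)
  have "override_on \<omega> (restrict \<omega> A) A = \<omega>"
    by (auto simp: override_on_def)
  then have "gibbs_weight H \<Phi> A \<omega> (restrict \<omega> A) > 0"
    using assms(3) by (simp add: gibbs_weight_def)
  then have "(\<Sum>\<alpha> \<in> A \<rightarrow>\<^sub>E nodes H. gibbs_weight H \<Phi> A \<omega> \<alpha>) > 0"
    by (intro sum_pos2[OF fin mem]) (auto simp: gibbs_weight_def)
  then show ?thesis
    by (simp add: gibbs_def flip: sum_divide_distrib)
qed

definition exp_decay :: "real \<Rightarrow> real \<Rightarrow> enat \<Rightarrow> real" where
  "exp_decay C \<gamma> d = (case d of enat n \<Rightarrow> C * exp (- \<gamma> * real n) | \<infinity> \<Rightarrow> 0)"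

definition exp_SSM :: "'v ugraph \<Rightarrow> 'v interaction \<Rightarrow> real \<Rightarrow> bool" where
  "exp_SSM H \<Phi> \<gamma> \<longleftrightarrow> \<gamma> > 0 \<and> (\<exists>C>0. \<forall>A B. finite A \<and> B \<subseteq> A \<longrightarrow>
     (\<forall>\<beta> \<in> B \<rightarrow>\<^sub>E nodes H. \<forall>\<omega>1 \<in> points H. \<forall>\<omega>2 \<in> points H.
        \<bar>gibbs_marginal H \<Phi> A \<omega>1 B \<beta> - gibbs_marginal H \<Phi> A \<omega>2 B \<beta>\<bar>
          \<le> real (card B) * exp_decay C \<gamma> (set_gdist Z2 B (disagreement (bdry A) \<omega>1 \<omega>2))))"

definition exp_WSM :: "'v ugraph \<Rightarrow> 'v interaction \<Rightarrow> real \<Rightarrow> bool" where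
  "exp_WSM H \<Phi> \<gamma> \<longleftrightarrow> \<gamma> > 0 \<and> (\<exists>C>0. \<forall>A B. finite A \<and> B \<subseteq> A \<longrightarrow>
     (\<forall>\<beta> \<in> B \<rightarrow>\<^sub>E nodes H. \<forall>\<omega>1 \<in> points H. \<forall>\<omega>2 \<in> points H.
        \<bar>gibbs_marginal H \<Phi> A \<omega>1 B \<beta> - gibbs_marginal H \<Phi> A \<omega>2 B \<beta>\<bar>
          \<le> real (card B) * exp_decay C \<gamma> (set_gdist Z2 B (bdry A))))"

definition bounded_SSM_rate :: "'v ugraph \<Rightarrow> real \<Rightarrow> bool" where
  "bounded_SSM_rate H \<gamma>0 \<longleftrightarrow>
     {\<Phi> \<in> nn_interactions H. \<exists>\<gamma>. exp_SSM H \<Phi> \<gamma>} \<noteq> {} \<and>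
     \<not> (\<exists>\<Phi> \<in> nn_interactions H. \<exists>\<gamma>>\<gamma>0. exp_SSM H \<Phi> \<gamma>) \<and>
     (SSF H \<and> TSSM H) \<and>
     (\<forall>\<gamma>>0. \<exists>\<Phi> \<in> nn_interactions H. exp_WSM H \<Phi> \<gamma>)"

end

theory Submission
  imports Defs
begin

text \<open>The graphs are cliques of \<open>m \<ge> 12\<close> colours with two further vertices: a looped hub and a
  loopless blocker, both adjacent to all colours and not to each other. The blocker folds to the hub,
  and then every colour does, so the graph is dismantlable. Any four vertices have a common
  neighbour (\<open>common_neighbour\<close>), which gives single-site fillability and TSSM.

  Large weight on the hub makes nearly all sites hubs, except next to blockers.
  Blockers are rare in the bulk but may occur in a boundary condition, and this separates weak from
  strong mixing.

  Weak mixing at any rate (\<open>exp_WSM_hub_interaction\<close>): take two independent copies with different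
  boundary conditions. They can be exchanged on a cluster of sites that is surrounded by hubs in both
  copies, so marginals on \<open>B\<close> differ only if sites without a common hub connect \<open>B\<close> to the
  boundary. By a Peierls estimate this is as unlikely per step as desired, if the hub is
  heavy enough.

  Strong mixing at some rate (\<open>exp_SSM_hub_interaction\<close>): near fixed blockers the system is a
  uniform colouring with many colours, elsewhere it is dominated by the hub. Dobrushin's comparison
  applies with a metric on spins in which the blocker is far from everything else
  (\<open>weighted_mean_allowed_contraction\<close>).

  Strong mixing is never fast (\<open>SSM_rate_bounded\<close>): a line of sites framed by blockers forbids the hub
  and leaves a one-dimensional chain of colours. Whatever the interaction, its symmetric transfer
  matrix has zero diagonal, which bounds the spectral gap in terms of the number of colours alone.
  The spectral statement is replaced by an estimate of \<open>2 \<times> 2\<close> minors of powers of the matrix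
  (\<open>principal_minor_power_of_two\<close>).\<close>

section \<open>Distance and boundary in the square lattice\<close>

text \<open>A site is a pair of integers; letting the simplifier split quantifiers over sites into
  quantifiers over coordinates would hide the sites from all lemmas below.\<close>
declare split_paired_All [simp del] split_paired_Ex [simp del]

definition l1_dist :: "site \<Rightarrow> site \<Rightarrow> nat" where
  "l1_dist x y = nat (\<bar>fst x - fst y\<bar> + \<bar>snd x - snd y\<bar>)"

lemma adj_Z2: "adj Z2 x y \<longleftrightarrow> l1_dist x y = 1"
proof -
  have "adj Z2 x y \<longleftrightarrow> \<bar>fst x - fst y\<bar> + \<bar>snd x - snd y\<bar> = 1"
    unfolding adj_def Z2_def
    by (auto simp: doubleton_eq_iff abs_minus_commute)
  then show ?thesis by (simp add: l1_dist_def nat_eq_iff)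
qed

lemma adj_Z2_sym: "adj Z2 x y \<longleftrightarrow> adj Z2 y x"
  by (simp add: adj_def insert_commute)

lemma not_adj_Z2_self [simp]: "\<not> adj Z2 x x"
  by (simp add: adj_Z2 l1_dist_def)

lemma l1_dist_triangle: "l1_dist x z \<le> l1_dist x y + l1_dist y z"
  by (auto simp: l1_dist_def)

lemma l1_dist_commute: "l1_dist x y = l1_dist y x"
  by (auto simp: l1_dist_def abs_minus_commute)

lemma l1_dist_eq_0 [simp]: "l1_dist x y = 0 \<longleftrightarrow> x = y"
  by (auto simp: l1_dist_def prod_eq_iff)

lemma step_towards:
  assumes "l1_dist x y = Suc n"
  obtains z where "adj Z2 x z" "l1_dist z y = n"
proof (cases "fst x = fst y")
  case True
  define z where "z = (fst x, snd x + sgn (snd y - snd x))"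
  show thesis
    by (rule that[of z])
      (use assms True in \<open>auto simp: z_def adj_Z2 l1_dist_def sgn_if split: if_splits\<close>)
next
  case False
  define z where "z = (fst x + sgn (fst y - fst x), snd x)"
  show thesis
    by (rule that[of z])
      (use assms False in \<open>auto simp: z_def adj_Z2 l1_dist_def sgn_if split: if_splits\<close>)
qed

lemma walk_of_l1_length: "(x, y) \<in> {(u, v). adj Z2 u v} ^^ l1_dist x y"
proof (induction "l1_dist x y" arbitrary: x)
  case 0
  then show ?case by (metis l1_dist_eq_0 relpow_0_I)
next
  case (Suc n)
  obtain z where z: "adj Z2 x z" "l1_dist z y = n"
    using step_towards Suc.hyps(2) by metis
  have "(z, y) \<in> {(u, v). adj Z2 u v} ^^ n"
    using Suc.hyps(1)[of z] z by simp
  then show ?case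
    unfolding Suc.hyps(2)[symmetric] by (intro relpow_Suc_I2[of x z]) (use z in auto)
qed

lemma l1_dist_le_walk:
  assumes "(x, y) \<in> {(u, v). adj Z2 u v} ^^ n"
  shows "l1_dist x y \<le> n"
  using assms
proof (induction n arbitrary: y)
  case (Suc n)
  then obtain z where "(x, z) \<in> {(u, v). adj Z2 u v} ^^ n" "adj Z2 z y"
    by auto
  then show ?case
    using Suc.IH[of z] l1_dist_triangle[of x y z] by (simp add: adj_Z2)
qed auto

text \<open>Walking towards the target one coordinate step at a time attains the \<open>l1\<close> lower bound, so all
  distances of the statement become explicit arithmetic.\<close>
lemma gdist_Z2: "gdist Z2 x y = enat (l1_dist x y)"
  unfolding gdist_def
proof (rule antisym)
  show "(INF n \<in> {n. (x, y) \<in> {(u, v). adj Z2 u v} ^^ n}. enat n) \<le> enat (l1_dist x y)"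
    by (rule INF_lower) (simp add: walk_of_l1_length)
  show "enat (l1_dist x y) \<le> (INF n \<in> {n. (x, y) \<in> {(u, v). adj Z2 u v} ^^ n}. enat n)"
    by (rule INF_greatest) (simp add: l1_dist_le_walk)
qed

lemma set_gdist_le: "x \<in> A \<Longrightarrow> y \<in> B \<Longrightarrow> set_gdist Z2 A B \<le> enat (l1_dist x y)"
  unfolding set_gdist_def gdist_Z2 by (intro INF_lower2[of x] INF_lower2[of y]) auto

lemma set_gdist_ge:
  assumes "\<And>x y. x \<in> A \<Longrightarrow> y \<in> B \<Longrightarrow> d \<le> enat (l1_dist x y)"
  shows "d \<le> set_gdist Z2 A B"
  unfolding set_gdist_def gdist_Z2 using assms by (auto intro!: INF_greatest)

lemma set_gdist_attained:
  assumes "S \<noteq> {}"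
  shows "\<exists>z\<in>S. set_gdist Z2 {x} S = enat (l1_dist x z)"
proof -
  obtain k where "k \<in> S" using assms by blast
  then have "Inf ((\<lambda>z. enat (l1_dist x z)) ` S) \<in> (\<lambda>z. enat (l1_dist x z)) ` S"
    by (intro wellorder_InfI[of "enat (l1_dist x k)"]) auto
  then show ?thesis by (auto simp: set_gdist_def gdist_Z2)
qed

lemma set_gdist_step:
  assumes "adj Z2 x y"
  shows "set_gdist Z2 {x} S \<le> set_gdist Z2 {y} S + 1"
proof (cases "S = {}")
  case True
  then show ?thesis by (simp add: set_gdist_def top_enat_def)
next
  case False
  then obtain z where z: "z \<in> S" "set_gdist Z2 {y} S = enat (l1_dist y z)"
    using set_gdist_attained by blast
  have "set_gdist Z2 {x} S \<le> enat (l1_dist x z)"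
    using z by (intro set_gdist_le) auto
  also have "l1_dist x z \<le> l1_dist y z + 1"
    using l1_dist_triangle[of x z y] assms by (simp add: adj_Z2)
  finally show ?thesis
    using z by (simp add: one_enat_def)
qed

lemma bdry_eq: "bdry A = {x. x \<notin> A \<and> (\<exists>y\<in>A. adj Z2 y x)}"
proof (intro set_eqI iffI)
  fix x assume "x \<in> bdry A"
  then have one: "set_gdist Z2 {x} A = 1" by (simp add: bdry_def)
  then have "A \<noteq> {}" by (auto simp: set_gdist_def top_enat_def one_enat_def)
  then obtain y where "y \<in> A" "set_gdist Z2 {x} A = enat (l1_dist x y)"
    using set_gdist_attained by blast
  then have "\<exists>y\<in>A. adj Z2 y x"
    using one by (auto simp: adj_Z2 one_enat_def l1_dist_commute)
  moreover have "x \<notin> A"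
    using set_gdist_le[of x "{x}" x A] one by (auto simp: one_enat_def l1_dist_def)
  ultimately show "x \<in> {x. x \<notin> A \<and> (\<exists>y\<in>A. adj Z2 y x)}" by simp
next
  fix x assume "x \<in> {x. x \<notin> A \<and> (\<exists>y\<in>A. adj Z2 y x)}"
  then obtain y where y: "x \<notin> A" "y \<in> A" "adj Z2 y x" by auto
  have "set_gdist Z2 {x} A \<le> enat 1"
    using set_gdist_le[of x "{x}" y A] y by (simp add: adj_Z2 l1_dist_commute)
  moreover have "enat 1 \<le> set_gdist Z2 {x} A"
  proof (rule set_gdist_ge)
    fix u v assume "u \<in> {x}" "v \<in> A"
    then have "l1_dist u v \<noteq> 0" using y(1) by auto
    then show "enat 1 \<le> enat (l1_dist u v)" by (simp del: l1_dist_eq_0)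
  qed
  ultimately show "x \<in> bdry A" by (simp add: bdry_def one_enat_def)
qed

lemma nbhd_Z2:
  "nbhd Z2 x = {(fst x + 1, snd x), (fst x - 1, snd x), (fst x, snd x + 1), (fst x, snd x - 1)}"
  by (auto simp: nbhd_def adj_Z2 l1_dist_def nat_eq_iff prod_eq_iff)

lemma finite_nbhd_Z2 [simp]: "finite (nbhd Z2 x)"
  by (simp add: nbhd_Z2)

lemma card_nbhd_Z2: "card (nbhd Z2 x) = 4"
  by (simp add: nbhd_Z2)

lemma mem_nbhd_Z2: "y \<in> nbhd Z2 x \<longleftrightarrow> adj Z2 y x"
  by (simp add: nbhd_def)

lemma bdry_singleton: "bdry {x} = nbhd Z2 x"
  by (auto simp: bdry_eq mem_nbhd_Z2 adj_Z2_sym)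

lemma finite_bdry [simp]: "finite A \<Longrightarrow> finite (bdry A)"
  by (rule finite_subset[of _ "\<Union>x\<in>A. nbhd Z2 x"]) (auto simp: bdry_eq mem_nbhd_Z2 adj_Z2_sym)

lemma points_iff:
  "\<omega> \<in> points H \<longleftrightarrow> (\<forall>x. \<omega> x \<in> nodes H) \<and> (\<forall>x y. adj Z2 x y \<longrightarrow> adj H (\<omega> x) (\<omega> y))"
  by (auto simp: graph_hom_def Z2_def)

lemma point_node: "\<omega> \<in> points H \<Longrightarrow> \<omega> x \<in> nodes H"
  by (simp add: points_iff)

lemma point_edge: "\<omega> \<in> points H \<Longrightarrow> adj Z2 x y \<Longrightarrow> adj H (\<omega> x) (\<omega> y)"
  by (simp add: points_iff)

section \<open>Energy as a function of the full configuration\<close>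

text \<open>The energy written on one configuration of the whole lattice. An edge inside \<open>A\<close> is met from
  both ends and so carries the factor \<open>1/2\<close>, an edge leaving \<open>A\<close> is met once. Its arguments no
  longer separate inside from outside, which makes regions of different size comparable.\<close>
definition local_energy :: "'v interaction \<Rightarrow> site set \<Rightarrow> (site \<Rightarrow> 'v) \<Rightarrow> real" where
  "local_energy \<Phi> A \<tau> = (\<Sum>x\<in>A. \<Phi> (Inl (\<tau> x)) +
     (\<Sum>y\<in>nbhd Z2 x. (if y \<in> A then 1/2 else 1) * \<Phi> (Inr {\<tau> x, \<tau> y})))"

lemma energy_eq_local_energy:
  assumes "finite A"
  shows "energy \<Phi> A \<omega> \<alpha> = local_energy \<Phi> A (override_on \<omega> \<alpha> A)"
  unfolding energy_def local_energy_def
proof (intro sum.cong refl)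
  fix x assume x: "x \<in> A"
  let ?\<tau> = "override_on \<omega> \<alpha> A"
  have nb: "nbhd Z2 x = {y \<in> A. adj Z2 y x} \<union> {y \<in> bdry A. adj Z2 y x}"
    using x by (auto simp: bdry_eq mem_nbhd_Z2 adj_Z2_sym)
  have "(\<Sum>y\<in>nbhd Z2 x. (if y \<in> A then 1/2 else 1) * \<Phi> (Inr {?\<tau> x, ?\<tau> y})) =
     (\<Sum>y\<in>{y \<in> A. adj Z2 y x}. (if y \<in> A then 1/2 else 1) * \<Phi> (Inr {?\<tau> x, ?\<tau> y})) +
     (\<Sum>y\<in>{y \<in> bdry A. adj Z2 y x}. (if y \<in> A then 1/2 else 1) * \<Phi> (Inr {?\<tau> x, ?\<tau> y}))"
    unfolding nb using assms by (intro sum.union_disjoint) (simp_all, auto simp: bdry_eq)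
  also have "(\<Sum>y\<in>{y \<in> A. adj Z2 y x}. (if y \<in> A then 1/2 else 1) * \<Phi> (Inr {?\<tau> x, ?\<tau> y})) =
     1/2 * (\<Sum>y \<in> {y \<in> A. adj Z2 y x}. \<Phi> (Inr {\<alpha> x, \<alpha> y}))"
    unfolding sum_distrib_left using x by (intro sum.cong) auto
  also have "(\<Sum>y\<in>{y \<in> bdry A. adj Z2 y x}. (if y \<in> A then 1/2 else 1) * \<Phi> (Inr {?\<tau> x, ?\<tau> y})) =
     (\<Sum>y \<in> {y \<in> bdry A. adj Z2 y x}. \<Phi> (Inr {\<alpha> x, \<omega> y}))"
    using x by (intro sum.cong) (auto simp: bdry_eq)
  finally show "\<Phi> (Inl (\<alpha> x)) + 1/2 * (\<Sum>y \<in> {y \<in> A. adj Z2 y x}. \<Phi> (Inr {\<alpha> x, \<alpha> y}))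
     + (\<Sum>y \<in> {y \<in> bdry A. adj Z2 y x}. \<Phi> (Inr {\<alpha> x, \<omega> y})) =
     \<Phi> (Inl (?\<tau> x)) + (\<Sum>y\<in>nbhd Z2 x. (if y \<in> A then 1/2 else 1) * \<Phi> (Inr {?\<tau> x, ?\<tau> y}))"
    using x by simp
qed

text \<open>A new site contributes its own potential and its edges to sites outside \<open>A\<close>; its edges into
  \<open>A\<close> were already counted as edges leaving \<open>A\<close>, and only change from weight \<open>1\<close> at one end to
  weight \<open>1/2\<close> at both.\<close>
lemma local_energy_insert:
  assumes "finite A" "x \<notin> A"
  shows "local_energy \<Phi> (insert x A) \<tau> =
    local_energy \<Phi> A \<tau> + \<Phi> (Inl (\<tau> x)) + (\<Sum>y\<in>nbhd Z2 x - A. \<Phi> (Inr {\<tau> x, \<tau> y}))"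
proof -
  define h where "h u v = \<Phi> (Inr {\<tau> u, \<tau> v})" for u v
  have h_sym: "h u v = h v u" for u v by (simp add: h_def insert_commute)
  have old: "(\<Sum>y\<in>nbhd Z2 z. (if y \<in> insert x A then 1/2 else 1) * h z y) =
      (\<Sum>y\<in>nbhd Z2 z. (if y \<in> A then 1/2 else 1) * h z y) - (if z \<in> nbhd Z2 x then h x z / 2 else 0)"
    for z
  proof -
    have "(\<Sum>y\<in>nbhd Z2 z. (if y \<in> insert x A then 1/2 else 1) * h z y) =
      (\<Sum>y\<in>nbhd Z2 z. (if y \<in> A then 1/2 else 1) * h z y - (if y = x then h z y / 2 else 0))"
      using assms(2) by (intro sum.cong) auto
    also have "\<dots> = (\<Sum>y\<in>nbhd Z2 z. (if y \<in> A then 1/2 else 1) * h z y) - (if x \<in> nbhd Z2 z then h z x / 2 else 0)"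
      by (simp add: sum_subtractf)
    finally show ?thesis by (simp add: mem_nbhd_Z2 adj_Z2_sym h_sym)
  qed
  have new: "(\<Sum>y\<in>nbhd Z2 x. (if y \<in> insert x A then 1/2 else 1) * h x y) =
      (\<Sum>y\<in>nbhd Z2 x - A. h x y) + (\<Sum>z\<in>A. if z \<in> nbhd Z2 x then h x z / 2 else 0)"
  proof -
    have "(\<Sum>y\<in>nbhd Z2 x. (if y \<in> insert x A then 1/2 else 1) * h x y) =
      (\<Sum>y\<in>nbhd Z2 x - A. (if y \<in> insert x A then 1/2 else 1) * h x y) +
      (\<Sum>y\<in>nbhd Z2 x \<inter> A. (if y \<in> insert x A then 1/2 else 1) * h x y)"
      by (subst sum.union_disjoint[symmetric]) (auto intro!: sum.cong)
    also have "(\<Sum>y\<in>nbhd Z2 x - A. (if y \<in> insert x A then 1/2 else 1) * h x y) = (\<Sum>y\<in>nbhd Z2 x - A. h x y)"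
      by (intro sum.cong) (auto simp: mem_nbhd_Z2)
    also have "(\<Sum>y\<in>nbhd Z2 x \<inter> A. (if y \<in> insert x A then 1/2 else 1) * h x y) =
       (\<Sum>z\<in>A. if z \<in> nbhd Z2 x then h x z / 2 else 0)"
      using assms(1) by (simp add: sum.inter_restrict[symmetric] Int_commute)
    finally show ?thesis .
  qed
  have "local_energy \<Phi> (insert x A) \<tau> =
      (\<Phi> (Inl (\<tau> x)) + (\<Sum>y\<in>nbhd Z2 x. (if y \<in> insert x A then 1/2 else 1) * h x y)) +
      (\<Sum>z\<in>A. \<Phi> (Inl (\<tau> z)) + (\<Sum>y\<in>nbhd Z2 z. (if y \<in> insert x A then 1/2 else 1) * h z y))"
    unfolding local_energy_def h_def using assms by (rule sum.insert)
  also have "(\<Sum>z\<in>A. \<Phi> (Inl (\<tau> z)) + (\<Sum>y\<in>nbhd Z2 z. (if y \<in> insert x A then 1/2 else 1) * h z y)) =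
      local_energy \<Phi> A \<tau> - (\<Sum>z\<in>A. if z \<in> nbhd Z2 x then h x z / 2 else 0)"
    unfolding old local_energy_def by (simp add: h_def sum.distrib sum_subtractf)
  finally show ?thesis unfolding new by (simp add: h_def)
qed

section \<open>The graphs and their dismantling\<close>

text \<open>Vertex \<open>0\<close> is the hub: it has a loop and is adjacent to everything except vertex \<open>1\<close>. Vertex \<open>1\<close>
  is the blocker: loopless and adjacent exactly to the colours \<open>2, \<dots>, m + 1\<close>, which form a loopless
  clique. The hub resembles a safe symbol, but a neighbouring blocker forbids it.\<close>
definition blocked_clique :: "nat \<Rightarrow> nat ugraph" where
  "blocked_clique m = \<lparr>nodes = {..<m + 2},
     links = {{u, v} | u v. u < m + 2 \<and> v < m + 2 \<and> (u = v \<longrightarrow> u = 0) \<and> {u, v} \<noteq> {0, 1}}\<rparr>"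

lemma nodes_blocked_clique [simp]: "nodes (blocked_clique m) = {..<m + 2}"
  by (simp add: blocked_clique_def)

lemma adj_blocked_clique:
  "adj (blocked_clique m) u v \<longleftrightarrow>
     u < m + 2 \<and> v < m + 2 \<and> (u = v \<longrightarrow> u = 0) \<and> {u, v} \<noteq> {0, 1}"
  unfolding adj_def blocked_clique_def
  by (auto simp: doubleton_eq_iff)

lemma adj_blocked_clique_sym: "adj (blocked_clique m) u v \<longleftrightarrow> adj (blocked_clique m) v u"
  by (simp add: adj_def insert_commute)

lemma adj_hub: "adj (blocked_clique m) 0 v \<longleftrightarrow> v < m + 2 \<and> v \<noteq> 1"
  by (auto simp: adj_blocked_clique doubleton_eq_iff)

lemma adj_blocker: "adj (blocked_clique m) 1 v \<longleftrightarrow> 2 \<le> v \<and> v < m + 2"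
  by (auto simp: adj_blocked_clique doubleton_eq_iff)

lemma adj_colour:
  "2 \<le> c \<Longrightarrow> adj (blocked_clique m) c v \<longleftrightarrow> c < m + 2 \<and> v < m + 2 \<and> v \<noteq> c"
  by (auto simp: adj_blocked_clique doubleton_eq_iff)

lemma constraint_graph_blocked_clique: "constraint_graph (blocked_clique m)"
  unfolding constraint_graph_def blocked_clique_def by auto

lemma nbhd_induced: "nbhd (induced G W) u = (if u \<in> W then nbhd G u \<inter> W else {})"
  by (auto simp: nbhd_def induced_def adj_def)

lemma adj_induced: "adj (induced G W) u v \<longleftrightarrow> u \<in> W \<and> v \<in> W \<and> adj G u v"
  by (auto simp: induced_def adj_def)

lemma nodes_induced: "nodes (induced G W) = W"
  by (simp add: induced_def)

lemma induced_induced: "W' \<subseteq> W \<Longrightarrow> induced (induced G W) W' = induced G W'"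
  by (auto simp: induced_def)

text \<open>Once the blocker is gone the hub is adjacent to everything that is left, itself included, so
  every other vertex folds onto it.\<close>
lemma folds_to_hub:
  assumes "finite W" "0 \<in> W" "1 \<notin> W" "W \<subseteq> {..<m + 2}"
  shows "folds_to\<^sup>*\<^sup>* (induced (blocked_clique m) W) (induced (blocked_clique m) {0})"
  using assms
proof (induction "card W" arbitrary: W rule: less_induct)
  case less
  show ?case
  proof (cases "W = {0}")
    case False
    then obtain u where u: "u \<in> W" "u \<noteq> 0" using less.prems by blast
    have "folds_to (induced (blocked_clique m) W) (induced (blocked_clique m) (W - {u}))"
      unfolding folds_to_def
    proof (intro bexI conjI)
      show "nbhd (induced (blocked_clique m) W) u \<subseteq> nbhd (induced (blocked_clique m) W) 0"
        using less.prems u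
        by (auto simp: nbhd_induced) (auto simp: nbhd_def adj_blocked_clique doubleton_eq_iff)
      have "induced (blocked_clique m) (W - {u}) = induced (induced (blocked_clique m) W) (W - {u})"
        by (rule induced_induced[symmetric]) auto
      then show "induced (blocked_clique m) (W - {u}) =
          induced (induced (blocked_clique m) W) (nodes (induced (blocked_clique m) W) - {u})"
        by (simp add: induced_def)
    qed (use u less.prems in \<open>auto simp: induced_def\<close>)
    moreover have "folds_to\<^sup>*\<^sup>* (induced (blocked_clique m) (W - {u})) (induced (blocked_clique m) {0})"
      by (rule less.hyps) (use less.prems u in \<open>auto simp del: card_Diff_insert intro!: card_Diff1_less\<close>)
    ultimately show ?thesis by (rule converse_rtranclp_into_rtranclp)
  qed simp
qed

text \<open>The first fold sends the blocker to the hub, whose neighbourhood contains all colours.\<close>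
lemma dismantlable_blocked_clique: "dismantlable (blocked_clique m)"
proof -
  have "folds_to (blocked_clique m) (induced (blocked_clique m) ({..<m + 2} - {1}))"
    unfolding folds_to_def
    by (intro bexI[of _ 1] bexI[of _ 0])
      (auto simp: nbhd_def adj_blocked_clique doubleton_eq_iff)
  then have "folds_to\<^sup>*\<^sup>* (blocked_clique m) (induced (blocked_clique m) {0})"
    by (rule converse_rtranclp_into_rtranclp) (rule folds_to_hub, auto)
  moreover have "card (nodes (induced (blocked_clique m) {0})) = 1"
    by (simp add: induced_def)
  ultimately show ?thesis unfolding dismantlable_def by blast
qed

section \<open>Single-site fillability and topological mixing\<close>

text \<open>If the blocker is not among the four vertices, the hub is a common neighbour. If it is, the other
  three exclude at most three of the \<open>m \<ge> 4\<close> colours. That the common neighbour is never the blocker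
  lets partial configurations be completed by hubs.\<close>
lemma common_neighbour:
  assumes "4 \<le> m" "card S \<le> 4" "finite S" "S \<subseteq> {..<m + 2}"
  shows "\<exists>v<m + 2. v \<noteq> 1 \<and> (\<forall>s\<in>S. adj (blocked_clique m) s v)"
proof (cases "1 \<in> S")
  case False
  then show ?thesis
    using assms(4) by (intro exI[of _ 0]) (auto simp: adj_blocked_clique doubleton_eq_iff)
next
  case True
  have "card (S - {1}) < card {2..<m + 2}"
    using True assms by simp
  then have "\<not> {2..<m + 2} \<subseteq> S - {1}"
    using card_mono[of "S - {1}" "{2..<m + 2}"] assms(3) by auto
  then obtain v where "v \<in> {2..<m + 2}" "v \<notin> S" by force
  then show ?thesis
    using assms(4) by (intro exI[of _ v]) (auto simp: adj_blocked_clique doubleton_eq_iff)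
qed

lemma SSF_blocked_clique:
  assumes "4 \<le> m"
  shows "SSF (blocked_clique m)"
  unfolding SSF_def
proof (intro allI impI ballI)
  fix x B f
  assume B: "B \<subseteq> bdry {x}" and f: "f \<in> graph_hom (induced Z2 B) (blocked_clique m)"
  have fB: "f \<in> B \<rightarrow>\<^sub>E {..<m + 2}"
    and f_adj: "\<And>y z. y \<in> B \<Longrightarrow> z \<in> B \<Longrightarrow> adj Z2 y z \<Longrightarrow> adj (blocked_clique m) (f y) (f z)"
    using f by (auto simp: graph_hom_def adj_induced nodes_induced)
  have B': "B \<subseteq> nbhd Z2 x" using B by (simp add: bdry_singleton)
  then have "finite B" "card B \<le> 4"
    using finite_subset[OF B'] card_mono[OF _ B'] card_nbhd_Z2[of x] by auto
  then have "card (f ` B) \<le> 4" "finite (f ` B)" using card_image_le[of B f] by auto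
  moreover have "f ` B \<subseteq> {..<m + 2}" using fB by auto
  ultimately obtain v where v: "v < m + 2" "\<And>s. s \<in> f ` B \<Longrightarrow> adj (blocked_clique m) s v"
    using common_neighbour[OF assms, of "f ` B"] by blast
  have xB: "x \<notin> B" using B' by (auto simp: mem_nbhd_Z2)
  have v_adj: "adj (blocked_clique m) (f y) v" "adj (blocked_clique m) v (f y)" if "y \<in> B" for y
    using v(2)[of "f y"] that adj_blocked_clique_sym by auto
  have "f(x := v) \<in> insert x B \<rightarrow>\<^sub>E {..<m + 2}"
    using fB v(1) by (intro PiE_fun_upd) auto
  moreover have "adj (blocked_clique m) ((f(x := v)) y) ((f(x := v)) z)"
    if yz: "y \<in> insert x B" "z \<in> insert x B" "adj Z2 y z" for y z
    using yz f_adj[of y z] v_adj[of y] v_adj[of z] by auto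
  ultimately have "f(x := v) \<in> graph_hom (induced Z2 (insert x B)) (blocked_clique m)"
    by (simp add: graph_hom_def adj_induced nodes_induced)
  moreover have "restrict (f(x := v)) B = f"
    using fB xB by (auto simp: restrict_def PiE_def extensional_def)
  ultimately show "\<exists>g\<in>graph_hom (induced Z2 (insert x B)) (blocked_clique m). restrict g B = f" by blast
qed

definition valid_on :: "nat \<Rightarrow> site set \<Rightarrow> (site \<Rightarrow> nat) \<Rightarrow> bool" where
  "valid_on m F \<tau> \<longleftrightarrow> (\<forall>x\<in>F. \<tau> x < m + 2) \<and>
     (\<forall>x\<in>F. \<forall>y\<in>F. adj Z2 x y \<longrightarrow> adj (blocked_clique m) (\<tau> x) (\<tau> y))"

lemma fill_without_blockers:
  assumes "4 \<le> m" "finite G" "valid_on m F \<tau>"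
  shows "\<exists>\<tau>'. valid_on m (F \<union> G) \<tau>' \<and> (\<forall>x\<in>F. \<tau>' x = \<tau> x) \<and> (\<forall>x\<in>G - F. \<tau>' x \<noteq> 1)"
  using assms(2)
proof (induction G rule: finite_induct)
  case empty
  then show ?case using assms(3) by auto
next
  case (insert x G)
  then obtain \<tau>' where \<tau>': "valid_on m (F \<union> G) \<tau>'" "\<And>x. x \<in> F \<Longrightarrow> \<tau>' x = \<tau> x"
    "\<And>x. x \<in> G - F \<Longrightarrow> \<tau>' x \<noteq> 1"
    by blast
  show ?case
  proof (cases "x \<in> F")
    case True
    then show ?thesis using \<tau>' by (auto simp: insert_absorb)
  next
    case False
    let ?S = "\<tau>' ` (nbhd Z2 x \<inter> (F \<union> G))"
    have "card (nbhd Z2 x \<inter> (F \<union> G)) \<le> card (nbhd Z2 x)"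
      by (rule card_mono) auto
    then have "card ?S \<le> 4"
      using card_image_le[of "nbhd Z2 x \<inter> (F \<union> G)" \<tau>'] card_nbhd_Z2[of x] by auto
    moreover have "?S \<subseteq> {..<m + 2}" using \<tau>'(1) by (auto simp: valid_on_def)
    moreover have "finite ?S" by simp
    ultimately obtain v where v: "v < m + 2" "v \<noteq> 1"
      "\<And>s. s \<in> ?S \<Longrightarrow> adj (blocked_clique m) s v"
      using common_neighbour[OF assms(1), of ?S] by blast
    show ?thesis
    proof (intro exI[of _ "\<tau>'(x := v)"] conjI ballI)
      have v_adj: "adj (blocked_clique m) (\<tau>' y) v" "adj (blocked_clique m) v (\<tau>' y)"
        if "adj Z2 x y" "y \<in> F \<union> G" for y
        using v(3)[of "\<tau>' y"] that adj_blocked_clique_sym adj_Z2_sym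
        by (auto simp: mem_nbhd_Z2)
      have "adj (blocked_clique m) ((\<tau>'(x := v)) y) ((\<tau>'(x := v)) z)"
        if yz: "y \<in> F \<union> insert x G" "z \<in> F \<union> insert x G" "adj Z2 y z" for y z
      proof -
        consider "y \<noteq> x" "z \<noteq> x" | "y = x" "z \<noteq> x" | "y \<noteq> x" "z = x"
          using yz(3) not_adj_Z2_self by blast
        then show ?thesis
        proof cases
          case 1
          then show ?thesis using yz \<tau>'(1) by (simp add: valid_on_def)
        next
          case 2
          then show ?thesis using yz v_adj[of z] by auto
        next
          case 3
          then show ?thesis using yz v_adj[of y] adj_Z2_sym[of y x] by auto
        qed
      qed
      then show "valid_on m (F \<union> insert x G) (\<tau>'(x := v))"
        using \<tau>'(1) v(1) by (simp add: valid_on_def)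
    qed (use \<tau>' v False in auto)
  qed
qed

text \<open>It suffices to fill the sites next to \<open>F\<close>: as no blockers are used there, hubs fit everywhere
  else.\<close>
lemma valid_on_extends_to_point:
  assumes "4 \<le> m" "finite F" "valid_on m F \<tau>"
  obtains \<omega> where "\<omega> \<in> points (blocked_clique m)" "\<And>x. x \<in> F \<Longrightarrow> \<omega> x = \<tau> x"
proof -
  define G where "G = (\<Union>x\<in>F. nbhd Z2 x)"
  have "finite G" using assms(2) by (auto simp: G_def)
  then obtain \<tau>' where \<tau>': "valid_on m (F \<union> G) \<tau>'" "\<And>x. x \<in> F \<Longrightarrow> \<tau>' x = \<tau> x"
    "\<And>x. x \<in> G - F \<Longrightarrow> \<tau>' x \<noteq> 1"
    using fill_without_blockers[OF assms(1) \<open>finite G\<close> assms(3)] by blast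
  define \<omega> where "\<omega> x = (if x \<in> F \<union> G then \<tau>' x else 0)" for x
  have edge: "adj (blocked_clique m) (\<omega> x) (\<omega> y)" if "adj Z2 x y" "x \<in> F \<union> G" for x y
  proof (cases "y \<in> F \<union> G")
    case True
    then show ?thesis using that \<tau>'(1) by (simp add: \<omega>_def valid_on_def)
  next
    case False
    then have "x \<notin> F" using that by (auto simp: G_def mem_nbhd_Z2 adj_Z2_sym)
    then have "\<tau>' x \<noteq> 1" "\<tau>' x < m + 2" using that \<tau>' by (auto simp: valid_on_def)
    then show ?thesis
      using that False by (simp add: \<omega>_def adj_blocked_clique_sym[of m "\<tau>' x"] adj_hub)
  qed
  have "\<omega> \<in> points (blocked_clique m)"
    unfolding points_iff
  proof (intro conjI allI impI)
    show "\<omega> x \<in> nodes (blocked_clique m)" for x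
      using \<tau>'(1) by (simp add: \<omega>_def valid_on_def)
    show "adj (blocked_clique m) (\<omega> x) (\<omega> y)" if "adj Z2 x y" for x y
    proof (cases "x \<in> F \<union> G \<or> y \<in> F \<union> G")
      case True
      then show ?thesis
        using edge that by (metis adj_Z2_sym adj_blocked_clique_sym)
    qed (simp add: \<omega>_def adj_hub)
  qed
  then show thesis using that[of \<omega>] \<tau>'(2) by (simp add: \<omega>_def)
qed

text \<open>Sets at distance at least \<open>2\<close> have no edges between them, so gluing preserves local validity, and
  locally valid configurations extend to points.\<close>
lemma TSSM_blocked_clique:
  assumes "4 \<le> m"
  shows "TSSM (blocked_clique m)"
  unfolding TSSM_def
proof (intro exI[of _ 2] allI impI ballI, elim conjE)
  fix A B S \<alpha> \<beta> \<sigma>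
  assume fin: "finite A" "finite B" "finite S"
    and disj: "A \<inter> B = {}" "A \<inter> S = {}" "B \<inter> S = {}"
    and far: "enat 2 \<le> set_gdist Z2 A B"
    and ext: "\<alpha> \<in> A \<rightarrow>\<^sub>E nodes (blocked_clique m)" "\<beta> \<in> B \<rightarrow>\<^sub>E nodes (blocked_clique m)"
      "\<sigma> \<in> S \<rightarrow>\<^sub>E nodes (blocked_clique m)"
    and AS: "globally_admissible (blocked_clique m) (A \<union> S) (override_on \<sigma> \<alpha> A)"
    and SB: "globally_admissible (blocked_clique m) (S \<union> B) (override_on \<beta> \<sigma> S)"
  let ?\<tau> = "override_on (override_on \<beta> \<sigma> S) \<alpha> A"
  obtain \<omega>1 where \<omega>1: "\<omega>1 \<in> points (blocked_clique m)" "override_on \<sigma> \<alpha> A = restrict \<omega>1 (A \<union> S)"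
    using AS by (auto simp: globally_admissible_def)
  obtain \<omega>2 where \<omega>2: "\<omega>2 \<in> points (blocked_clique m)" "override_on \<beta> \<sigma> S = restrict \<omega>2 (S \<union> B)"
    using SB by (auto simp: globally_admissible_def)
  have t1: "?\<tau> x = \<omega>1 x" if "x \<in> A \<union> S" for x
    using fun_cong[OF \<omega>1(2), of x] that disj by (auto simp: override_on_def)
  have t2: "?\<tau> x = \<omega>2 x" if "x \<in> S \<union> B" for x
    using fun_cong[OF \<omega>2(2), of x] that disj by (auto simp: override_on_def)
  have noedge: "\<not> adj Z2 x y" if "x \<in> A" "y \<in> B" for x y
    using order_trans[OF far set_gdist_le[OF that]] by (simp add: adj_Z2)
  have "valid_on m (A \<union> S \<union> B) ?\<tau>"
    unfolding valid_on_def
  proof (intro conjI ballI impI)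
    fix x assume x: "x \<in> A \<union> S \<union> B"
    then consider "x \<in> A \<union> S" | "x \<in> S \<union> B" by blast
    then show "?\<tau> x < m + 2"
      using t1 t2 point_node[OF \<omega>1(1)] point_node[OF \<omega>2(1)] by cases auto
    fix y assume y: "y \<in> A \<union> S \<union> B" and xy: "adj Z2 x y"
    then consider "x \<in> A \<union> S" "y \<in> A \<union> S" | "x \<in> S \<union> B" "y \<in> S \<union> B"
      using x noedge adj_Z2_sym by blast
    then show "adj (blocked_clique m) (?\<tau> x) (?\<tau> y)"
      using t1 t2 point_edge[OF \<omega>1(1) xy] point_edge[OF \<omega>2(1) xy] by cases auto
  qed
  then obtain \<omega> where \<omega>: "\<omega> \<in> points (blocked_clique m)" "\<And>x. x \<in> A \<union> S \<union> B \<Longrightarrow> \<omega> x = ?\<tau> x"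
    using valid_on_extends_to_point[OF assms, of "A \<union> S \<union> B"] fin by blast
  have "?\<tau> = restrict \<omega> (A \<union> S \<union> B)"
  proof
    fix x
    show "?\<tau> x = restrict \<omega> (A \<union> S \<union> B) x"
      using \<omega>(2)[of x] ext
      by (cases "x \<in> A \<union> S \<union> B") (auto simp: override_on_def PiE_def extensional_def)
  qed
  then show "globally_admissible (blocked_clique m) (A \<union> S \<union> B) ?\<tau>"
    using \<omega>(1) by (auto simp: globally_admissible_def)
qed

section \<open>The interaction that rewards the hub\<close>

text \<open>Under this interaction every hub has weight \<open>l\<close> and everything else weight \<open>1\<close>.\<close>
definition hub_interaction :: "nat \<Rightarrow> real \<Rightarrow> nat interaction" where
  "hub_interaction m l =
     (\<lambda>z\<in>nodes (blocked_clique m) <+> links (blocked_clique m). if z = Inl 0 then - ln l else 0)"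

definition hub_weight :: "real \<Rightarrow> nat \<Rightarrow> real" where
  "hub_weight l v = (if v = 0 then l else 1)"

lemma hub_weight_pos: "0 < l \<Longrightarrow> 0 < hub_weight l v"
  by (simp add: hub_weight_def)

lemma hub_interaction_nn: "1 \<le> l \<Longrightarrow> hub_interaction m l \<in> nn_interactions (blocked_clique m)"
  by (auto simp: hub_interaction_def nn_interactions_def)

lemma gibbs_weight_hub_interaction:
  assumes "finite A" "0 < l"
  shows "gibbs_weight (blocked_clique m) (hub_interaction m l) A \<omega> \<alpha> =
    (if override_on \<omega> \<alpha> A \<in> points (blocked_clique m) then \<Prod>x\<in>A. hub_weight l (\<alpha> x) else 0)"
proof (cases "override_on \<omega> \<alpha> A \<in> points (blocked_clique m)")
  case True
  let ?\<tau> = "override_on \<omega> \<alpha> A"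
  have vertex: "hub_interaction m l (Inl (?\<tau> x)) = - ln (hub_weight l (?\<tau> x))" for x
    using point_node[OF True, of x] by (auto simp: hub_interaction_def hub_weight_def)
  have edge: "hub_interaction m l (Inr {?\<tau> x, ?\<tau> y}) = 0" if "y \<in> nbhd Z2 x" for x y
    using point_edge[OF True, of y x] that
    by (auto simp: hub_interaction_def mem_nbhd_Z2 adj_def insert_commute)
  have "energy (hub_interaction m l) A \<omega> \<alpha> = (\<Sum>x\<in>A. - ln (hub_weight l (?\<tau> x)))"
    unfolding energy_eq_local_energy[OF assms(1)] local_energy_def vertex
    by (simp add: edge del: override_on_apply_in override_on_apply_notin)
  also have "\<dots> = (\<Sum>x\<in>A. - ln (hub_weight l (\<alpha> x)))"
    by (intro sum.cong) auto
  finally have "energy (hub_interaction m l) A \<omega> \<alpha> = (\<Sum>x\<in>A. - ln (hub_weight l (\<alpha> x)))" .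
  then have "exp (- energy (hub_interaction m l) A \<omega> \<alpha>) = (\<Prod>x\<in>A. hub_weight l (\<alpha> x))"
    using assms hub_weight_pos by (simp add: sum_negf exp_sum)
  then show ?thesis using True by (simp add: gibbs_weight_def)
qed (simp add: gibbs_weight_def)

section \<open>Single-site resampling\<close>

definition gibbs_mean ::
  "'v ugraph \<Rightarrow> 'v interaction \<Rightarrow> site set \<Rightarrow> (site \<Rightarrow> 'v) \<Rightarrow> ((site \<Rightarrow> 'v) \<Rightarrow> real) \<Rightarrow> real" where
  "gibbs_mean H \<Phi> A \<omega> f =
     (\<Sum>\<alpha>\<in>A \<rightarrow>\<^sub>E nodes H. gibbs H \<Phi> A \<omega> \<alpha> * f (override_on \<omega> \<alpha> A))"

definition allowed :: "nat \<Rightarrow> (site \<Rightarrow> nat) \<Rightarrow> site \<Rightarrow> nat set" where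
  "allowed m \<tau> x = {s. s < m + 2 \<and> (\<forall>y\<in>nbhd Z2 x. adj (blocked_clique m) s (\<tau> y))}"

definition weighted_mean :: "real \<Rightarrow> nat set \<Rightarrow> (nat \<Rightarrow> real) \<Rightarrow> real" where
  "weighted_mean l S \<phi> = (\<Sum>s\<in>S. hub_weight l s * \<phi> s) / (\<Sum>s\<in>S. hub_weight l s)"

text \<open>The conditional expectation of \<open>f\<close> when the spin at \<open>x\<close> is redrawn given its four neighbours. It
  is evaluated on all configurations, valid or not.\<close>
definition resample ::
  "nat \<Rightarrow> real \<Rightarrow> site \<Rightarrow> ((site \<Rightarrow> nat) \<Rightarrow> real) \<Rightarrow> (site \<Rightarrow> nat) \<Rightarrow> real" where
  "resample m l x f \<tau> = weighted_mean l (allowed m \<tau> x) (\<lambda>s. f (\<tau>(x := s)))"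

lemma finite_allowed [simp]: "finite (allowed m \<tau> x)"
  by (simp add: allowed_def)

lemma sum_PiE_insert:
  assumes "x \<notin> A"
  shows "(\<Sum>\<alpha>\<in>insert x A \<rightarrow>\<^sub>E V. F \<alpha>) = (\<Sum>\<eta>\<in>A \<rightarrow>\<^sub>E V. \<Sum>s\<in>V. F (\<eta>(x := s)))"
proof -
  have "(\<Sum>\<alpha>\<in>insert x A \<rightarrow>\<^sub>E V. F \<alpha>) = (\<Sum>(s, \<eta>)\<in>V \<times> (A \<rightarrow>\<^sub>E V). F (\<eta>(x := s)))"
    unfolding PiE_insert_eq
    by (subst sum.reindex[OF inj_combinator[OF assms, of "\<lambda>_. V"]]) (simp add: case_prod_unfold)
  also have "\<dots> = (\<Sum>\<eta>\<in>A \<rightarrow>\<^sub>E V. \<Sum>s\<in>V. F (\<eta>(x := s)))"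
    unfolding sum.cartesian_product[symmetric] by (rule sum.swap)
  finally show ?thesis .
qed

lemma point_upd_iff:
  "\<tau>(x := s) \<in> points (blocked_clique m) \<longleftrightarrow> valid_on m (- {x}) \<tau> \<and> s \<in> allowed m \<tau> x"
proof
  assume "\<tau>(x := s) \<in> points (blocked_clique m)"
  note p = point_node[OF this] point_edge[OF this]
  have "valid_on m (- {x}) \<tau>"
    unfolding valid_on_def
  proof (intro conjI ballI impI)
    fix y assume "y \<in> - {x}"
    then show "\<tau> y < m + 2" using p(1)[of y] by simp
    fix z assume "z \<in> - {x}" "adj Z2 y z"
    then show "adj (blocked_clique m) (\<tau> y) (\<tau> z)" using p(2)[of y z] \<open>y \<in> - {x}\<close> by simp
  qed
  moreover have "adj (blocked_clique m) s (\<tau> y)" if "y \<in> nbhd Z2 x" for y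
    using p(2)[of x y] that by (auto simp: mem_nbhd_Z2 adj_Z2_sym[of y] split: if_splits)
  ultimately show "valid_on m (- {x}) \<tau> \<and> s \<in> allowed m \<tau> x"
    using p(1)[of x] by (simp add: allowed_def)
next
  assume *: "valid_on m (- {x}) \<tau> \<and> s \<in> allowed m \<tau> x"
  then have nb: "adj (blocked_clique m) s (\<tau> y)" "adj (blocked_clique m) (\<tau> y) s"
    if "adj Z2 y x" for y
    using that by (auto simp: allowed_def mem_nbhd_Z2 adj_blocked_clique_sym[of m "\<tau> y"])
  show "\<tau>(x := s) \<in> points (blocked_clique m)"
    unfolding points_iff
  proof (intro conjI allI impI)
    show "(\<tau>(x := s)) y \<in> nodes (blocked_clique m)" for y
      using * by (auto simp: valid_on_def allowed_def)
    show "adj (blocked_clique m) ((\<tau>(x := s)) y) ((\<tau>(x := s)) z)" if "adj Z2 y z" for y z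
    proof -
      have "\<not> (y = x \<and> z = x)" using that by auto
      then consider "y \<noteq> x" "z \<noteq> x" | "y = x" "z \<noteq> x" | "y \<noteq> x" "z = x"
        by blast
      then show ?thesis
      proof cases
        case 1
        then show ?thesis using * that by (simp add: valid_on_def)
      next
        case 2
        then show ?thesis using that nb(1)[of z] adj_Z2_sym by simp
      next
        case 3
        then show ?thesis using that nb(2)[of y] by simp
      qed
    qed
  qed
qed

lemma allowed_upd_self [simp]: "allowed m (\<tau>(x := s)) x = allowed m \<tau> x"
proof -
  have "(\<tau>(x := s)) y = \<tau> y" if "y \<in> nbhd Z2 x" for y
    using that by (cases "y = x") (simp_all add: mem_nbhd_Z2)
  then show ?thesis by (simp add: allowed_def)
qed

text \<open>Given the spins off \<open>x\<close>, the weight of a configuration is a factor that does not depend on the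
  spin at \<open>x\<close> times the weight of that spin, provided the spin is allowed. Averaging over the spin
  thus changes no expectation.\<close>
lemma gibbs_mean_resample:
  assumes "finite A" "x \<in> A" "0 < l"
  shows "gibbs_mean (blocked_clique m) (hub_interaction m l) A \<omega> (resample m l x f) =
    gibbs_mean (blocked_clique m) (hub_interaction m l) A \<omega> f"
proof -
  let ?w = "gibbs_weight (blocked_clique m) (hub_interaction m l) A \<omega>"
  define A' where "A' = A - {x}"
  have A: "A = insert x A'" "x \<notin> A'" "finite A'" using assms by (auto simp: A'_def)
  have site: "(\<Sum>s<m + 2. ?w (\<eta>(x := s)) * resample m l x f (override_on \<omega> (\<eta>(x := s)) A)) =
      (\<Sum>s<m + 2. ?w (\<eta>(x := s)) * f (override_on \<omega> (\<eta>(x := s)) A))" for \<eta>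
  proof -
    define \<tau> where "\<tau> = override_on \<omega> \<eta> A'"
    define r where "r = (if valid_on m (- {x}) \<tau> then \<Prod>y\<in>A'. hub_weight l (\<eta> y) else 0)"
    have ov: "override_on \<omega> (\<eta>(x := s)) A = \<tau>(x := s)" for s
      by (auto simp: \<tau>_def A(1) override_on_def fun_eq_iff)
    have pr: "(\<Prod>y\<in>A'. hub_weight l ((\<eta>(x := s)) y)) = (\<Prod>y\<in>A'. hub_weight l (\<eta> y))" for s
      using A(2) by (intro prod.cong) auto
    have w: "?w (\<eta>(x := s)) = r * (if s \<in> allowed m \<tau> x then hub_weight l s else 0)" for s
      unfolding gibbs_weight_hub_interaction[OF assms(1,3)] ov point_upd_iff
      using A pr by (simp add: r_def)
    have res: "resample m l x f (\<tau>(x := s)) = weighted_mean l (allowed m \<tau> x) (\<lambda>s. f (\<tau>(x := s)))" for s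
      by (simp add: resample_def)
    have restr: "(\<Sum>s<m + 2. ?w (\<eta>(x := s)) * h s) = r * (\<Sum>s\<in>allowed m \<tau> x. hub_weight l s * h s)" for h
    proof -
      have "(\<Sum>s<m + 2. ?w (\<eta>(x := s)) * h s) =
          r * (\<Sum>s<m + 2. if s \<in> allowed m \<tau> x then hub_weight l s * h s else 0)"
        unfolding w sum_distrib_left by (intro sum.cong) auto
      also have "(\<Sum>s<m + 2. if s \<in> allowed m \<tau> x then hub_weight l s * h s else 0) =
          (\<Sum>s\<in>allowed m \<tau> x. hub_weight l s * h s)"
        by (intro sum.mono_neutral_cong_right) (auto simp: allowed_def)
      finally show ?thesis .
    qed
    have "(\<Sum>s\<in>allowed m \<tau> x. hub_weight l s) = 0 \<Longrightarrow> allowed m \<tau> x = {}"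
      using sum_pos[of "allowed m \<tau> x" "hub_weight l"] hub_weight_pos[OF assms(3)] by force
    then have "(\<Sum>s\<in>allowed m \<tau> x. hub_weight l s) *
        weighted_mean l (allowed m \<tau> x) (\<lambda>s. f (\<tau>(x := s))) =
        (\<Sum>s\<in>allowed m \<tau> x. hub_weight l s * f (\<tau>(x := s)))"
      by (cases "(\<Sum>s\<in>allowed m \<tau> x. hub_weight l s) = 0") (auto simp: weighted_mean_def)
    then show ?thesis
      unfolding ov res restr by (simp flip: sum_distrib_right)
  qed
  have "(\<Sum>\<alpha>\<in>A \<rightarrow>\<^sub>E nodes (blocked_clique m). ?w \<alpha> * resample m l x f (override_on \<omega> \<alpha> A)) =
      (\<Sum>\<alpha>\<in>A \<rightarrow>\<^sub>E nodes (blocked_clique m). ?w \<alpha> * f (override_on \<omega> \<alpha> A))"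
    using A(2) site unfolding nodes_blocked_clique by (subst (1 2) A(1)) (simp add: sum_PiE_insert)
  then show ?thesis
    unfolding gibbs_mean_def gibbs_def by (simp flip: sum_divide_distrib)
qed

section \<open>Contraction of the single-site means\<close>

text \<open>Replacing a blocker can change the conditional law of a neighbour almost completely, whereas
  replacing a hub or a colour cannot change it much. A plain count of disagreements is therefore
  not contracted. Charging \<open>12\<close> for a blocker pays for its influence, and costs little on the other
  side because blockers are rare: wherever a blocker is allowed, so is the heavy hub.\<close>
definition spin_dist :: "nat \<Rightarrow> nat \<Rightarrow> real" where
  "spin_dist s t = (if s = t then 0 else if s = 1 \<or> t = 1 then 12 else 1)"

lemma spin_dist_nonneg [simp]: "0 \<le> spin_dist s t"
  and spin_dist_le: "spin_dist s t \<le> 12"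
  and spin_dist_self [simp]: "spin_dist s s = 0"
  by (auto simp: spin_dist_def)

lemma weighted_mean_close:
  assumes "finite S" "S \<noteq> {}" "0 < l"
    and "(\<Sum>s\<in>S. hub_weight l s * \<bar>\<phi> s - c\<bar>) \<le> e * (\<Sum>s\<in>S. hub_weight l s)"
  shows "\<bar>weighted_mean l S \<phi> - c\<bar> \<le> e"
proof -
  let ?Z = "\<Sum>s\<in>S. hub_weight l s"
  have Z: "0 < ?Z" using assms by (intro sum_pos hub_weight_pos) auto
  have "weighted_mean l S \<phi> - c = (\<Sum>s\<in>S. hub_weight l s * (\<phi> s - c)) / ?Z"
    using Z by (simp add: weighted_mean_def algebra_simps sum_subtractf sum_distrib_left diff_divide_distrib)
      (simp add: sum_distrib_left[symmetric])
  also have "\<bar>\<dots>\<bar> \<le> (\<Sum>s\<in>S. hub_weight l s * \<bar>\<phi> s - c\<bar>) / ?Z"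
  proof -
    have "\<bar>\<Sum>s\<in>S. hub_weight l s * (\<phi> s - c)\<bar> \<le> (\<Sum>s\<in>S. \<bar>hub_weight l s * (\<phi> s - c)\<bar>)"
      by (rule sum_abs)
    also have "\<dots> = (\<Sum>s\<in>S. hub_weight l s * \<bar>\<phi> s - c\<bar>)"
      using hub_weight_pos[OF assms(3)] by (intro sum.cong) (simp_all add: abs_mult less_imp_le)
    finally show ?thesis using Z by (simp add: divide_right_mono)
  qed
  also have "\<dots> \<le> e" using assms(4) Z by (simp add: pos_divide_le_eq)
  finally show ?thesis .
qed

text \<open>When the hub is allowed, its weight \<open>l\<close> dominates the at most \<open>m + 1\<close> other spins, each at
  \<open>spin_dist\<close> at most \<open>12\<close> from it; \<open>12 (m + 1) / l \<le> 1/10\<close>.\<close>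
lemma weighted_mean_near_hub:
  assumes "S \<subseteq> {..<m + 2}" "0 \<in> S" "0 < l" "0 \<le> \<delta>" "120 * (real m + 1) \<le> l"
    and "\<And>s. s < m + 2 \<Longrightarrow> \<bar>\<phi> s - \<phi> 0\<bar> \<le> \<delta> * spin_dist s 0"
  shows "\<bar>weighted_mean l S \<phi> - \<phi> 0\<bar> \<le> \<delta> / 10"
proof (rule weighted_mean_close)
  show fin: "finite S" using assms(1) finite_subset by blast
  show "S \<noteq> {}" "0 < l" using assms by auto
  have "(\<Sum>s\<in>S. hub_weight l s * \<bar>\<phi> s - \<phi> 0\<bar>) \<le> (\<Sum>s\<in>S. if s = 0 then 0 else 12 * \<delta>)"
  proof (intro sum_mono)
    fix s assume "s \<in> S"
    then have "\<bar>\<phi> s - \<phi> 0\<bar> \<le> \<delta> * spin_dist s 0" using assms by auto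
    also have "\<dots> \<le> \<delta> * 12" using assms(4) spin_dist_le by (intro mult_left_mono)
    finally show "hub_weight l s * \<bar>\<phi> s - \<phi> 0\<bar> \<le> (if s = 0 then 0 else 12 * \<delta>)"
      by (simp add: hub_weight_def)
  qed
  also have "\<dots> = (\<Sum>s\<in>S - {0}. 12 * \<delta>)"
    using fin by (intro sum.mono_neutral_cong_right) auto
  also have "\<dots> \<le> (\<Sum>s\<in>{1..<m + 2}. 12 * \<delta>)"
    using assms(1,4) by (intro sum_mono2) auto
  also have "\<dots> = (12 * (real m + 1)) * \<delta>" by (simp add: algebra_simps)
  also have "\<dots> \<le> (l / 10) * \<delta>"
    using assms by (intro mult_right_mono) auto
  also have "\<dots> \<le> \<delta> / 10 * (\<Sum>s\<in>S. hub_weight l s)"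
  proof -
    have "hub_weight l 0 \<le> (\<Sum>s\<in>S. hub_weight l s)"
      using assms fin hub_weight_pos[OF assms(3)] by (intro member_le_sum) (auto intro: less_imp_le)
    then have "l \<le> (\<Sum>s\<in>S. hub_weight l s)" by (simp add: hub_weight_def)
    from mult_left_mono[OF this, of "\<delta> / 10"] show ?thesis using assms(4) by (simp add: mult.commute)
  qed
  finally show "(\<Sum>s\<in>S. hub_weight l s * \<bar>\<phi> s - \<phi> 0\<bar>) \<le> \<delta> / 10 * (\<Sum>s\<in>S. hub_weight l s)" .
qed

text \<open>Even when the hub is forbidden, all allowed spins are at distance at most \<open>1\<close> from it,
  except for the blocker, which is allowed only along with the hub and then has probability at most \<open>1/60\<close>; the
  blocker adds \<open>12/60 = 1/5\<close>.\<close>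
lemma weighted_mean_near_hub_value:
  assumes "S \<subseteq> {..<m + 2}" "S \<noteq> {}" "1 \<in> S \<Longrightarrow> 0 \<in> S" "60 \<le> l" "0 \<le> \<delta>"
    and "\<And>s. s < m + 2 \<Longrightarrow> \<bar>\<phi> s - \<phi> 0\<bar> \<le> \<delta> * spin_dist s 0"
  shows "\<bar>weighted_mean l S \<phi> - \<phi> 0\<bar> \<le> 6 / 5 * \<delta>"
proof (rule weighted_mean_close)
  show fin: "finite S" using assms(1) finite_subset by blast
  show "S \<noteq> {}" "0 < l" using assms by auto
  have "(\<Sum>s\<in>S. hub_weight l s * \<bar>\<phi> s - \<phi> 0\<bar>) \<le>
      (\<Sum>s\<in>S. \<delta> * hub_weight l s + (if s = 1 then 12 * \<delta> else 0))"
  proof (intro sum_mono)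
    fix s assume "s \<in> S"
    then have "\<bar>\<phi> s - \<phi> 0\<bar> \<le> \<delta> * spin_dist s 0" using assms by auto
    then have "hub_weight l s * \<bar>\<phi> s - \<phi> 0\<bar> \<le> hub_weight l s * (\<delta> * spin_dist s 0)"
      using hub_weight_pos[of l s] assms(4) by (intro mult_left_mono) auto
    also have "\<dots> \<le> \<delta> * hub_weight l s + (if s = 1 then 12 * \<delta> else 0)"
      using assms(4,5) by (auto simp: spin_dist_def hub_weight_def)
    finally show "hub_weight l s * \<bar>\<phi> s - \<phi> 0\<bar> \<le> \<delta> * hub_weight l s + (if s = 1 then 12 * \<delta> else 0)" .
  qed
  also have "\<dots> = \<delta> * (\<Sum>s\<in>S. hub_weight l s) + (if 1 \<in> S then 12 * \<delta> else 0)"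
    using fin by (simp add: sum.distrib sum_distrib_left)
  also have "(if 1 \<in> S then 12 * \<delta> else 0) \<le> \<delta> / 5 * (\<Sum>s\<in>S. hub_weight l s)"
  proof (cases "1 \<in> S")
    case True
    have "hub_weight l 0 \<le> (\<Sum>s\<in>S. hub_weight l s)"
      using assms(3)[OF True] fin hub_weight_pos[of l] assms(4)
      by (intro member_le_sum) (auto intro: less_imp_le)
    then have "60 \<le> (\<Sum>s\<in>S. hub_weight l s)" using assms(4) by (simp add: hub_weight_def)
    then show ?thesis using True assms(5) mult_left_mono[of 60 _ "\<delta> / 5"] by simp
  next
    case False
    have "0 \<le> (\<Sum>s\<in>S. hub_weight l s)"
      using hub_weight_pos[of l] assms(4) by (intro sum_nonneg) (auto intro: less_imp_le)
    then show ?thesis using False assms(5) by simp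
  qed
  finally show "(\<Sum>s\<in>S. hub_weight l s * \<bar>\<phi> s - \<phi> 0\<bar>) \<le> 6 / 5 * \<delta> * (\<Sum>s\<in>S. hub_weight l s)"
    by (simp add: algebra_simps)
qed

text \<open>On colours the mean is uniform, and one colour among \<open>card P\<close> carries a fraction \<open>1 / card P\<close> of
  it.\<close>
lemma weighted_mean_remove:
  assumes "finite P" "0 \<notin> P" "2 \<le> card P"
    and "\<And>s t. s \<in> P \<Longrightarrow> t \<in> P \<Longrightarrow> \<bar>\<phi> s - \<phi> t\<bar> \<le> \<delta>" "0 \<le> \<delta>"
  shows "\<bar>weighted_mean l (P - {c}) \<phi> - weighted_mean l P \<phi>\<bar> \<le> \<delta> / card P"
proof (cases "c \<in> P")
  case True
  have avg: "weighted_mean l Q \<phi> = (\<Sum>s\<in>Q. \<phi> s) / card Q" if "Q \<subseteq> P" for Q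
  proof -
    have h: "hub_weight l s = 1" if "s \<in> Q" for s
      using that \<open>Q \<subseteq> P\<close> assms(2) by (auto simp: hub_weight_def)
    show ?thesis by (simp add: weighted_mean_def h)
  qed
  define k where "k = real (card P - 1)"
  define T where "T = (\<Sum>s\<in>P - {c}. \<phi> s)"
  have k: "0 < k" "real (card P) = k + 1" "real (card (P - {c})) = k"
    using assms True by (auto simp: k_def)
  have "\<bar>T - k * \<phi> c\<bar> = \<bar>\<Sum>s\<in>P - {c}. \<phi> s - \<phi> c\<bar>"
    using k(3) by (simp add: T_def sum_subtractf del: card_Diff_insert)
  also have "\<dots> \<le> (\<Sum>s\<in>P - {c}. \<bar>\<phi> s - \<phi> c\<bar>)" by (rule sum_abs)
  also have "\<dots> \<le> (\<Sum>s\<in>P - {c}. \<delta>)" using assms True by (intro sum_mono) auto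
  also have "\<dots> = k * \<delta>" using k(3) by (simp del: card_Diff_insert)
  finally have T: "\<bar>T - k * \<phi> c\<bar> \<le> k * \<delta>" .
  have sum_P: "(\<Sum>s\<in>P. \<phi> s) = \<phi> c + T"
    unfolding T_def using assms(1) True by (rule sum.remove)
  have "weighted_mean l (P - {c}) \<phi> - weighted_mean l P \<phi> = T / k - (\<phi> c + T) / (k + 1)"
    unfolding avg[OF order_refl] avg[OF Diff_subset] sum_P k(2,3) T_def ..
  also have "\<dots> = (T - k * \<phi> c) / (k * (k + 1))"
    using k(1) by (simp add: field_simps)
  finally have "\<bar>weighted_mean l (P - {c}) \<phi> - weighted_mean l P \<phi>\<bar> = \<bar>T - k * \<phi> c\<bar> / (k * (k + 1))"
    using k(1) by (simp add: abs_mult)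
  also have "\<dots> \<le> k * \<delta> / (k * (k + 1))"
    using T k(1) by (intro divide_right_mono) auto
  also have "\<dots> = \<delta> / card P" using k by simp
  finally show ?thesis .
qed (use assms in simp)

lemma allowed_nonempty:
  assumes "4 \<le> m" "\<And>x. \<tau> x < m + 2"
  shows "allowed m \<tau> x \<noteq> {}"
proof -
  have "card (\<tau> ` nbhd Z2 x) \<le> 4" "finite (\<tau> ` nbhd Z2 x)" "\<tau> ` nbhd Z2 x \<subseteq> {..<m + 2}"
    using card_image_le[of "nbhd Z2 x" \<tau>] card_nbhd_Z2[of x] assms(2) by auto
  then obtain v where "v < m + 2" "\<forall>s\<in>\<tau> ` nbhd Z2 x. adj (blocked_clique m) s v"
    using common_neighbour[OF assms(1)] by blast
  then have "v \<in> allowed m \<tau> x"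
    by (auto simp: allowed_def adj_blocked_clique_sym[of m v])
  then show ?thesis by blast
qed

lemma hub_allowed:
  assumes "\<And>x. \<tau> x < m + 2" "\<And>y. y \<in> nbhd Z2 x \<Longrightarrow> \<tau> y \<noteq> 1"
  shows "0 \<in> allowed m \<tau> x"
  using assms by (auto simp: allowed_def adj_hub)

lemma blocker_allowed_imp_hub_allowed: "1 \<in> allowed m \<tau> x \<Longrightarrow> 0 \<in> allowed m \<tau> x"
  by (auto simp: allowed_def adj_hub adj_blocker[simplified])

lemma ball_fun_upd:
  "y \<in> N \<Longrightarrow> (\<forall>u\<in>N. P ((f(y := c)) u)) \<longleftrightarrow> P c \<and> (\<forall>u\<in>N - {y}. P (f u))"
  by auto

text \<open>The factor \<open>1/5\<close> is below \<open>1/4\<close>, the reciprocal of the degree of the lattice, as Dobrushin's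
  criterion demands. There are three cases for the changed neighbour \<open>y\<close>. If a blocker appears or
  disappears, both means are within \<open>6/5 \<delta>\<close> of the hub value and their difference is at most
  \<open>12/5 \<delta>\<close>. If no blocker is near \<open>x\<close>, both means are dominated by the hub. If another neighbour
  is a blocker, both means are uniform on a set of at least ten colours with one colour removed.\<close>
lemma weighted_mean_allowed_contraction:
  assumes m: "12 \<le> m" and l: "120 * (real m + 1) \<le> l"
    and \<tau>: "\<And>x. \<tau> x < m + 2" and s: "s < m + 2" and y: "y \<in> nbhd Z2 x"
    and \<delta>: "0 \<le> \<delta>" and \<phi>: "\<And>s t. s < m + 2 \<Longrightarrow> t < m + 2 \<Longrightarrow> \<bar>\<phi> s - \<phi> t\<bar> \<le> \<delta> * spin_dist s t"
  shows "\<bar>weighted_mean l (allowed m (\<tau>(y := s)) x) \<phi> - weighted_mean l (allowed m \<tau> x) \<phi>\<bar>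
     \<le> \<delta> / 5 * spin_dist s (\<tau> y)"
proof -
  let ?S = "allowed m \<tau> x" and ?S' = "allowed m (\<tau>(y := s)) x"
  have \<tau>': "(\<tau>(y := s)) z < m + 2" for z using \<tau> s by simp
  have l60: "60 \<le> l" "0 < l" using l by simp_all
  have sub: "allowed m \<sigma> x \<subseteq> {..<m + 2}" for \<sigma> by (auto simp: allowed_def)
  consider (same) "s = \<tau> y" | (blocker) "s \<noteq> \<tau> y" "s = 1 \<or> \<tau> y = 1"
    | (hub) "s \<noteq> \<tau> y" "s \<noteq> 1" "\<tau> y \<noteq> 1" "\<And>z. z \<in> nbhd Z2 x \<Longrightarrow> \<tau> z \<noteq> 1"
    | (clique) z where "s \<noteq> \<tau> y" "s \<noteq> 1" "\<tau> y \<noteq> 1" "z \<in> nbhd Z2 x" "\<tau> z = 1"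
    by blast
  then show ?thesis
  proof cases
    case same
    then show ?thesis by simp
  next
    case blocker
    have "\<bar>weighted_mean l ?S \<phi> - \<phi> 0\<bar> \<le> 6 / 5 * \<delta>"
      by (intro weighted_mean_near_hub_value[of _ m] sub blocker_allowed_imp_hub_allowed
          allowed_nonempty \<tau> l60 \<delta> \<phi>) (use m in auto)
    moreover have "\<bar>weighted_mean l ?S' \<phi> - \<phi> 0\<bar> \<le> 6 / 5 * \<delta>"
      by (intro weighted_mean_near_hub_value[of _ m] sub blocker_allowed_imp_hub_allowed
          allowed_nonempty \<tau>' l60 \<delta> \<phi>) (use m in auto)
    moreover have "spin_dist s (\<tau> y) = 12" using blocker by (simp add: spin_dist_def)
    ultimately show ?thesis by (simp only:)
  next
    case hub
    have "\<bar>weighted_mean l ?S \<phi> - \<phi> 0\<bar> \<le> \<delta> / 10"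
      by (intro weighted_mean_near_hub[of _ m] sub hub_allowed \<tau> l60 \<delta> l \<phi>) (use hub in auto)
    moreover have "\<bar>weighted_mean l ?S' \<phi> - \<phi> 0\<bar> \<le> \<delta> / 10"
      by (intro weighted_mean_near_hub[of _ m] sub hub_allowed \<tau>' l60 \<delta> l \<phi>) (use hub in auto)
    moreover have "spin_dist s (\<tau> y) = 1" using hub by (simp add: spin_dist_def)
    ultimately show ?thesis by (simp only:)
  next
    case clique
    define P where "P = {v. v < m + 2 \<and> (\<forall>u\<in>nbhd Z2 x - {y}. adj (blocked_clique m) v (\<tau> u))}"
    have zy: "z \<noteq> y" using clique by auto
    have P_sub: "P \<subseteq> {2..<m + 2}"
    proof
      fix v assume "v \<in> P"
      then have "adj (blocked_clique m) v 1"
        using clique zy by (auto simp: P_def dest!: bspec[of _ _ z])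
      then show "v \<in> {2..<m + 2}"
        using adj_blocked_clique_sym[of m v 1] adj_blocker by auto
    qed
    have finP: "finite P" using P_sub finite_subset by blast
    have "{2..<m + 2} - \<tau> ` (nbhd Z2 x - {y, z}) \<subseteq> P"
    proof
      fix v assume v: "v \<in> {2..<m + 2} - \<tau> ` (nbhd Z2 x - {y, z})"
      have "adj (blocked_clique m) v (\<tau> u)" if "u \<in> nbhd Z2 x - {y}" for u
        using v that \<tau>[of u] clique by (cases "u = z") (auto simp: adj_colour)
      then show "v \<in> P" using v by (auto simp: P_def)
    qed
    then have "card ({2..<m + 2} - \<tau> ` (nbhd Z2 x - {y, z})) \<le> card P"
      using finP by (rule card_mono[rotated])
    moreover have "card {2..<m + 2} - card (\<tau> ` (nbhd Z2 x - {y, z})) \<le>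
        card ({2..<m + 2} - \<tau> ` (nbhd Z2 x - {y, z}))"
      by (rule diff_card_le_card_Diff) auto
    moreover have "card (\<tau> ` (nbhd Z2 x - {y, z})) \<le> 2"
    proof -
      have "card (nbhd Z2 x - {y, z}) = 2"
        using y clique(4) zy by (subst card_Diff_subset) (auto simp: card_nbhd_Z2)
      then show ?thesis using card_image_le[of "nbhd Z2 x - {y, z}" \<tau>] by simp
    qed
    ultimately have cardP: "10 \<le> card P" using m by simp
    have split: "allowed m (\<tau>(y := c)) x = P - {c}" if "c \<noteq> 1" "c < m + 2" for c
    proof -
      have "(\<forall>u\<in>nbhd Z2 x. adj (blocked_clique m) v ((\<tau>(y := c)) u)) \<longleftrightarrow>
          adj (blocked_clique m) v c \<and> (\<forall>u\<in>nbhd Z2 x - {y}. adj (blocked_clique m) v (\<tau> u))" for v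
        by (rule ball_fun_upd[OF y])
      then have "allowed m (\<tau>(y := c)) x = {v \<in> P. adj (blocked_clique m) v c}"
        by (auto simp: allowed_def P_def)
      also have "\<dots> = P - {c}"
        using P_sub that by (auto simp: adj_colour)
      finally show ?thesis .
    qed
    have \<phi>P: "\<bar>\<phi> u - \<phi> v\<bar> \<le> \<delta>" if "u \<in> P" "v \<in> P" for u v
    proof -
      have "spin_dist u v \<le> 1" using that P_sub by (auto simp: spin_dist_def)
      then have "\<delta> * spin_dist u v \<le> \<delta>" using \<delta> mult_left_mono[of "spin_dist u v" 1 \<delta>] by simp
      moreover have "\<bar>\<phi> u - \<phi> v\<bar> \<le> \<delta> * spin_dist u v" using that P_sub by (intro \<phi>) auto
      ultimately show ?thesis by linarith
    qed
    have rem: "\<bar>weighted_mean l (P - {c}) \<phi> - weighted_mean l P \<phi>\<bar> \<le> \<delta> / 10" for c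
    proof -
      have "\<bar>weighted_mean l (P - {c}) \<phi> - weighted_mean l P \<phi>\<bar> \<le> \<delta> / card P"
        using finP P_sub cardP \<phi>P \<delta> by (intro weighted_mean_remove) auto
      also have "\<dots> \<le> \<delta> / 10" using cardP \<delta> by (intro divide_left_mono) auto
      finally show ?thesis .
    qed
    have "?S = P - {\<tau> y}" using split[of "\<tau> y"] clique(3) \<tau>[of y] by simp
    moreover have "?S' = P - {s}" using clique(2) s by (rule split)
    moreover have "spin_dist s (\<tau> y) = 1" using clique by (simp add: spin_dist_def)
    ultimately show ?thesis using rem[of s] rem[of "\<tau> y"] by (simp only:)
  qed
qed

section \<open>Strong spatial mixing by Dobrushin's comparison\<close>

text \<open>The bound is required of all configurations with values in the graph, not only of points, so that
  spins can be changed one at a time.\<close>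
definition site_lipschitz ::
  "nat \<Rightarrow> site set \<Rightarrow> (site \<Rightarrow> real) \<Rightarrow> ((site \<Rightarrow> nat) \<Rightarrow> real) \<Rightarrow> bool" where
  "site_lipschitz m F D f \<longleftrightarrow> (\<forall>\<tau> \<tau>'. (\<forall>x. \<tau> x < m + 2) \<and> (\<forall>x. \<tau>' x < m + 2) \<longrightarrow>
     \<bar>f \<tau> - f \<tau>'\<bar> \<le> (\<Sum>x\<in>F. D x * spin_dist (\<tau> x) (\<tau>' x)))"

lemma site_lipschitzD:
  assumes "site_lipschitz m F D f" "\<And>x. \<tau> x < m + 2" "\<And>x. \<tau>' x < m + 2"
  shows "\<bar>f \<tau> - f \<tau>'\<bar> \<le> (\<Sum>x\<in>F. D x * spin_dist (\<tau> x) (\<tau>' x))"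
  using assms by (simp add: site_lipschitz_def)

lemma site_lipschitzI_single:
  assumes "finite F"
    and local: "\<And>\<tau> \<tau>'. (\<And>x. x \<in> F \<Longrightarrow> \<tau> x = \<tau>' x) \<Longrightarrow> f \<tau> = f \<tau>'"
    and single: "\<And>\<tau> y s. (\<And>x. \<tau> x < m + 2) \<Longrightarrow> y \<in> F \<Longrightarrow> s < m + 2 \<Longrightarrow>
      \<bar>f (\<tau>(y := s)) - f \<tau>\<bar> \<le> D y * spin_dist s (\<tau> y)"
  shows "site_lipschitz m F D f"
  unfolding site_lipschitz_def
proof (intro allI impI, elim conjE)
  fix \<tau> \<tau>' :: "site \<Rightarrow> nat"
  assume \<tau>: "\<forall>x. \<tau> x < m + 2" and \<tau>': "\<forall>x. \<tau>' x < m + 2"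
  have "\<bar>f (override_on \<tau>' \<tau> G) - f \<tau>'\<bar> \<le> (\<Sum>x\<in>G. D x * spin_dist (\<tau> x) (\<tau>' x))"
    if "G \<subseteq> F" for G
    using finite_subset[OF that assms(1)] that
  proof (induction G rule: finite_induct)
    case (insert y G)
    let ?\<sigma> = "override_on \<tau>' \<tau> G"
    have upd: "override_on \<tau>' \<tau> (insert y G) = ?\<sigma>(y := \<tau> y)"
      by (auto simp: override_on_def fun_eq_iff)
    have "\<bar>f (?\<sigma>(y := \<tau> y)) - f ?\<sigma>\<bar> \<le> D y * spin_dist (\<tau> y) (?\<sigma> y)"
      using insert.prems \<tau> \<tau>' by (intro single) (auto simp: override_on_def)
    moreover have "?\<sigma> y = \<tau>' y" using insert.hyps by simp
    moreover have "\<bar>f ?\<sigma> - f \<tau>'\<bar> \<le> (\<Sum>x\<in>G. D x * spin_dist (\<tau> x) (\<tau>' x))"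
      using insert by simp
    ultimately show ?case unfolding upd using insert.hyps by (simp del: fun_upd_apply)
  qed simp
  moreover have "f (override_on \<tau>' \<tau> F) = f \<tau>" by (rule local) simp
  ultimately show "\<bar>f \<tau> - f \<tau>'\<bar> \<le> (\<Sum>x\<in>F. D x * spin_dist (\<tau> x) (\<tau>' x))" by force
qed

lemma weighted_mean_mono_abs:
  assumes "finite S" "S \<noteq> {}" "0 < l" "\<And>s. s \<in> S \<Longrightarrow> \<bar>\<phi> s - \<psi> s\<bar> \<le> e"
  shows "\<bar>weighted_mean l S \<phi> - weighted_mean l S \<psi>\<bar> \<le> e"
proof -
  have Z: "0 < (\<Sum>s\<in>S. hub_weight l s)" using assms by (intro sum_pos hub_weight_pos) auto
  have "weighted_mean l S \<phi> - weighted_mean l S \<psi> = weighted_mean l S (\<lambda>s. \<phi> s - \<psi> s) - 0"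
    by (simp add: weighted_mean_def algebra_simps sum_subtractf diff_divide_distrib)
  also have "\<bar>\<dots>\<bar> \<le> e"
  proof (rule weighted_mean_close[OF assms(1-3)])
    show "(\<Sum>s\<in>S. hub_weight l s * \<bar>\<phi> s - \<psi> s - 0\<bar>) \<le> e * (\<Sum>s\<in>S. hub_weight l s)"
      unfolding sum_distrib_left mult.commute[of e]
      using assms hub_weight_pos[OF assms(3)] by (intro sum_mono mult_left_mono) (auto intro: less_imp_le)
  qed
  finally show ?thesis .
qed

text \<open>Resampling at \<open>x\<close> erases the dependence on \<open>x\<close> and spreads a fifth of it to each neighbour of
  \<open>x\<close>.\<close>
lemma site_lipschitz_resample:
  assumes m: "12 \<le> m" and l: "120 * (real m + 1) \<le> l"
    and F: "finite F" "x \<in> F" "nbhd Z2 x \<subseteq> F"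
    and D: "\<And>y. 0 \<le> D y" and f: "site_lipschitz m F D f"
  shows "site_lipschitz m F
    (\<lambda>y. (if y = x then 0 else D y) + (if y \<in> nbhd Z2 x then D x / 5 else 0)) (resample m l x f)"
  unfolding site_lipschitz_def
proof (intro allI impI, elim conjE)
  fix \<tau> \<tau>' :: "site \<Rightarrow> nat"
  assume \<tau>: "\<forall>x. \<tau> x < m + 2" and \<tau>': "\<forall>x. \<tau>' x < m + 2"
  have l0: "0 < l" using l by simp
  define \<phi> where "\<phi> s = f (\<tau>'(x := s))" for s
  have \<phi>: "\<bar>\<phi> s - \<phi> t\<bar> \<le> D x * spin_dist s t" if "s < m + 2" "t < m + 2" for s t
  proof -
    have "\<bar>\<phi> s - \<phi> t\<bar> \<le> (\<Sum>y\<in>F. D y * spin_dist ((\<tau>'(x := s)) y) ((\<tau>'(x := t)) y))"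
      unfolding \<phi>_def using \<tau>' that by (intro site_lipschitzD[OF f]) auto
    also have "\<dots> = (\<Sum>y\<in>F. if y = x then D x * spin_dist s t else 0)"
      by (intro sum.cong) auto
    also have "\<dots> = D x * spin_dist s t" using F by simp
    finally show ?thesis .
  qed
  have "\<bar>weighted_mean l (allowed m \<tau> x) (\<lambda>s. f (\<tau>(x := s))) - weighted_mean l (allowed m \<tau> x) \<phi>\<bar> \<le>
      (\<Sum>y\<in>F. (if y = x then 0 else D y) * spin_dist (\<tau> y) (\<tau>' y))"
  proof (rule weighted_mean_mono_abs)
    show "allowed m \<tau> x \<noteq> {}" using m \<tau> by (intro allowed_nonempty) auto
    fix s assume "s \<in> allowed m \<tau> x"
    then have "s < m + 2" by (simp add: allowed_def)
    then have "\<bar>f (\<tau>(x := s)) - \<phi> s\<bar> \<le> (\<Sum>y\<in>F. D y * spin_dist ((\<tau>(x := s)) y) ((\<tau>'(x := s)) y))"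
      unfolding \<phi>_def using \<tau> \<tau>' by (intro site_lipschitzD[OF f]) auto
    also have "\<dots> = (\<Sum>y\<in>F. (if y = x then 0 else D y) * spin_dist (\<tau> y) (\<tau>' y))"
      by (intro sum.cong) auto
    finally show "\<bar>f (\<tau>(x := s)) - \<phi> s\<bar> \<le> (\<Sum>y\<in>F. (if y = x then 0 else D y) * spin_dist (\<tau> y) (\<tau>' y))" .
  qed (use l0 in auto)
  moreover have "site_lipschitz m (nbhd Z2 x) (\<lambda>_. D x / 5) (\<lambda>\<tau>. weighted_mean l (allowed m \<tau> x) \<phi>)"
  proof (rule site_lipschitzI_single)
    show "weighted_mean l (allowed m \<sigma> x) \<phi> = weighted_mean l (allowed m \<sigma>' x) \<phi>"
      if "\<And>y. y \<in> nbhd Z2 x \<Longrightarrow> \<sigma> y = \<sigma>' y" for \<sigma> \<sigma>'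
    proof -
      have "allowed m \<sigma> x = allowed m \<sigma>' x" using that by (simp add: allowed_def)
      then show ?thesis by simp
    qed
  qed (use weighted_mean_allowed_contraction[OF m l _ _ _ D \<phi>] in auto)
  then have "\<bar>weighted_mean l (allowed m \<tau> x) \<phi> - weighted_mean l (allowed m \<tau>' x) \<phi>\<bar> \<le>
      (\<Sum>y\<in>nbhd Z2 x. D x / 5 * spin_dist (\<tau> y) (\<tau>' y))"
    using \<tau> \<tau>' site_lipschitzD by blast
  moreover have "(\<Sum>y\<in>nbhd Z2 x. D x / 5 * spin_dist (\<tau> y) (\<tau>' y)) =
      (\<Sum>y\<in>F. (if y \<in> nbhd Z2 x then D x / 5 else 0) * spin_dist (\<tau> y) (\<tau>' y))"
    using F by (intro sum.mono_neutral_cong_left) auto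
  ultimately show "\<bar>resample m l x f \<tau> - resample m l x f \<tau>'\<bar> \<le>
      (\<Sum>y\<in>F. ((if y = x then 0 else D y) + (if y \<in> nbhd Z2 x then D x / 5 else 0)) *
        spin_dist (\<tau> y) (\<tau>' y))"
    unfolding resample_def \<phi>_def by (simp only: distrib_right sum.distrib)
qed

text \<open>The entry \<open>a x\<close> bounds how far the two Gibbs measures differ at \<open>x\<close>, tested on functions of
  controlled sensitivity. The boundary sites have entries as well: there the two configurations are
  fixed and may disagree.\<close>
definition comparison_vector ::
  "nat \<Rightarrow> real \<Rightarrow> site set \<Rightarrow> (site \<Rightarrow> nat) \<Rightarrow> (site \<Rightarrow> nat) \<Rightarrow> (site \<Rightarrow> real) \<Rightarrow> bool" where
  "comparison_vector m l A \<omega>1 \<omega>2 a \<longleftrightarrow>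
     (\<forall>D f. (\<forall>x. 0 \<le> D x) \<and> site_lipschitz m (A \<union> bdry A) D f \<longrightarrow>
        \<bar>gibbs_mean (blocked_clique m) (hub_interaction m l) A \<omega>1 f -
         gibbs_mean (blocked_clique m) (hub_interaction m l) A \<omega>2 f\<bar> \<le> (\<Sum>x\<in>A \<union> bdry A. a x * D x))"

lemma comparison_vectorD:
  assumes "comparison_vector m l A \<omega>1 \<omega>2 a" "\<And>x. 0 \<le> D x" "site_lipschitz m (A \<union> bdry A) D f"
  shows "\<bar>gibbs_mean (blocked_clique m) (hub_interaction m l) A \<omega>1 f -
         gibbs_mean (blocked_clique m) (hub_interaction m l) A \<omega>2 f\<bar> \<le> (\<Sum>x\<in>A \<union> bdry A. a x * D x)"
  using assms by (simp add: comparison_vector_def)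

lemma comparison_vector_mono:
  assumes "comparison_vector m l A \<omega>1 \<omega>2 a" "\<And>x. x \<in> A \<union> bdry A \<Longrightarrow> a x \<le> b x"
  shows "comparison_vector m l A \<omega>1 \<omega>2 b"
  unfolding comparison_vector_def
proof (intro allI impI, elim conjE)
  fix D f assume D: "\<forall>x. 0 \<le> D x" "site_lipschitz m (A \<union> bdry A) D f"
  have "(\<Sum>x\<in>A \<union> bdry A. a x * D x) \<le> (\<Sum>x\<in>A \<union> bdry A. b x * D x)"
    using assms(2) D by (intro sum_mono mult_right_mono) auto
  then show "\<bar>gibbs_mean (blocked_clique m) (hub_interaction m l) A \<omega>1 f -
         gibbs_mean (blocked_clique m) (hub_interaction m l) A \<omega>2 f\<bar> \<le> (\<Sum>x\<in>A \<union> bdry A. b x * D x)"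
    using comparison_vectorD[OF assms(1) _ D(2)] D(1) by force
qed

lemma PiE_nodes_less: "\<alpha> \<in> A \<rightarrow>\<^sub>E nodes (blocked_clique m) \<Longrightarrow> \<omega> \<in> points (blocked_clique m) \<Longrightarrow>
   override_on \<omega> \<alpha> A x < m + 2"
  using point_node[of \<omega> "blocked_clique m" x] by (cases "x \<in> A") (auto dest: PiE_mem)

lemma abs_diff_of_means_le:
  fixes f g p q :: "'a \<Rightarrow> real"
  assumes "sum p C = 1" "sum q C = 1" "\<And>x. 0 \<le> p x" "\<And>x. 0 \<le> q x"
    and "\<And>x y. x \<in> C \<Longrightarrow> y \<in> C \<Longrightarrow> \<bar>f x - g y\<bar> \<le> R"
  shows "\<bar>(\<Sum>x\<in>C. p x * f x) - (\<Sum>x\<in>C. q x * g x)\<bar> \<le> R"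
proof -
  have "(\<Sum>x\<in>C. p x * f x) - (\<Sum>x\<in>C. q x * g x) =
      (\<Sum>x\<in>C. p x * f x) * sum q C - sum p C * (\<Sum>x\<in>C. q x * g x)"
    using assms(1,2) by simp
  also have "\<dots> = (\<Sum>x\<in>C. \<Sum>y\<in>C. p x * q y * (f x - g y))"
    unfolding sum_product sum_subtractf[symmetric] by (simp add: algebra_simps)
  also have "\<bar>\<dots>\<bar> \<le> (\<Sum>x\<in>C. \<Sum>y\<in>C. p x * q y * R)"
  proof (rule order.trans[OF sum_abs sum_mono], rule order.trans[OF sum_abs sum_mono])
    fix x y assume "x \<in> C" "y \<in> C"
    then show "\<bar>p x * q y * (f x - g y)\<bar> \<le> p x * q y * R"
      using assms(3-5) by (simp add: abs_mult mult_left_mono)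
  qed
  also have "\<dots> = sum p C * sum q C * R"
    unfolding sum_product unfolding sum_distrib_right ..
  finally show ?thesis using assms(1,2) by simp
qed

lemma comparison_vector_initial:
  assumes "finite A" "\<omega>1 \<in> points (blocked_clique m)" "\<omega>2 \<in> points (blocked_clique m)"
  shows "comparison_vector m l A \<omega>1 \<omega>2
    (\<lambda>x. if x \<in> A \<union> disagreement (bdry A) \<omega>1 \<omega>2 then 12 else 0)"
  unfolding comparison_vector_def
proof (intro allI impI, elim conjE)
  let ?a = "\<lambda>x. if x \<in> A \<union> disagreement (bdry A) \<omega>1 \<omega>2 then 12 else (0::real)"
  fix D :: "site \<Rightarrow> real" and f
  assume D: "\<forall>x. 0 \<le> D x" and f: "site_lipschitz m (A \<union> bdry A) D f"
  define R where "R = (\<Sum>x\<in>A \<union> bdry A. ?a x * D x)"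
  let ?C = "A \<rightarrow>\<^sub>E nodes (blocked_clique m)"
  let ?p1 = "gibbs (blocked_clique m) (hub_interaction m l) A \<omega>1"
  let ?p2 = "gibbs (blocked_clique m) (hub_interaction m l) A \<omega>2"
  let ?f1 = "\<lambda>\<alpha>. f (override_on \<omega>1 \<alpha> A)" and ?f2 = "\<lambda>\<alpha>. f (override_on \<omega>2 \<alpha> A)"
  have one: "(\<Sum>\<alpha>\<in>?C. ?p1 \<alpha>) = 1" "(\<Sum>\<alpha>\<in>?C. ?p2 \<alpha>) = 1"
    using gibbs_sum_eq_1[OF constraint_graph_blocked_clique assms(1)] assms(2,3) by blast+
  have diff: "\<bar>?f1 \<alpha> - ?f2 \<alpha>'\<bar> \<le> R" if "\<alpha> \<in> ?C" "\<alpha>' \<in> ?C" for \<alpha> \<alpha>'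
  proof -
    have "\<bar>?f1 \<alpha> - ?f2 \<alpha>'\<bar> \<le>
        (\<Sum>x\<in>A \<union> bdry A. D x * spin_dist (override_on \<omega>1 \<alpha> A x) (override_on \<omega>2 \<alpha>' A x))"
      using that assms by (intro site_lipschitzD[OF f] PiE_nodes_less) auto
    also have "\<dots> \<le> R"
      unfolding R_def
    proof (rule sum_mono)
      fix x assume "x \<in> A \<union> bdry A"
      then have "spin_dist (override_on \<omega>1 \<alpha> A x) (override_on \<omega>2 \<alpha>' A x) \<le> ?a x"
        using spin_dist_le by (auto simp: disagreement_def)
      then show "D x * spin_dist (override_on \<omega>1 \<alpha> A x) (override_on \<omega>2 \<alpha>' A x) \<le> ?a x * D x"
        using D by (subst mult.commute) (intro mult_right_mono, auto)
    qed
    finally show ?thesis .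
  qed
  show "\<bar>gibbs_mean (blocked_clique m) (hub_interaction m l) A \<omega>1 f -
         gibbs_mean (blocked_clique m) (hub_interaction m l) A \<omega>2 f\<bar> \<le>
         (\<Sum>x\<in>A \<union> bdry A. ?a x * D x)"
    unfolding gibbs_mean_def R_def[symmetric]
    by (rule abs_diff_of_means_le[OF one gibbs_nonneg gibbs_nonneg diff])
qed

text \<open>Neither expectation changes when the test function is resampled at \<open>x\<close>. So the entry at \<open>x\<close> may
  be replaced by a fifth of the sum of the entries at the four neighbours.\<close>
lemma comparison_vector_update:
  assumes m: "12 \<le> m" and l: "120 * (real m + 1) \<le> l" and A: "finite A" "x \<in> A"
    and a: "comparison_vector m l A \<omega>1 \<omega>2 a"
  shows "comparison_vector m l A \<omega>1 \<omega>2 (a(x := (\<Sum>y\<in>nbhd Z2 x. a y) / 5))"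
  unfolding comparison_vector_def
proof (intro allI impI, elim conjE)
  let ?F = "A \<union> bdry A"
  fix D :: "site \<Rightarrow> real" and f
  assume D: "\<forall>x. 0 \<le> D x" and f: "site_lipschitz m ?F D f"
  let ?D' = "\<lambda>y. (if y = x then 0 else D y) + (if y \<in> nbhd Z2 x then D x / 5 else 0)"
  have nb: "nbhd Z2 x \<subseteq> ?F" using A by (auto simp: bdry_eq mem_nbhd_Z2 adj_Z2_sym)
  have F: "finite ?F" "x \<in> ?F" using A by auto
  have l0: "0 < l" using l by simp
  have "\<bar>gibbs_mean (blocked_clique m) (hub_interaction m l) A \<omega>1 (resample m l x f) -
      gibbs_mean (blocked_clique m) (hub_interaction m l) A \<omega>2 (resample m l x f)\<bar> \<le> (\<Sum>y\<in>?F. a y * ?D' y)"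
    using D by (intro comparison_vectorD[OF a] site_lipschitz_resample m l F nb f) auto
  also have "(\<Sum>y\<in>?F. a y * ?D' y) =
      (\<Sum>y\<in>?F. if y = x then 0 else a y * D y) + (\<Sum>y\<in>?F. if y \<in> nbhd Z2 x then a y * (D x / 5) else 0)"
    unfolding sum.distrib[symmetric] by (intro sum.cong) (auto simp: algebra_simps)
  also have "(\<Sum>y\<in>?F. if y \<in> nbhd Z2 x then a y * (D x / 5) else 0) = (\<Sum>y\<in>nbhd Z2 x. a y * (D x / 5))"
    using F nb by (intro sum.mono_neutral_cong_right) auto
  also have "\<dots> = (\<Sum>y\<in>?F. if y = x then (\<Sum>y\<in>nbhd Z2 x. a y) / 5 * D x else 0)"
    using F by (simp add: sum_distrib_right sum_divide_distrib)
  also have "(\<Sum>y\<in>?F. if y = x then 0 else a y * D y) + \<dots> =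
      (\<Sum>y\<in>?F. (a(x := (\<Sum>y\<in>nbhd Z2 x. a y) / 5)) y * D y)"
    unfolding sum.distrib[symmetric] by (intro sum.cong) auto
  finally show "\<bar>gibbs_mean (blocked_clique m) (hub_interaction m l) A \<omega>1 f -
      gibbs_mean (blocked_clique m) (hub_interaction m l) A \<omega>2 f\<bar> \<le>
      (\<Sum>y\<in>?F. (a(x := (\<Sum>y\<in>nbhd Z2 x. a y) / 5)) y * D y)"
    unfolding gibbs_mean_resample[OF A l0] .
qed

text \<open>The distance to \<open>S\<close> truncated at \<open>n\<close>, so that it is finite even when \<open>S\<close> is empty.\<close>
definition level :: "site set \<Rightarrow> nat \<Rightarrow> site \<Rightarrow> nat" where
  "level S n x = the_enat (min (enat n) (set_gdist Z2 {x} S))"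

lemma enat_level: "enat (level S n x) = min (enat n) (set_gdist Z2 {x} S)"
  by (cases "set_gdist Z2 {x} S") (auto simp: level_def min_def)

lemma level_step:
  assumes "adj Z2 y x"
  shows "level S (Suc n) x \<le> Suc (level S n y)"
proof -
  have "set_gdist Z2 {x} S \<le> set_gdist Z2 {y} S + 1"
    using assms by (intro set_gdist_step) (simp add: adj_Z2_sym)
  then show ?thesis
    by (cases "set_gdist Z2 {x} S"; cases "set_gdist Z2 {y} S")
      (auto simp: level_def min_def one_enat_def)
qed

lemma level_mono: "level S n x \<le> level S (Suc n) x"
proof -
  have "enat (level S n x) \<le> enat (level S (Suc n) x)"
    unfolding enat_level by (intro min.mono) auto
  then show ?thesis by simp
qed

lemma level_self: "x \<in> S \<Longrightarrow> level S n x = 0"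
  using set_gdist_le[of x "{x}" x S]
  by (cases "set_gdist Z2 {x} S") (auto simp: level_def l1_dist_def min_def)

text \<open>Updating every site of \<open>A\<close> once gains a factor \<open>4 * 1/5\<close>, until the fixed entries \<open>12\<close> at the
  disagreements are felt, which takes as many rounds as the distance to them. The order of the updates does not matter:
  sites already updated only have smaller entries.\<close>
lemma comparison_vector_level:
  assumes m: "12 \<le> m" and l: "120 * (real m + 1) \<le> l" and A: "finite A"
    and \<omega>: "\<omega>1 \<in> points (blocked_clique m)" "\<omega>2 \<in> points (blocked_clique m)"
  defines "S \<equiv> disagreement (bdry A) \<omega>1 \<omega>2"
  shows "comparison_vector m l A \<omega>1 \<omega>2 (\<lambda>x. if x \<in> A \<union> S then 12 * (4/5) ^ level S n x else 0)"
proof (induction n)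
  case 0
  have "level S 0 x = 0" for x 
    by (cases "set_gdist Z2 {x} S") (auto simp: level_def min_def)
  then show ?case using comparison_vector_initial[OF A \<omega>, folded S_def] by (simp cong: if_cong)
next
  case (Suc n)
  define a where "a T x = (if x \<in> A \<union> S then 12 * (4/5) ^ level S (if x \<in> T then Suc n else n) x else (0::real))"
    for T x
  have a_le: "a T y \<le> 12 * (4/5) ^ level S n y" for T y
    using power_decreasing[OF level_mono[of S n y], of "4/5 :: real"] by (auto simp: a_def)
  have "comparison_vector m l A \<omega>1 \<omega>2 (a T)" if "T \<subseteq> A" for T
    using finite_subset[OF that A] that
  proof (induction T rule: finite_induct)
    case empty
    then show ?case using Suc.IH by (simp add: a_def cong: if_cong)
  next
    case (insert x T)
    have x: "x \<in> A" using insert.prems by simp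
    have "comparison_vector m l A \<omega>1 \<omega>2 ((a T)(x := (\<Sum>y\<in>nbhd Z2 x. a T y) / 5))"
      using insert x by (intro comparison_vector_update m l A) auto
    then show ?case
    proof (rule comparison_vector_mono)
      fix z assume "z \<in> A \<union> bdry A"
      show "((a T)(x := (\<Sum>y\<in>nbhd Z2 x. a T y) / 5)) z \<le> a (insert x T) z"
      proof (cases "z = x")
        case True
        \<comment> \<open>A neighbour is at most one level lower, and \<open>12 / (4/5) = 15\<close>; then \<open>4 * 15 / 5 = 12\<close>.\<close>
        have "(\<Sum>y\<in>nbhd Z2 x. a T y) \<le> (\<Sum>y\<in>nbhd Z2 x. 15 * (4/5) ^ level S (Suc n) x)"
        proof (rule sum_mono)
          fix y assume "y \<in> nbhd Z2 x"
          then have "level S (Suc n) x \<le> Suc (level S n y)"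
            by (intro level_step) (simp add: mem_nbhd_Z2)
          then have "(4/5 :: real) ^ Suc (level S n y) \<le> (4/5) ^ level S (Suc n) x"
            by (intro power_decreasing) auto
          then show "a T y \<le> 15 * (4/5) ^ level S (Suc n) x" using a_le[of T y] by simp
        qed
        then show ?thesis using True x by (simp add: a_def card_nbhd_Z2)
      next
        case False
        then show ?thesis by (simp add: a_def)
      qed
    qed
  qed
  then have "comparison_vector m l A \<omega>1 \<omega>2 (a A)" by simp
  then show ?case
    by (rule comparison_vector_mono) (auto simp: a_def level_self)
qed

lemma gibbs_marginal_eq_mean:
  assumes "B \<subseteq> A" "finite A" "finite (nodes H)"
  shows "gibbs_marginal H \<Phi> A \<omega> B \<beta> =
    gibbs_mean H \<Phi> A \<omega> (\<lambda>\<tau>. if restrict \<tau> B = \<beta> then 1 else 0)"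
proof -
  have fin: "finite (A \<rightarrow>\<^sub>E nodes H)" using assms by (auto intro: finite_PiE)
  have "restrict (override_on \<omega> \<alpha> A) B = restrict \<alpha> B" for \<alpha>
    using assms(1) by (intro restrict_ext) auto
  then show ?thesis
    unfolding gibbs_marginal_def gibbs_mean_def
    by (intro sum.mono_neutral_cong_left fin) auto
qed

text \<open>At infinite distance the hypothesis holds for all \<open>n\<close>, and the limit of the bounds is \<open>0\<close>.\<close>
lemma le_exp_decay:
  assumes "0 < \<gamma>" "\<And>n. enat n \<le> d \<Longrightarrow> u \<le> K * (C * exp (- \<gamma>) ^ n)"
  shows "u \<le> K * exp_decay C \<gamma> d"
proof (cases d)
  case (enat n)
  have "exp (- \<gamma> * real n) = exp (- \<gamma>) ^ n"
    by (metis exp_of_nat_mult mult.commute)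
  then show ?thesis using assms(2)[of n] enat by (simp add: exp_decay_def)
next
  case infinity
  have "(\<lambda>n. K * (C * exp (- \<gamma>) ^ n)) \<longlonglongrightarrow> K * (C * 0)"
    using assms(1) by (intro tendsto_mult tendsto_const LIMSEQ_power_zero) auto
  then have "u \<le> K * (C * 0)"
    by (rule LIMSEQ_le_const) (use assms(2) infinity in auto)
  then show ?thesis using infinity by (simp add: exp_decay_def)
qed

text \<open>The indicator of a configuration on \<open>B\<close> changes by at most \<open>1\<close>, and only if a spin in \<open>B\<close> changes, so
  it is Lipschitz with constant \<open>1\<close> at the sites of \<open>B\<close>, where the comparison vector is small.\<close>
lemma strong_mixing_bound:
  assumes m: "12 \<le> m" and l: "120 * (real m + 1) \<le> l"
    and A: "finite A" "B \<subseteq> A"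
    and \<omega>: "\<omega>1 \<in> points (blocked_clique m)" "\<omega>2 \<in> points (blocked_clique m)"
  shows "\<bar>gibbs_marginal (blocked_clique m) (hub_interaction m l) A \<omega>1 B \<beta> -
      gibbs_marginal (blocked_clique m) (hub_interaction m l) A \<omega>2 B \<beta>\<bar>
    \<le> real (card B) * exp_decay 12 (ln (5/4)) (set_gdist Z2 B (disagreement (bdry A) \<omega>1 \<omega>2))"
    (is "?diff \<le> _")
proof (rule le_exp_decay)
  define S where "S = disagreement (bdry A) \<omega>1 \<omega>2"
  define f where "f = (\<lambda>\<tau>. if restrict \<tau> B = \<beta> then 1 else (0::real))"
  let ?D = "\<lambda>x. if x \<in> B then 1 else (0::real)"
  have B: "finite B" using A finite_subset by blast
  have lip: "site_lipschitz m (A \<union> bdry A) ?D f"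
    unfolding site_lipschitz_def
  proof (intro allI impI)
    fix \<tau> \<tau>' :: "site \<Rightarrow> nat"
    show "\<bar>f \<tau> - f \<tau>'\<bar> \<le> (\<Sum>x\<in>A \<union> bdry A. ?D x * spin_dist (\<tau> x) (\<tau>' x))"
    proof (cases "\<exists>x\<in>B. \<tau> x \<noteq> \<tau>' x")
      case True
      then obtain x where x: "x \<in> B" "\<tau> x \<noteq> \<tau>' x" by blast
      have "\<bar>f \<tau> - f \<tau>'\<bar> \<le> 1" by (simp add: f_def)
      also have "1 \<le> ?D x * spin_dist (\<tau> x) (\<tau>' x)" using x by (simp add: spin_dist_def)
      also have "\<dots> \<le> (\<Sum>x\<in>A \<union> bdry A. ?D x * spin_dist (\<tau> x) (\<tau>' x))"
        using x A by (intro member_le_sum) auto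
      finally show ?thesis .
    next
      case False
      then have "restrict \<tau> B = restrict \<tau>' B" by (intro restrict_ext) auto
      then have "\<bar>f \<tau> - f \<tau>'\<bar> = 0" by (simp add: f_def)
      then show ?thesis by (simp add: sum_nonneg)
    qed
  qed
  show "?diff \<le> real (card B) * (12 * exp (- ln (5/4)) ^ n)"
    if n: "enat n \<le> set_gdist Z2 B (disagreement (bdry A) \<omega>1 \<omega>2)" for n
  proof -
    have "?diff \<le> (\<Sum>x\<in>A \<union> bdry A. (if x \<in> A \<union> S then 12 * (4/5) ^ level S n x else 0) * ?D x)"
      using gibbs_marginal_eq_mean[OF A(2,1), of "blocked_clique m"]
        comparison_vectorD[OF comparison_vector_level[OF m l A(1) \<omega>, of n, folded S_def] _ lip]
      by (simp add: f_def)
    also have "\<dots> = (\<Sum>x\<in>B. 12 * (4/5) ^ level S n x)"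
      using A by (intro sum.mono_neutral_cong_right) auto
    also have "\<dots> = (\<Sum>x\<in>B. 12 * (4/5) ^ n)"
    proof (rule sum.cong)
      fix x assume "x \<in> B"
      then have "set_gdist Z2 B S \<le> set_gdist Z2 {x} S"
        unfolding set_gdist_def by (intro INF_superset_mono) auto
      then have "enat (level S n x) = enat n" unfolding enat_level using order_trans[OF n[folded S_def]] by (simp add: min_def)
      then show "12 * (4/5) ^ level S n x = 12 * (4/5 :: real) ^ n" by simp
    qed simp
    finally show ?thesis by (simp add: exp_minus)
  qed
qed simp

lemma exp_SSM_hub_interaction:
  assumes "12 \<le> m" "120 * (real m + 1) \<le> l"
  shows "exp_SSM (blocked_clique m) (hub_interaction m l) (ln (5/4))"
  unfolding exp_SSM_def
  using strong_mixing_bound[OF assms] by (intro conjI exI[of _ 12]) auto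

section \<open>Away from the boundary, non-hub values are rare\<close>

definition closed_nbhd :: "site \<Rightarrow> site set" where
  "closed_nbhd x = insert x (nbhd Z2 x)"

lemma card_closed_nbhd: "card (closed_nbhd x) \<le> 5" and finite_closed_nbhd [simp]: "finite (closed_nbhd x)"
  using card_insert_le_m1[of 5 "nbhd Z2 x" x] by (auto simp: closed_nbhd_def card_nbhd_Z2)

lemma closed_nbhd_sym: "x \<in> closed_nbhd y \<longleftrightarrow> y \<in> closed_nbhd x"
  by (auto simp: closed_nbhd_def mem_nbhd_Z2 adj_Z2_sym)

definition interior_sites :: "site set \<Rightarrow> site set" where
  "interior_sites A = {x. closed_nbhd x \<subseteq> A}"

text \<open>Sites where a hub may be written without violating a constraint, because no neighbour is a
  blocker.\<close>
definition resettable :: "(site \<Rightarrow> nat) \<Rightarrow> site set" where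
  "resettable \<tau> = {x. \<tau> x = 1 \<or> \<tau> x \<noteq> 0 \<and> (\<forall>y\<in>nbhd Z2 x. \<tau> y \<noteq> 1)}"

text \<open>A colour that cannot be reset has a blocker next to it, and a blocker can be reset.\<close>
lemma resettable_near_nonhub:
  assumes "\<tau> x \<noteq> 0"
  shows "\<exists>z\<in>closed_nbhd x. z \<in> resettable \<tau>"
proof (cases "\<exists>y\<in>nbhd Z2 x. \<tau> y = 1")
  case True
  then show ?thesis by (auto simp: closed_nbhd_def resettable_def)
next
  case False
  then show ?thesis using assms by (auto simp: closed_nbhd_def resettable_def)
qed

lemma reset_point:
  assumes \<tau>: "\<tau> \<in> points (blocked_clique m)" and U: "U \<subseteq> resettable \<tau>"
  shows "override_on \<tau> (\<lambda>_. 0) U \<in> points (blocked_clique m)"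
  unfolding points_iff
proof (intro conjI allI impI)
  let ?\<sigma> = "override_on \<tau> (\<lambda>_. 0) U"
  show "?\<sigma> x \<in> nodes (blocked_clique m)" for x
    using point_node[OF \<tau>, of x] by (cases "x \<in> U") auto
  have keep: "\<tau> y \<noteq> 1" if "adj Z2 x y" "x \<in> U" for x y
  proof
    assume y: "\<tau> y = 1"
    then have "\<tau> x = 1"
      using U that by (auto simp: resettable_def mem_nbhd_Z2 adj_Z2_sym[of y x])
    then show False
      using point_edge[OF \<tau> that(1)] y by (auto simp: adj_blocked_clique)
  qed
  have lt: "\<tau> y < m + 2" for y using point_node[OF \<tau>, of y] by simp
  show "adj (blocked_clique m) (?\<sigma> x) (?\<sigma> y)" if xy: "adj Z2 x y" for x y
  proof -
    consider "x \<notin> U" "y \<notin> U" | "x \<in> U" | "x \<notin> U" "y \<in> U" by blast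
    then show ?thesis
    proof cases
      case 1
      then show ?thesis using point_edge[OF \<tau> xy] by simp
    next
      case 2
      then show ?thesis using keep[OF xy] lt[of y] by (cases "y \<in> U") (auto simp: adj_hub)
    next
      case 3
      then have "\<tau> x \<noteq> 1" using keep[of y x] xy adj_Z2_sym by blast
      then have "adj (blocked_clique m) 0 (\<tau> x)" using lt[of x] by (simp add: adj_hub)
      then show ?thesis using 3 adj_blocked_clique_sym by simp
    qed
  qed
qed

text \<open>A Peierls argument. Writing hubs on all resettable sites within distance \<open>1\<close> of \<open>T\<close> gains a factor
  \<open>L ^ 5\<close> per site, and at least \<open>card T / 5\<close> sites are reset since closed neighbourhoods have five
  elements. The map forgets at most the spins on \<open>5 * card T\<close> sites. The fifth power in the hub
  weight makes the gain at least \<open>L ^ card T\<close>. The hypothesis on \<open>T\<close> keeps the argument away from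
  the boundary, where fixed blockers may force colours.\<close>
lemma nonhub_weight_bound:
  fixes m :: nat and \<omega> :: "site \<Rightarrow> nat"
  assumes A: "finite A" and T: "T \<subseteq> interior_sites A" and L: "1 \<le> L"
  defines "w \<equiv> gibbs_weight (blocked_clique m) (hub_interaction m (L ^ 5)) A \<omega>"
    and "C \<equiv> A \<rightarrow>\<^sub>E nodes (blocked_clique m)"
  shows "(\<Sum>\<alpha>\<in>{\<alpha> \<in> C. \<forall>x\<in>T. \<alpha> x \<noteq> 0}. w \<alpha>) \<le> (real (m + 2) ^ 5 / L) ^ card T * (\<Sum>\<alpha>\<in>C. w \<alpha>)"
proof -
  define W where "W = (\<Union>x\<in>T. closed_nbhd x)"
  define U where "U \<alpha> = resettable (override_on \<omega> \<alpha> A) \<inter> W" for \<alpha>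
  define r where "r \<alpha> = override_on \<alpha> (\<lambda>_. 0) (U \<alpha>)" for \<alpha> :: "site \<Rightarrow> nat"
  let ?P = "{\<alpha> \<in> C. \<forall>x\<in>T. \<alpha> x \<noteq> 0}"
  have WA: "W \<subseteq> A" using T by (auto simp: W_def interior_sites_def)
  have TA: "T \<subseteq> A" using T by (auto simp: interior_sites_def closed_nbhd_def)
  have fin: "finite T" "finite W" "finite C"
    using A TA WA finite_subset by (auto simp: C_def intro: finite_PiE)
  have UW: "U \<alpha> \<subseteq> W" for \<alpha> by (auto simp: U_def)
  have cardW: "card W \<le> 5 * card T"
  proof -
    have "card W \<le> (\<Sum>x\<in>T. card (closed_nbhd x))" unfolding W_def using fin(1) by (rule card_UN_le)
    also have "\<dots> \<le> (\<Sum>x\<in>T. 5)" using card_closed_nbhd by (intro sum_mono)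
    finally show ?thesis by simp
  qed
  have l0: "0 < L ^ 5" using L by simp
  have w_eq: "w \<alpha> = (if override_on \<omega> \<alpha> A \<in> points (blocked_clique m)
      then \<Prod>x\<in>A. hub_weight (L ^ 5) (\<alpha> x) else 0)" for \<alpha>
    unfolding w_def by (rule gibbs_weight_hub_interaction[OF A l0])
  have w0: "0 \<le> w \<alpha>" for \<alpha> by (simp add: w_def gibbs_weight_def)
  have gain: "w \<alpha> * L ^ card T \<le> w (r \<alpha>)" if \<alpha>: "\<alpha> \<in> ?P" for \<alpha>
  proof (cases "override_on \<omega> \<alpha> A \<in> points (blocked_clique m)")
    case True
    have "override_on \<omega> (r \<alpha>) A = override_on (override_on \<omega> \<alpha> A) (\<lambda>_. 0) (U \<alpha>)"
      using WA UW[of \<alpha>] by (auto simp: override_on_def r_def fun_eq_iff)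
    then have pt: "override_on \<omega> (r \<alpha>) A \<in> points (blocked_clique m)"
      using reset_point[OF True, of "U \<alpha>"] by (auto simp: U_def)
    have finU: "finite (U \<alpha>)" using fin(2) UW finite_subset by blast
    have one: "hub_weight (L ^ 5) (\<alpha> x) = 1" if "x \<in> U \<alpha>" for x
    proof -
      have "x \<in> A" using that UW WA by blast
      then show ?thesis using that by (auto simp: U_def resettable_def hub_weight_def)
    qed
    have "(\<Prod>x\<in>A. hub_weight (L ^ 5) (r \<alpha> x)) =
        (\<Prod>x\<in>A. hub_weight (L ^ 5) (\<alpha> x) * (if x \<in> U \<alpha> then L ^ 5 else 1))"
      using one by (intro prod.cong) (auto simp: r_def hub_weight_def)
    also have "\<dots> = (\<Prod>x\<in>A. hub_weight (L ^ 5) (\<alpha> x)) * (\<Prod>x\<in>A. if x \<in> U \<alpha> then L ^ 5 else 1)"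
      by (rule prod.distrib)
    also have "(\<Prod>x\<in>A. if x \<in> U \<alpha> then L ^ 5 else 1) = (\<Prod>x\<in>U \<alpha>. L ^ 5)"
      using WA UW[of \<alpha>] A by (intro prod.mono_neutral_cong_right) auto
    also have "\<dots> = L ^ (5 * card (U \<alpha>))" by (simp add: power_mult)
    finally have wr: "w (r \<alpha>) = w \<alpha> * L ^ (5 * card (U \<alpha>))"
      using pt True by (simp add: w_eq)
    have "T \<subseteq> (\<Union>z\<in>U \<alpha>. closed_nbhd z)"
    proof
      fix x assume x: "x \<in> T"
      then have "override_on \<omega> \<alpha> A x \<noteq> 0" using \<alpha> TA by auto
      then obtain z where "z \<in> closed_nbhd x" "z \<in> resettable (override_on \<omega> \<alpha> A)"
        using resettable_near_nonhub by blast
      then show "x \<in> (\<Union>z\<in>U \<alpha>. closed_nbhd z)"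
        using x closed_nbhd_sym[of x z] by (auto simp: U_def W_def)
    qed
    then have "card T \<le> card (\<Union>z\<in>U \<alpha>. closed_nbhd z)"
      using finU by (intro card_mono) auto
    also have "\<dots> \<le> (\<Sum>z\<in>U \<alpha>. card (closed_nbhd z))" using finU by (rule card_UN_le)
    also have "\<dots> \<le> (\<Sum>z\<in>U \<alpha>. 5)" using card_closed_nbhd by (intro sum_mono)
    finally have "card T \<le> 5 * card (U \<alpha>)" by simp
    then show ?thesis unfolding wr using L w0 by (intro mult_left_mono power_increasing)
  next
    case False
    then show ?thesis using w0[of "r \<alpha>"] by (simp add: w_eq)
  qed
  have rC: "r ` ?P \<subseteq> C"
    using WA UW by (fastforce simp: C_def r_def override_on_def PiE_def Pi_def extensional_def)
  have fibre: "card {\<alpha> \<in> ?P. r \<alpha> = \<beta>} \<le> (m + 2) ^ (5 * card T)" for \<beta>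
  proof -
    have "inj_on (\<lambda>\<alpha>. restrict \<alpha> W) {\<alpha> \<in> ?P. r \<alpha> = \<beta>}"
    proof (rule inj_onI)
      fix \<alpha> \<alpha>' assume *: "\<alpha> \<in> {\<alpha> \<in> ?P. r \<alpha> = \<beta>}" "\<alpha>' \<in> {\<alpha> \<in> ?P. r \<alpha> = \<beta>}"
        "restrict \<alpha> W = restrict \<alpha>' W"
      show "\<alpha> = \<alpha>'"
      proof
        fix x show "\<alpha> x = \<alpha>' x"
        proof (cases "x \<in> W")
          case True
          then show ?thesis using fun_cong[OF *(3), of x] by simp
        next
          case False
          then have "r \<alpha> x = \<alpha> x" "r \<alpha>' x = \<alpha>' x" using UW by (auto simp: r_def override_on_def)
          then show ?thesis using * by simp
        qed
      qed
    qed
    moreover have "(\<lambda>\<alpha>. restrict \<alpha> W) ` {\<alpha> \<in> ?P. r \<alpha> = \<beta>} \<subseteq> W \<rightarrow>\<^sub>E {..<m + 2}"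
      using WA by (auto simp: C_def)
    moreover have "finite (W \<rightarrow>\<^sub>E {..<m + 2})" using fin by (intro finite_PiE) auto
    ultimately have "card {\<alpha> \<in> ?P. r \<alpha> = \<beta>} \<le> card (W \<rightarrow>\<^sub>E {..<m + 2})"
      by (rule card_inj_on_le)
    also have "\<dots> = (m + 2) ^ card W" using fin by (simp add: card_PiE)
    also have "\<dots> \<le> (m + 2) ^ (5 * card T)" using cardW by (intro power_increasing) auto
    finally show ?thesis .
  qed
  have "(\<Sum>\<alpha>\<in>?P. w \<alpha>) * L ^ card T \<le> (\<Sum>\<alpha>\<in>?P. w (r \<alpha>))"
    unfolding sum_distrib_right using gain by (rule sum_mono)
  also have "\<dots> = (\<Sum>\<beta>\<in>C. \<Sum>\<alpha>\<in>{\<alpha> \<in> ?P. r \<alpha> = \<beta>}. w (r \<alpha>))"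
    using fin rC by (intro sum.group[symmetric]) auto
  also have "\<dots> = (\<Sum>\<beta>\<in>C. real (card {\<alpha> \<in> ?P. r \<alpha> = \<beta>}) * w \<beta>)"
    by (intro sum.cong) auto
  also have "\<dots> \<le> (\<Sum>\<beta>\<in>C. real ((m + 2) ^ (5 * card T)) * w \<beta>)"
    using fibre w0 by (intro sum_mono mult_right_mono) (auto simp del: of_nat_power)
  also have "\<dots> = (real (m + 2) ^ 5) ^ card T * (\<Sum>\<beta>\<in>C. w \<beta>)"
    by (simp add: sum_distrib_left power_mult)
  finally show ?thesis
    using L by (simp add: power_divide field_simps)
qed

lemma partition_function_pos:
  assumes "constraint_graph H" "finite A" "\<omega> \<in> points H"
  shows "0 < (\<Sum>\<alpha>\<in>A \<rightarrow>\<^sub>E nodes H. gibbs_weight H \<Phi> A \<omega> \<alpha>)"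
proof -
  have "0 \<le> (\<Sum>\<alpha>\<in>A \<rightarrow>\<^sub>E nodes H. gibbs_weight H \<Phi> A \<omega> \<alpha>)"
    by (intro sum_nonneg) (simp add: gibbs_weight_def)
  moreover have "(\<Sum>\<alpha>\<in>A \<rightarrow>\<^sub>E nodes H. gibbs_weight H \<Phi> A \<omega> \<alpha>) \<noteq> 0"
  proof
    assume "(\<Sum>\<alpha>\<in>A \<rightarrow>\<^sub>E nodes H. gibbs_weight H \<Phi> A \<omega> \<alpha>) = 0"
    then have "(\<Sum>\<alpha>\<in>A \<rightarrow>\<^sub>E nodes H. gibbs H \<Phi> A \<omega> \<alpha>) = 0" by (simp add: gibbs_def)
    then show False using gibbs_sum_eq_1[OF assms, of \<Phi>] by simp
  qed
  ultimately show ?thesis by simp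
qed

lemma nonhub_probability_bound:
  assumes A: "finite A" and T: "T \<subseteq> interior_sites A" and L: "1 \<le> L"
    and \<omega>: "\<omega> \<in> points (blocked_clique m)"
  shows "(\<Sum>\<alpha>\<in>{\<alpha> \<in> A \<rightarrow>\<^sub>E nodes (blocked_clique m). \<forall>x\<in>T. \<alpha> x \<noteq> 0}.
      gibbs (blocked_clique m) (hub_interaction m (L ^ 5)) A \<omega> \<alpha>) \<le> (real (m + 2) ^ 5 / L) ^ card T"
proof -
  let ?C = "A \<rightarrow>\<^sub>E nodes (blocked_clique m)"
  let ?w = "gibbs_weight (blocked_clique m) (hub_interaction m (L ^ 5)) A \<omega>"
  have Z: "0 < (\<Sum>\<alpha>\<in>?C. ?w \<alpha>)"
    by (rule partition_function_pos[OF constraint_graph_blocked_clique A \<omega>])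
  have "(\<Sum>\<alpha>\<in>{\<alpha> \<in> ?C. \<forall>x\<in>T. \<alpha> x \<noteq> 0}. ?w \<alpha>) / (\<Sum>\<alpha>\<in>?C. ?w \<alpha>) \<le> (real (m + 2) ^ 5 / L) ^ card T"
    using nonhub_weight_bound[OF A T L, where m = m and \<omega> = \<omega>] Z by (simp only: pos_divide_le_eq)
  then show ?thesis by (simp add: gibbs_def sum_divide_distrib)
qed

lemma sum_UN_le_sum_sum:
  fixes f :: "'a \<Rightarrow> real"
  assumes "finite I" "\<And>i. i \<in> I \<Longrightarrow> finite (A i)" "\<And>x. 0 \<le> f x"
  shows "sum f (\<Union>i\<in>I. A i) \<le> (\<Sum>i\<in>I. sum f (A i))"
  using assms(1,2)
proof (induction I rule: finite_induct)
  case (insert i I)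
  have "sum f (A i \<union> (\<Union>i\<in>I. A i)) \<le> sum f (A i) + sum f (\<Union>i\<in>I. A i)"
    using insert assms(3) sum_nonneg[of "A i \<inter> (\<Union>i\<in>I. A i)" f] by (subst sum_Un) auto
  then show ?case using insert by simp
qed simp

text \<open>Every site of \<open>S\<close> is charged to one of the two copies; the copies are independent, and there are
  \<open>2 ^ card S\<close> ways to charge.\<close>
lemma nonhub_pair_bound:
  fixes m :: nat and \<omega>1 \<omega>2 :: "site \<Rightarrow> nat"
  assumes A: "finite A" and S: "S \<subseteq> interior_sites A" and L: "1 \<le> L"
    and \<omega>: "\<omega>1 \<in> points (blocked_clique m)" "\<omega>2 \<in> points (blocked_clique m)"
  defines "p1 \<equiv> gibbs (blocked_clique m) (hub_interaction m (L ^ 5)) A \<omega>1"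
    and "p2 \<equiv> gibbs (blocked_clique m) (hub_interaction m (L ^ 5)) A \<omega>2"
    and "C \<equiv> A \<rightarrow>\<^sub>E nodes (blocked_clique m)"
  shows "(\<Sum>(\<alpha>, \<alpha>')\<in>{(\<alpha>, \<alpha>') \<in> C \<times> C. \<forall>x\<in>S. \<alpha> x \<noteq> 0 \<or> \<alpha>' x \<noteq> 0}. p1 \<alpha> * p2 \<alpha>')
    \<le> (2 * (real (m + 2) ^ 5 / L)) ^ card S"
proof -
  let ?\<eta> = "real (m + 2) ^ 5 / L"
  have SA: "S \<subseteq> A" using S by (auto simp: interior_sites_def closed_nbhd_def)
  have fin: "finite S" "finite C" using A SA finite_subset by (auto simp: C_def intro: finite_PiE)
  have p0: "0 \<le> p1 \<alpha>" "0 \<le> p2 \<alpha>" for \<alpha> by (simp_all add: p1_def p2_def gibbs_nonneg)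
  let ?E = "\<lambda>T. {\<alpha> \<in> C. \<forall>x\<in>T. \<alpha> x \<noteq> 0}"
  have "{(\<alpha>, \<alpha>') \<in> C \<times> C. \<forall>x\<in>S. \<alpha> x \<noteq> 0 \<or> \<alpha>' x \<noteq> 0} \<subseteq> (\<Union>T\<in>Pow S. ?E T \<times> ?E (S - T))"
  proof safe
    fix \<alpha> \<alpha>' assume "\<alpha> \<in> C" "\<alpha>' \<in> C" and *: "\<forall>x\<in>S. \<alpha> x \<noteq> 0 \<or> \<alpha>' x \<noteq> 0"
    then show "(\<alpha>, \<alpha>') \<in> (\<Union>T\<in>Pow S. ?E T \<times> ?E (S - T))"
      by (intro UN_I[of "{x \<in> S. \<alpha> x \<noteq> 0}"]) auto
  qed
  then have "(\<Sum>(\<alpha>, \<alpha>')\<in>{(\<alpha>, \<alpha>') \<in> C \<times> C. \<forall>x\<in>S. \<alpha> x \<noteq> 0 \<or> \<alpha>' x \<noteq> 0}. p1 \<alpha> * p2 \<alpha>') \<le>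
      (\<Sum>(\<alpha>, \<alpha>')\<in>(\<Union>T\<in>Pow S. ?E T \<times> ?E (S - T)). p1 \<alpha> * p2 \<alpha>')"
    using fin p0 by (intro sum_mono2) auto
  also have "\<dots> \<le> (\<Sum>T\<in>Pow S. \<Sum>(\<alpha>, \<alpha>')\<in>?E T \<times> ?E (S - T). p1 \<alpha> * p2 \<alpha>')"
    using fin p0 by (intro sum_UN_le_sum_sum) auto
  also have "\<dots> = (\<Sum>T\<in>Pow S. (\<Sum>\<alpha>\<in>?E T. p1 \<alpha>) * (\<Sum>\<alpha>\<in>?E (S - T). p2 \<alpha>))"
    by (simp add: sum_product sum.cartesian_product)
  also have "\<dots> \<le> (\<Sum>T\<in>Pow S. ?\<eta> ^ card T * ?\<eta> ^ card (S - T))"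
  proof (intro sum_mono mult_mono)
    fix T assume "T \<in> Pow S"
    then have T: "T \<subseteq> interior_sites A" "S - T \<subseteq> interior_sites A" using S by auto
    show "(\<Sum>\<alpha>\<in>?E T. p1 \<alpha>) \<le> ?\<eta> ^ card T"
      unfolding p1_def C_def by (rule nonhub_probability_bound[OF A T(1) L \<omega>(1)])
    show "(\<Sum>\<alpha>\<in>?E (S - T). p2 \<alpha>) \<le> ?\<eta> ^ card (S - T)"
      unfolding p2_def C_def by (rule nonhub_probability_bound[OF A T(2) L \<omega>(2)])
  qed (use L p0 in \<open>auto intro!: sum_nonneg\<close>)
  also have "\<dots> = (\<Sum>T\<in>Pow S. ?\<eta> ^ card S)"
  proof (intro sum.cong refl)
    fix T assume "T \<in> Pow S"
    then have "card T + card (S - T) = card S"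
      using fin(1) by (metis PowD card_Diff_subset card_mono finite_subset le_add_diff_inverse)
    then show "?\<eta> ^ card T * ?\<eta> ^ card (S - T) = ?\<eta> ^ card S"
      by (metis power_add)
  qed
  also have "\<dots> = (2 * ?\<eta>) ^ card S"
  proof -
    have "real (card (Pow S)) = 2 ^ card S" using fin by (simp add: card_Pow)
    then show ?thesis by (simp only: sum_constant power_mult_distrib)
  qed
  finally show ?thesis .
qed

section \<open>Weak spatial mixing by swapping two copies\<close>

primrec lattice_paths :: "nat \<Rightarrow> site \<Rightarrow> site list set" where
  "lattice_paths 0 x = {[]}"
| "lattice_paths (Suc k) x = (#) x ` (\<Union>y\<in>nbhd Z2 x. lattice_paths k y)"

lemma finite_lattice_paths [simp]: "finite (lattice_paths k x)"
  by (induction k arbitrary: x) auto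

lemma card_lattice_paths: "card (lattice_paths k x) \<le> 4 ^ k"
proof (induction k arbitrary: x)
  case (Suc k)
  have "card (lattice_paths (Suc k) x) \<le> card (\<Union>y\<in>nbhd Z2 x. lattice_paths k y)"
    unfolding lattice_paths.simps by (rule card_image_le) auto
  also have "\<dots> \<le> (\<Sum>y\<in>nbhd Z2 x. card (lattice_paths k y))" by (rule card_UN_le) auto
  also have "\<dots> \<le> (\<Sum>y\<in>nbhd Z2 x. 4 ^ k)" by (intro sum_mono Suc.IH)
  finally show ?case by (simp add: card_nbhd_Z2)
qed simp

lemma length_lattice_paths: "xs \<in> lattice_paths k x \<Longrightarrow> length xs = k"
  by (induction k arbitrary: x xs) auto

lemma take_in_lattice_paths:
  assumes "successively (adj Z2) (x # xs)" "k \<le> Suc (length xs)"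
  shows "take k (x # xs) \<in> lattice_paths k x"
  using assms
proof (induction k arbitrary: x xs)
  case (Suc k)
  show ?case
  proof (cases xs)
    case Nil
    then have "k = 0" using Suc.prems by simp
    then show ?thesis by (auto simp: nbhd_Z2)
  next
    case (Cons y ys)
    then have "take k (y # ys) \<in> lattice_paths k y" "y \<in> nbhd Z2 x"
      using Suc by (auto simp: mem_nbhd_Z2 adj_Z2_sym)
    then show ?thesis using Cons by auto
  qed
qed simp

lemma l1_dist_along_path:
  assumes "successively (adj Z2) (x # xs)" "i \<le> length xs"
  shows "l1_dist x ((x # xs) ! i) \<le> i"
  using assms
proof (induction i arbitrary: x xs)
  case (Suc i)
  then obtain y ys where xs: "xs = y # ys" by (cases xs) auto
  have "l1_dist y ((y # ys) ! i) \<le> i" using Suc xs by auto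
  moreover have "l1_dist x y = 1" using Suc.prems xs by (simp add: adj_Z2)
  ultimately show ?case using l1_dist_triangle[of x "(y # ys) ! i" y] xs by simp
qed simp

definition cluster :: "site set \<Rightarrow> site set \<Rightarrow> site set" where
  "cluster B N = {y. \<exists>x\<in>B \<inter> N. (\<lambda>u v. adj Z2 u v \<and> u \<in> N \<and> v \<in> N)\<^sup>*\<^sup>* x y}"

lemma cluster_subset: "cluster B N \<subseteq> N"
proof
  fix y assume "y \<in> cluster B N"
  then obtain x where "x \<in> N" "(\<lambda>u v. adj Z2 u v \<and> u \<in> N \<and> v \<in> N)\<^sup>*\<^sup>* x y"
    by (auto simp: cluster_def)
  from this(2,1) show "y \<in> N" by (induction rule: rtranclp_induct) auto
qed

lemma cluster_start: "x \<in> B \<Longrightarrow> x \<in> N \<Longrightarrow> x \<in> cluster B N"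
  by (auto simp: cluster_def)

lemma cluster_step:
  assumes "y \<in> cluster B N" "adj Z2 y z" "z \<in> N"
  shows "z \<in> cluster B N"
proof -
  have "y \<in> N" using assms(1) cluster_subset by blast
  then show ?thesis
    using assms unfolding cluster_def by (auto intro: rtranclp.rtrancl_into_rtrancl)
qed

text \<open>A walk that returns to a visited site is cut at the first visit, so the path may be taken
  self-avoiding.\<close>
lemma cluster_path:
  assumes "y \<in> cluster B N"
  shows "\<exists>x xs. x \<in> B \<and> distinct (x # xs) \<and> set (x # xs) \<subseteq> N \<and>
    successively (adj Z2) (x # xs) \<and> last (x # xs) = y"
proof -
  obtain x where x: "x \<in> B" "x \<in> N" "(\<lambda>u v. adj Z2 u v \<and> u \<in> N \<and> v \<in> N)\<^sup>*\<^sup>* x y"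
    using assms by (auto simp: cluster_def)
  from x(3) have "\<exists>xs. distinct (x # xs) \<and> set (x # xs) \<subseteq> N \<and>
    successively (adj Z2) (x # xs) \<and> last (x # xs) = y"
  proof (induction rule: rtranclp_induct)
    case base
    then show ?case using x(2) by (intro exI[of _ "[]"]) simp
  next
    case (step y z)
    then obtain xs where xs: "distinct (x # xs)" "set (x # xs) \<subseteq> N"
      "successively (adj Z2) (x # xs)" "last (x # xs) = y" by blast
    show ?case
    proof (cases "z \<in> set (x # xs)")
      case True
      then obtain ys zs where split: "x # xs = ys @ z # zs" by (meson split_list)
      have eq: "x # xs = (ys @ [z]) @ zs" using split by simp
      obtain us where us: "ys @ [z] = x # us" using split by (cases ys) auto
      show ?thesis
      proof (intro exI[of _ us] conjI)
        show "distinct (x # us)" "set (x # us) \<subseteq> N" "successively (adj Z2) (x # us)"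
          using xs(1-3) unfolding eq us[symmetric] by (auto simp: successively_append_iff)
        show "last (x # us) = z" unfolding us[symmetric] by simp
      qed
    next
      case False
      have "successively (adj Z2) ((x # xs) @ [z])"
        unfolding successively_append_iff using xs step.hyps(2) by auto
      then show ?thesis
        using xs False step.hyps(2) by (intro exI[of _ "xs @ [z]"]) auto
    qed
  qed
  then show ?thesis using x(1) by blast
qed

definition nonhub_sites :: "site set \<Rightarrow> (site \<Rightarrow> nat) \<times> (site \<Rightarrow> nat) \<Rightarrow> site set" where
  "nonhub_sites A c = {x \<in> A. fst c x \<noteq> 0 \<or> snd c x \<noteq> 0}"

definition swap_on :: "site set \<Rightarrow> (site \<Rightarrow> nat) \<times> (site \<Rightarrow> nat) \<Rightarrow> (site \<Rightarrow> nat) \<times> (site \<Rightarrow> nat)" where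
  "swap_on D c = (override_on (fst c) (snd c) D, override_on (snd c) (fst c) D)"

lemma swap_on_swap_on [simp]: "swap_on D (swap_on D c) = c"
  by (cases c) (auto simp: swap_on_def override_on_def fun_eq_iff)

lemma nonhub_sites_swap_on: "nonhub_sites A (swap_on D c) = nonhub_sites A c"
  by (auto simp: nonhub_sites_def swap_on_def override_on_def)

text \<open>Every edge that leaves \<open>D\<close> ends where the two copies agree, so each edge of the mixed
  configuration occurs in one of the copies.\<close>
lemma swap_point:
  assumes D: "D \<subseteq> interior_sites A"
    and hubs: "\<And>x y. x \<in> D \<Longrightarrow> y \<notin> D \<Longrightarrow> adj Z2 x y \<Longrightarrow> \<alpha> y = \<alpha>' y"
    and pt: "override_on \<omega> \<alpha> A \<in> points H" "override_on \<omega>' \<alpha>' A \<in> points H"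
  shows "override_on \<omega> (override_on \<alpha> \<alpha>' D) A \<in> points H"
proof -
  let ?\<sigma> = "override_on \<omega> (override_on \<alpha> \<alpha>' D) A"
  have DA: "y \<in> A" if "x \<in> D" "y = x \<or> adj Z2 x y" for x y
  proof -
    have "y \<in> closed_nbhd x" using that(2) by (auto simp: closed_nbhd_def mem_nbhd_Z2 adj_Z2_sym)
    then show ?thesis using that(1) D by (auto simp: interior_sites_def)
  qed
  have on: "?\<sigma> x = override_on \<omega>' \<alpha>' A x" if "x \<in> D" for x using that DA by (auto simp: override_on_def)
  have off: "?\<sigma> x = override_on \<omega> \<alpha> A x" if "x \<notin> D" for x using that by (auto simp: override_on_def)
  have near: "override_on \<omega>' \<alpha>' A y = override_on \<omega> \<alpha> A y" if "x \<in> D" "y \<notin> D" "adj Z2 x y" for x y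
    using hubs[OF that] DA[of x y] that by simp
  show ?thesis
    unfolding points_iff
  proof (intro conjI allI impI)
    show "?\<sigma> x \<in> nodes H" for x
      using on off point_node[OF pt(1)] point_node[OF pt(2)] by (cases "x \<in> D") simp_all
    show "adj H (?\<sigma> x) (?\<sigma> y)" if xy: "adj Z2 x y" for x y
    proof -
      note e = point_edge[OF pt(1) xy] point_edge[OF pt(2) xy]
      have yx: "adj Z2 y x" using xy adj_Z2_sym by blast
      consider "x \<in> D" "y \<in> D" | "x \<in> D" "y \<notin> D" | "x \<notin> D" "y \<in> D" | "x \<notin> D" "y \<notin> D" by blast
      then show ?thesis
      proof cases
        case 1 then show ?thesis using e(2) on by simp
      next
        case 2 then show ?thesis using e(2) on[of x] off[of y] near[of x y] xy by simp
      next
        case 3 then show ?thesis using e(2) on[of y] off[of x] near[of y x] yx by simp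
      next
        case 4 then show ?thesis using e(1) off by simp
      qed
    qed
  qed
qed

lemma swap_gibbs:
  fixes m :: nat and \<omega>1 \<omega>2 :: "site \<Rightarrow> nat"
  assumes A: "finite A" and l: "0 < l" and D: "D \<subseteq> interior_sites A"
    and hubs: "\<And>x y. x \<in> D \<Longrightarrow> y \<notin> D \<Longrightarrow> adj Z2 x y \<Longrightarrow> fst c y = snd c y"
  defines "p1 \<equiv> gibbs (blocked_clique m) (hub_interaction m l) A \<omega>1"
    and "p2 \<equiv> gibbs (blocked_clique m) (hub_interaction m l) A \<omega>2"
  shows "p1 (fst (swap_on D c)) * p2 (snd (swap_on D c)) = p1 (fst c) * p2 (snd c)"
proof -
  let ?H = "blocked_clique m" and ?g = "hub_weight l"
  obtain \<alpha> \<alpha>' where c: "c = (\<alpha>, \<alpha>')" by (cases c)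
  define \<beta> \<beta>' where "\<beta> = override_on \<alpha> \<alpha>' D" and "\<beta>' = override_on \<alpha>' \<alpha> D"
  have h: "\<alpha> y = \<alpha>' y" if "x \<in> D" "y \<notin> D" "adj Z2 x y" for x y using hubs[OF that] c by simp
  have h': "\<beta> y = \<beta>' y" if "x \<in> D" "y \<notin> D" "adj Z2 x y" for x y
    using h[OF that] that(2) by (simp add: \<beta>_def \<beta>'_def)
  have undo: "override_on \<beta> \<beta>' D = \<alpha>" "override_on \<beta>' \<beta> D = \<alpha>'"
    by (auto simp: \<beta>_def \<beta>'_def override_on_def fun_eq_iff)
  have swapped: "override_on \<omega>1 (override_on \<zeta> \<zeta>' D) A \<in> points ?H \<and>
      override_on \<omega>2 (override_on \<zeta>' \<zeta> D) A \<in> points ?H"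
    if pt: "override_on \<omega>1 \<zeta> A \<in> points ?H" "override_on \<omega>2 \<zeta>' A \<in> points ?H"
      and eq: "\<And>x y. x \<in> D \<Longrightarrow> y \<notin> D \<Longrightarrow> adj Z2 x y \<Longrightarrow> \<zeta> y = \<zeta>' y" for \<zeta> \<zeta>'
  proof
    show "override_on \<omega>1 (override_on \<zeta> \<zeta>' D) A \<in> points ?H"
      by (rule swap_point[OF D _ pt]) (rule eq)
    show "override_on \<omega>2 (override_on \<zeta>' \<zeta> D) A \<in> points ?H"
      by (rule swap_point[OF D _ pt(2,1)]) (rule eq[symmetric])
  qed
  have pts: "override_on \<omega>1 \<beta> A \<in> points ?H \<and> override_on \<omega>2 \<beta>' A \<in> points ?H \<longleftrightarrow>
      override_on \<omega>1 \<alpha> A \<in> points ?H \<and> override_on \<omega>2 \<alpha>' A \<in> points ?H"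
  proof
    assume "override_on \<omega>1 \<beta> A \<in> points ?H \<and> override_on \<omega>2 \<beta>' A \<in> points ?H"
    then show "override_on \<omega>1 \<alpha> A \<in> points ?H \<and> override_on \<omega>2 \<alpha>' A \<in> points ?H"
      using swapped[of \<beta> \<beta>', unfolded undo] h' by blast
  next
    assume "override_on \<omega>1 \<alpha> A \<in> points ?H \<and> override_on \<omega>2 \<alpha>' A \<in> points ?H"
    then show "override_on \<omega>1 \<beta> A \<in> points ?H \<and> override_on \<omega>2 \<beta>' A \<in> points ?H"
      using swapped[of \<alpha> \<alpha>', folded \<beta>_def \<beta>'_def] h by blast
  qed
  have prods: "(\<Prod>x\<in>A. ?g (\<beta> x)) * (\<Prod>x\<in>A. ?g (\<beta>' x)) = (\<Prod>x\<in>A. ?g (\<alpha> x)) * (\<Prod>x\<in>A. ?g (\<alpha>' x))"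
    unfolding prod.distrib[symmetric]
    by (intro prod.cong) (auto simp: \<beta>_def \<beta>'_def override_on_def)
  have "gibbs_weight ?H (hub_interaction m l) A \<omega>1 \<beta> * gibbs_weight ?H (hub_interaction m l) A \<omega>2 \<beta>' =
      gibbs_weight ?H (hub_interaction m l) A \<omega>1 \<alpha> * gibbs_weight ?H (hub_interaction m l) A \<omega>2 \<alpha>'"
    unfolding gibbs_weight_hub_interaction[OF A l] using pts prods by auto
  then show ?thesis
    by (simp add: p1_def p2_def gibbs_def c swap_on_def \<beta>_def \<beta>'_def)
qed

text \<open>Two independent copies are compared through the cluster of \<open>B\<close> among the sites where not both
  copies show a hub. If the cluster stays inside, exchanging the copies on it is a weight-preserving
  involution, for both show hubs around it. On \<open>B\<close> the first copy then reads what the second one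
  read before: \<open>B\<close> is covered by the cluster and by sites where both show hubs. Only pairs whose
  cluster reaches the boundary contribute.\<close>
lemma marginal_difference_le_cluster_reaches_boundary:
  fixes m :: nat and \<omega>1 \<omega>2 :: "site \<Rightarrow> nat"
  assumes A: "finite A" "B \<subseteq> A" and l: "0 < l"
    and \<omega>: "\<omega>1 \<in> points (blocked_clique m)" "\<omega>2 \<in> points (blocked_clique m)"
  defines "p1 \<equiv> gibbs (blocked_clique m) (hub_interaction m l) A \<omega>1"
    and "p2 \<equiv> gibbs (blocked_clique m) (hub_interaction m l) A \<omega>2"
    and "C \<equiv> A \<rightarrow>\<^sub>E nodes (blocked_clique m)"
  shows "\<bar>gibbs_marginal (blocked_clique m) (hub_interaction m l) A \<omega>1 B \<beta> -
      gibbs_marginal (blocked_clique m) (hub_interaction m l) A \<omega>2 B \<beta>\<bar>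
    \<le> (\<Sum>c\<in>{c \<in> C \<times> C. \<not> cluster B (nonhub_sites A c) \<subseteq> interior_sites A}. p1 (fst c) * p2 (snd c))"
proof -
  define p where "p c = p1 (fst c) * p2 (snd c)" for c
  define G where "G = {c \<in> C \<times> C. cluster B (nonhub_sites A c) \<subseteq> interior_sites A}"
  define Bad where "Bad = {c \<in> C \<times> C. \<not> cluster B (nonhub_sites A c) \<subseteq> interior_sites A}"
  define S where "S c = swap_on (cluster B (nonhub_sites A c)) c" for c
  define e where "e \<alpha> = (if restrict \<alpha> B = \<beta> then 1 else (0::real))" for \<alpha>
  have finC: "finite C" using A by (auto simp: C_def intro: finite_PiE)
  have one: "(\<Sum>\<alpha>\<in>C. p1 \<alpha>) = 1" "(\<Sum>\<alpha>\<in>C. p2 \<alpha>) = 1"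
    using gibbs_sum_eq_1[OF constraint_graph_blocked_clique A(1)] \<omega> unfolding p1_def p2_def C_def by blast+
  have p0: "0 \<le> p c" for c by (simp add: p_def p1_def p2_def gibbs_nonneg)
  have marg: "gibbs_marginal (blocked_clique m) (hub_interaction m l) A \<omega> B \<beta> =
      (\<Sum>\<alpha>\<in>C. gibbs (blocked_clique m) (hub_interaction m l) A \<omega> \<alpha> * e \<alpha>)" for \<omega>
    unfolding gibbs_marginal_def C_def[symmetric]
    by (intro sum.mono_neutral_cong_left finC) (auto simp: e_def)
  have SS: "S (S c) = c" for c by (simp add: S_def nonhub_sites_swap_on)
  have SG: "S c \<in> G" if "c \<in> G" for c
  proof -
    have "cluster B (nonhub_sites A c) \<subseteq> A"
      using cluster_subset by (fastforce simp: nonhub_sites_def)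
    then have "S c \<in> C \<times> C"
      using that by (auto simp: G_def C_def S_def swap_on_def override_on_def PiE_def Pi_def extensional_def)
    then show ?thesis using that by (simp add: G_def S_def nonhub_sites_swap_on)
  qed
  have pS: "p (S c) = p c" if "c \<in> G" for c
    unfolding p_def S_def p1_def p2_def
  proof (rule swap_gibbs[OF A(1) l])
    show sub: "cluster B (nonhub_sites A c) \<subseteq> interior_sites A" using that by (simp add: G_def)
    fix x y assume xy: "x \<in> cluster B (nonhub_sites A c)" "y \<notin> cluster B (nonhub_sites A c)" "adj Z2 x y"
    then have "y \<in> closed_nbhd x" by (auto simp: closed_nbhd_def mem_nbhd_Z2 adj_Z2_sym)
    then have "y \<in> A" using sub xy(1) by (auto simp: interior_sites_def)
    moreover have "y \<notin> nonhub_sites A c" using cluster_step xy by blast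
    ultimately show "fst c y = snd c y" by (simp add: nonhub_sites_def)
  qed
  have eS: "e (fst (S c)) = e (snd c)" for c
  proof -
    have "fst (S c) x = snd c x" if "x \<in> B" for x
    proof (cases "x \<in> cluster B (nonhub_sites A c)")
      case True
      then show ?thesis by (simp add: S_def swap_on_def)
    next
      case False
      then have "x \<notin> nonhub_sites A c" using cluster_start that by blast
      then show ?thesis using that A(2) False by (auto simp: S_def swap_on_def nonhub_sites_def)
    qed
    then have "restrict (fst (S c)) B = restrict (snd c) B" by (intro restrict_ext) auto
    then show ?thesis by (simp add: e_def)
  qed
  have "(\<Sum>c\<in>G. p c * e (fst c)) = (\<Sum>c\<in>G. p c * e (snd c))"
    by (rule sum.reindex_bij_witness[of _ S S]) (auto simp: SS SG pS eS[symmetric])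
  then have G0: "(\<Sum>c\<in>G. p c * (e (fst c) - e (snd c))) = 0"
    by (simp add: right_diff_distrib sum_subtractf)
  have "(\<Sum>\<alpha>\<in>C. p1 \<alpha> * e \<alpha>) - (\<Sum>\<alpha>\<in>C. p2 \<alpha> * e \<alpha>) =
      (\<Sum>\<alpha>\<in>C. p1 \<alpha> * e \<alpha>) * (\<Sum>\<alpha>\<in>C. p2 \<alpha>) - (\<Sum>\<alpha>\<in>C. p1 \<alpha>) * (\<Sum>\<alpha>\<in>C. p2 \<alpha> * e \<alpha>)"
    unfolding one by simp
  also have "\<dots> = (\<Sum>c\<in>C \<times> C. p c * (e (fst c) - e (snd c)))"
    unfolding sum_product sum.cartesian_product sum_subtractf[symmetric]
    by (intro sum.cong) (auto simp: p_def algebra_simps)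
  also have "\<dots> = (\<Sum>c\<in>G. p c * (e (fst c) - e (snd c))) + (\<Sum>c\<in>Bad. p c * (e (fst c) - e (snd c)))"
    using finC by (subst sum.union_disjoint[symmetric]) (auto simp: G_def Bad_def intro!: sum.cong)
  finally have "\<bar>(\<Sum>\<alpha>\<in>C. p1 \<alpha> * e \<alpha>) - (\<Sum>\<alpha>\<in>C. p2 \<alpha> * e \<alpha>)\<bar> =
      \<bar>\<Sum>c\<in>Bad. p c * (e (fst c) - e (snd c))\<bar>"
    unfolding G0 by simp
  also have "\<dots> \<le> (\<Sum>c\<in>Bad. p c)"
  proof (rule order.trans[OF sum_abs sum_mono])
    fix c
    have "\<bar>e (fst c) - e (snd c)\<bar> \<le> 1" by (simp add: e_def)
    then show "\<bar>p c * (e (fst c) - e (snd c))\<bar> \<le> p c"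
      using p0[of c] mult_left_mono[of "\<bar>e (fst c) - e (snd c)\<bar>" 1 "p c"] by (simp add: abs_mult)
  qed
  finally show ?thesis
    unfolding marg Bad_def p_def p1_def p2_def by simp
qed

text \<open>The path that reaches the boundary is cut after \<open>k\<close> sites, before it comes next to the boundary:
  there the bound on non-hub spins is available.\<close>
lemma cluster_reaches_boundary_path:
  assumes "B \<subseteq> A" "N \<subseteq> A" "enat k < set_gdist Z2 B (bdry A)" "\<not> cluster B N \<subseteq> interior_sites A"
  shows "\<exists>x\<in>B. \<exists>xs\<in>lattice_paths k x. distinct xs \<and> set xs \<subseteq> N \<and> set xs \<subseteq> interior_sites A"
proof -
  obtain y where y: "y \<in> cluster B N" "y \<notin> interior_sites A" using assms(4) by blast
  then obtain x xs where xs: "x \<in> B" "distinct (x # xs)" "set (x # xs) \<subseteq> N"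
    "successively (adj Z2) (x # xs)" "last (x # xs) = y"
    using cluster_path by blast
  let ?p = "x # xs"
  have close: "z \<notin> bdry A" if "l1_dist x z \<le> k" for z
    using set_gdist_le[of x B z "bdry A"] xs(1) assms(3) that
    by (auto dest: order.strict_trans2)
  have inner: "z \<in> interior_sites A" if "z \<in> A" "l1_dist x z < k" for z
  proof -
    have "w \<in> A" if "w \<in> nbhd Z2 z" for w
    proof (rule ccontr)
      assume "w \<notin> A"
      then have "w \<in> bdry A" using \<open>z \<in> A\<close> that by (auto simp: bdry_eq mem_nbhd_Z2 adj_Z2_sym)
      moreover have "l1_dist x w \<le> k"
        using l1_dist_triangle[of x w z] that \<open>l1_dist x z < k\<close> l1_dist_commute[of z w]
        by (simp add: mem_nbhd_Z2 adj_Z2)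
      ultimately show False using close by blast
    qed
    then show ?thesis using that by (auto simp: interior_sites_def closed_nbhd_def)
  qed
  have dist: "l1_dist x (?p ! i) \<le> i" if "i < length ?p" for i
    using l1_dist_along_path[OF xs(4), of i] that by simp
  have len: "k \<le> length xs"
  proof (rule ccontr)
    assume "\<not> k \<le> length xs"
    moreover have "l1_dist x y \<le> length xs"
      using dist[of "length xs"] xs(5) last_conv_nth[of ?p] by (simp del: last.simps)
    moreover have "y \<in> A" using assms(2) xs(3,5) last_in_set[of ?p] by auto
    ultimately have "y \<in> interior_sites A" by (intro inner) auto
    then show False using y by blast
  qed
  show ?thesis
  proof (intro bexI[of _ x] bexI[of _ "take k ?p"] conjI)
    show "distinct (take k ?p)" using xs(2) distinct_take by blast
    show sub: "set (take k ?p) \<subseteq> N" using xs(3) set_take_subset by fast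
    show "set (take k ?p) \<subseteq> interior_sites A"
    proof
      fix z assume z: "z \<in> set (take k ?p)"
      then obtain i where i: "i < k" "i < length ?p" "z = ?p ! i"
        by (auto simp: in_set_conv_nth simp del: take_Suc_Cons)
      have "l1_dist x z \<le> i" using dist[OF i(2)] i(3) by simp
      then show "z \<in> interior_sites A" using i(1) z sub assms(2) by (intro inner) auto
    qed
    show "take k ?p \<in> lattice_paths k x" using xs(4) len by (intro take_in_lattice_paths) auto
  qed (rule xs(1))
qed

text \<open>A union bound: there are \<open>card B\<close> starting sites and at most \<open>4 ^ k\<close> paths from each, and each site of a
  path is charged to one of the two copies; hence the factor \<open>8 = 4 * 2\<close> per step.\<close>
lemma weak_mixing_bound:
  fixes m :: nat and \<omega>1 \<omega>2 :: "site \<Rightarrow> nat"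
  assumes A: "finite A" "B \<subseteq> A" and L: "1 \<le> L"
    and \<omega>: "\<omega>1 \<in> points (blocked_clique m)" "\<omega>2 \<in> points (blocked_clique m)"
    and k: "enat k < set_gdist Z2 B (bdry A)"
  shows "\<bar>gibbs_marginal (blocked_clique m) (hub_interaction m (L ^ 5)) A \<omega>1 B \<beta> -
      gibbs_marginal (blocked_clique m) (hub_interaction m (L ^ 5)) A \<omega>2 B \<beta>\<bar>
    \<le> card B * (8 * (real (m + 2) ^ 5 / L)) ^ k"
proof -
  let ?\<eta> = "real (m + 2) ^ 5 / L"
  define p where "p c = gibbs (blocked_clique m) (hub_interaction m (L ^ 5)) A \<omega>1 (fst c) *
     gibbs (blocked_clique m) (hub_interaction m (L ^ 5)) A \<omega>2 (snd c)" for c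
  define C where "C = A \<rightarrow>\<^sub>E nodes (blocked_clique m)"
  define Bad where "Bad = {c \<in> C \<times> C. \<not> cluster B (nonhub_sites A c) \<subseteq> interior_sites A}"
  define P where "P x = {xs \<in> lattice_paths k x. distinct xs \<and> set xs \<subseteq> interior_sites A}" for x
  define E where "E xs = {c \<in> C \<times> C. \<forall>x\<in>set xs. fst c x \<noteq> 0 \<or> snd c x \<noteq> 0}" for xs
  have fin: "finite B" "finite C" "finite (P x)" "finite (E xs)" for x xs
  proof -
    show "finite B" using A finite_subset by blast
    show C: "finite C" using A by (auto simp: C_def intro: finite_PiE)
    show "finite (P x)" by (simp add: P_def)
    show "finite (E xs)" using C by (simp add: E_def)
  qed
  have p0: "0 \<le> p c" for c by (simp add: p_def gibbs_nonneg)
  have "\<bar>gibbs_marginal (blocked_clique m) (hub_interaction m (L ^ 5)) A \<omega>1 B \<beta> -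
      gibbs_marginal (blocked_clique m) (hub_interaction m (L ^ 5)) A \<omega>2 B \<beta>\<bar> \<le> sum p Bad"
    unfolding p_def Bad_def C_def
    using L by (intro marginal_difference_le_cluster_reaches_boundary A \<omega>) simp
  also have "\<dots> \<le> sum p (\<Union>x\<in>B. \<Union>xs\<in>P x. E xs)"
  proof (intro sum_mono2 p0)
    show "Bad \<subseteq> (\<Union>x\<in>B. \<Union>xs\<in>P x. E xs)"
    proof
      fix c assume c: "c \<in> Bad"
      then obtain x xs where "x \<in> B" "xs \<in> lattice_paths k x" "distinct xs"
        "set xs \<subseteq> nonhub_sites A c" "set xs \<subseteq> interior_sites A"
        using cluster_reaches_boundary_path[OF A(2) _ k, of "nonhub_sites A c"]
        by (auto simp: Bad_def nonhub_sites_def)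
      then have "x \<in> B" "xs \<in> P x" "c \<in> E xs"
        using c by (auto simp: P_def E_def Bad_def nonhub_sites_def)
      then show "c \<in> (\<Union>x\<in>B. \<Union>xs\<in>P x. E xs)" by blast
    qed
  qed (use fin in auto)
  also have "\<dots> \<le> (\<Sum>x\<in>B. sum p (\<Union>xs\<in>P x. E xs))"
    using fin by (intro sum_UN_le_sum_sum p0) auto
  also have "\<dots> \<le> (\<Sum>x\<in>B. \<Sum>xs\<in>P x. sum p (E xs))"
    using fin by (intro sum_mono sum_UN_le_sum_sum p0) auto
  also have "\<dots> \<le> (\<Sum>x\<in>B. \<Sum>xs\<in>P x. (2 * ?\<eta>) ^ k)"
  proof (intro sum_mono)
    fix x xs assume "xs \<in> P x"
    then have xs: "set xs \<subseteq> interior_sites A" "card (set xs) = k"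
      by (auto simp: P_def length_lattice_paths distinct_card)
    have "sum p (E xs) = (\<Sum>(\<alpha>, \<alpha>')\<in>{(\<alpha>, \<alpha>') \<in> C \<times> C. \<forall>x\<in>set xs. \<alpha> x \<noteq> 0 \<or> \<alpha>' x \<noteq> 0}.
        gibbs (blocked_clique m) (hub_interaction m (L ^ 5)) A \<omega>1 \<alpha> *
        gibbs (blocked_clique m) (hub_interaction m (L ^ 5)) A \<omega>2 \<alpha>')"
      by (intro sum.cong) (auto simp: E_def p_def)
    also have "\<dots> \<le> (2 * ?\<eta>) ^ card (set xs)"
      unfolding C_def by (rule nonhub_pair_bound[OF A(1) xs(1) L \<omega>])
    finally show "sum p (E xs) \<le> (2 * ?\<eta>) ^ k" using xs(2) by simp
  qed
  also have "\<dots> \<le> (\<Sum>x\<in>B. 4 ^ k * (2 * ?\<eta>) ^ k)"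
  proof (intro sum_mono)
    fix x
    have "card (P x) \<le> card (lattice_paths k x)" by (intro card_mono) (auto simp: P_def)
    then have "card (P x) \<le> 4 ^ k" using card_lattice_paths[of k x] by linarith
    then have "real (card (P x)) \<le> 4 ^ k" by (metis of_nat_le_iff of_nat_numeral of_nat_power)
    then show "(\<Sum>xs\<in>P x. (2 * ?\<eta>) ^ k) \<le> 4 ^ k * (2 * ?\<eta>) ^ k"
      using L by (simp add: mult_right_mono)
  qed
  also have "\<dots> = card B * (8 * ?\<eta>) ^ k"
    by (simp add: power_mult_distrib[symmetric] mult_ac)
  finally show ?thesis .
qed

text \<open>The constant \<open>exp \<gamma>\<close> accounts for the one unit by which the length of the path falls short of the
  distance.\<close>
lemma exp_WSM_hub_interaction:
  assumes "0 < \<gamma>"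
  shows "\<exists>l\<ge>1. exp_WSM (blocked_clique m) (hub_interaction m l) \<gamma>"
proof -
  \<comment> \<open>Chosen so that \<open>weak_mixing_bound\<close> decays by \<open>exp (- \<gamma>)\<close> per step.\<close>
  define L where "L = 8 * real (m + 2) ^ 5 * exp \<gamma>"
  have "1 \<le> 8 * real (m + 2) ^ 5" using one_le_power[of "real (m + 2)" 5] by linarith
  moreover have "1 \<le> exp \<gamma>" using assms by simp
  ultimately have L: "1 \<le> L"
    unfolding L_def using mult_mono[of 1 "8 * real (m + 2) ^ 5" 1 "exp \<gamma>"] by simp
  have \<eta>: "8 * (real (m + 2) ^ 5 / L) = exp (- \<gamma>)"
    by (simp add: L_def exp_minus field_simps)
  have "\<bar>gibbs_marginal (blocked_clique m) (hub_interaction m (L ^ 5)) A \<omega>1 B \<beta> -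
      gibbs_marginal (blocked_clique m) (hub_interaction m (L ^ 5)) A \<omega>2 B \<beta>\<bar>
    \<le> real (card B) * exp_decay (exp \<gamma>) \<gamma> (set_gdist Z2 B (bdry A))"
    if A: "finite A" "B \<subseteq> A" and \<omega>: "\<omega>1 \<in> points (blocked_clique m)" "\<omega>2 \<in> points (blocked_clique m)"
    for A B \<beta> \<omega>1 \<omega>2
  proof (rule le_exp_decay[OF assms])
    fix n assume n: "enat n \<le> set_gdist Z2 B (bdry A)"
    have "enat 1 \<le> set_gdist Z2 B (bdry A)"
    proof (rule set_gdist_ge)
      fix x y assume "x \<in> B" "y \<in> bdry A"
      then have "l1_dist x y \<noteq> 0" using A(2) by (auto simp: bdry_eq)
      then show "enat 1 \<le> enat (l1_dist x y)" by (simp del: l1_dist_eq_0)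
    qed
    then have "enat (n - 1) < set_gdist Z2 B (bdry A)"
      using n by (cases "set_gdist Z2 B (bdry A)") auto
    note weak_mixing_bound[OF A L \<omega> this, unfolded \<eta>, of \<beta>]
    also have "exp (- \<gamma>) ^ (n - 1) \<le> exp \<gamma> * exp (- \<gamma>) ^ n"
      using assms by (cases n) (simp_all add: exp_minus)
    finally show "\<bar>gibbs_marginal (blocked_clique m) (hub_interaction m (L ^ 5)) A \<omega>1 B \<beta> -
      gibbs_marginal (blocked_clique m) (hub_interaction m (L ^ 5)) A \<omega>2 B \<beta>\<bar>
      \<le> real (card B) * (exp \<gamma> * exp (- \<gamma>) ^ n)"
      by (simp add: mult_left_mono)
  qed
  then have "exp_WSM (blocked_clique m) (hub_interaction m (L ^ 5)) \<gamma>"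
    unfolding exp_WSM_def using assms by (intro conjI exI[of _ "exp \<gamma>"]) auto
  moreover have "1 \<le> L ^ 5" using L by (rule one_le_power)
  ultimately show ?thesis by blast
qed

section \<open>Powers of a symmetric matrix with zero diagonal\<close>

primrec matpow :: "'a set \<Rightarrow> ('a \<Rightarrow> 'a \<Rightarrow> real) \<Rightarrow> nat \<Rightarrow> 'a \<Rightarrow> 'a \<Rightarrow> real" where
  "matpow W M 0 i j = (if i = j then 1 else 0)"
| "matpow W M (Suc n) i j = (\<Sum>k\<in>W. matpow W M n i k * M k j)"

lemma matpow_add:
  assumes "finite W" "i \<in> W" "j \<in> W"
  shows "matpow W M (a + b) i j = (\<Sum>k\<in>W. matpow W M a i k * matpow W M b k j)"
  using assms(3)
proof (induction b arbitrary: j)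
  case 0
  have "(\<Sum>k\<in>W. matpow W M a i k * matpow W M 0 k j) = (\<Sum>k\<in>W. if k = j then matpow W M a i k else 0)"
    by (intro sum.cong) auto
  then show ?case using assms(1) 0 by simp
next
  case (Suc b)
  have "matpow W M (a + Suc b) i j = (\<Sum>h\<in>W. (\<Sum>k\<in>W. matpow W M a i k * matpow W M b k h) * M h j)"
    using Suc.IH by simp
  also have "\<dots> = (\<Sum>k\<in>W. \<Sum>h\<in>W. matpow W M a i k * matpow W M b k h * M h j)"
    unfolding sum_distrib_right by (rule sum.swap)
  also have "\<dots> = (\<Sum>k\<in>W. matpow W M a i k * matpow W M (Suc b) k j)"
    by (simp add: sum_distrib_left mult.assoc)
  finally show ?case .
qed

lemma matpow_1: "finite W \<Longrightarrow> i \<in> W \<Longrightarrow> matpow W M 1 i j = M i j"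
proof -
  assume "finite W" "i \<in> W"
  have "matpow W M 1 i j = (\<Sum>k\<in>W. if k = i then M k j else 0)"
    unfolding One_nat_def matpow.simps by (intro sum.cong) auto
  then show ?thesis using \<open>finite W\<close> \<open>i \<in> W\<close> by simp
qed

lemma matpow_sym:
  assumes "finite W" "\<And>i j. M i j = M j i" "i \<in> W" "j \<in> W"
  shows "matpow W M n i j = matpow W M n j i"
  using assms(3,4)
proof (induction n arbitrary: i j)
  case (Suc n)
  have "matpow W M (Suc n) i j = (\<Sum>k\<in>W. M j k * matpow W M n k i)"
    using Suc assms(2)[of j] by (auto intro!: sum.cong)
  also have "\<dots> = (\<Sum>k\<in>W. matpow W M 1 j k * matpow W M n k i)"
    using matpow_1[OF assms(1) Suc.prems(2)] by simp
  also have "\<dots> = matpow W M (1 + n) j i"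
    using matpow_add[OF assms(1) Suc.prems(2,1), of M 1 n] by simp
  finally show ?case by simp
qed auto

lemma matpow_nonneg: "(\<And>i j. 0 \<le> M i j) \<Longrightarrow> 0 \<le> matpow W M n i j"
  by (induction n arbitrary: j) (auto intro!: sum_nonneg)

lemma matpow_le:
  fixes \<mu> :: real
  assumes "\<And>i j. 0 \<le> M i j" "\<And>i j. M i j \<le> \<mu>"
  shows "matpow W M n i j \<le> (card W * \<mu>) ^ n"
proof (induction n arbitrary: j)
  case (Suc n)
  have \<mu>: "0 \<le> \<mu>" using assms order_trans by blast
  have "matpow W M (Suc n) i j \<le> (\<Sum>k\<in>W. (card W * \<mu>) ^ n * \<mu>)"
    unfolding matpow.simps using Suc assms \<mu> matpow_nonneg[of M] by (intro sum_mono mult_mono) auto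
  then show ?case by (simp add: mult_ac)
qed simp

text \<open>Expanding the squares gives the Gram determinant of the two rows once for each order of the pair of
  columns.\<close>
lemma lagrange_identity:
  fixes a b :: "'a \<Rightarrow> real"
  shows "(\<Sum>k\<in>W. \<Sum>h\<in>W. (a k * b h - a h * b k)\<^sup>2) =
    2 * ((\<Sum>k\<in>W. a k * a k) * (\<Sum>k\<in>W. b k * b k) - (\<Sum>k\<in>W. a k * b k)\<^sup>2)"
proof -
  have "(\<Sum>k\<in>W. \<Sum>h\<in>W. (a k * b h - a h * b k)\<^sup>2) =
      (\<Sum>k\<in>W. \<Sum>h\<in>W. (a k * a k) * (b h * b h)) + (\<Sum>k\<in>W. \<Sum>h\<in>W. (b k * b k) * (a h * a h)) -
      2 * (\<Sum>k\<in>W. \<Sum>h\<in>W. (a k * b k) * (a h * b h))"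
    unfolding sum_distrib_left sum.distrib[symmetric] sum_subtractf[symmetric]
    by (intro sum.cong) (auto simp: power2_eq_square algebra_simps)
  then show ?thesis
    unfolding sum_product[symmetric] by (simp add: power2_eq_square algebra_simps)
qed

definition principal_minor :: "'a set \<Rightarrow> ('a \<Rightarrow> 'a \<Rightarrow> real) \<Rightarrow> nat \<Rightarrow> 'a \<Rightarrow> 'a \<Rightarrow> real" where
  "principal_minor W M n i j = matpow W M n i i * matpow W M n j j - (matpow W M n i j)\<^sup>2"

text \<open>By symmetry the entries of \<open>M ^ (2 n)\<close> are the inner products of the rows of \<open>M ^ n\<close>. Hence the
  minor of \<open>M ^ (2 n)\<close> is a Gram determinant, which is at least the square of one minor of
  \<open>M ^ n\<close>.\<close>
lemma principal_minor_double:
  assumes W: "finite W" "i \<in> W" "j \<in> W" "i \<noteq> j" and sym: "\<And>i j. M i j = M j i"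
  shows "(principal_minor W M n i j)\<^sup>2 \<le> principal_minor W M (n + n) i j"
proof -
  define a where "a k = matpow W M n i k" for k
  define b where "b k = matpow W M n j k" for k
  have dbl: "matpow W M (n + n) u v = (\<Sum>k\<in>W. matpow W M n u k * matpow W M n v k)"
    if "u \<in> W" "v \<in> W" for u v
    using matpow_add[OF W(1) that, of M n n] matpow_sym[OF W(1) sym that(2)]
    by (simp cong: sum.cong)
  have "2 * principal_minor W M (n + n) i j = (\<Sum>k\<in>W. \<Sum>h\<in>W. (a k * b h - a h * b k)\<^sup>2)"
    unfolding lagrange_identity using W by (simp add: principal_minor_def dbl a_def b_def)
  also have "\<dots> = (\<Sum>(k, h)\<in>W \<times> W. (a k * b h - a h * b k)\<^sup>2)"
    by (rule sum.cartesian_product)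
  also have "\<dots> \<ge> (\<Sum>(k, h)\<in>{(i, j), (j, i)}. (a k * b h - a h * b k)\<^sup>2)"
    using W by (intro sum_mono2) auto
  also have "(\<Sum>(k, h)\<in>{(i, j), (j, i)}. (a k * b h - a h * b k)\<^sup>2) = 2 * (a i * b j - a j * b i)\<^sup>2"
    using W(4) by (simp add: power2_commute)
  also have "a i * b j - a j * b i = principal_minor W M n i j"
    using matpow_sym[OF W(1) sym W(3,2)] by (simp add: principal_minor_def a_def b_def power2_eq_square)
  finally show ?thesis by simp
qed

text \<open>With zero diagonal the minor of \<open>M\<close> itself is \<open>- (M i j)\<^sup>2\<close>, and repeated squaring keeps the growth.
  This is an elementary form of the fact that the trace vanishes, so that the second largest
  eigenvalue in modulus is at least a fixed fraction of the largest one.\<close>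
lemma principal_minor_power_of_two:
  assumes W: "finite W" "i \<in> W" "j \<in> W" "i \<noteq> j" and sym: "\<And>i j. M i j = M j i"
    and diag: "M i i = 0"
  shows "(M i j ^ 2) ^ (2 ^ k) \<le> \<bar>principal_minor W M (2 ^ k) i j\<bar>"
proof (induction k)
  case 0
  show ?case using matpow_1[OF W(1)] W diag by (simp add: principal_minor_def)
next
  case (Suc k)
  have "(M i j ^ 2) ^ (2 ^ Suc k) = ((M i j ^ 2) ^ (2 ^ k))\<^sup>2"
    by (simp add: power_mult[symmetric] mult_ac)
  also have "\<dots> \<le> \<bar>principal_minor W M (2 ^ k) i j\<bar>\<^sup>2"
    using Suc by (intro power_mono) auto
  also have "\<dots> = (principal_minor W M (2 ^ k) i j)\<^sup>2" by simp
  also have "\<dots> \<le> principal_minor W M (2 ^ k + 2 ^ k) i j"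
    by (rule principal_minor_double[OF W sym])
  finally show ?case by (simp add: mult_2)
qed

section \<open>A line of clique colours as a transfer matrix\<close>

abbreviation line_site :: "nat \<Rightarrow> site" where
  "line_site k \<equiv> (int k, 0)"

definition line :: "nat \<Rightarrow> site set" where
  "line n = line_site ` {1..n}"

lemma finite_line [simp]: "finite (line n)"
  by (simp add: line_def)

lemma line_0 [simp]: "line 0 = {}"
  by (simp add: line_def)

lemma line_Suc: "line (Suc n) = insert (line_site (Suc n)) (line n)"
  by (auto simp: line_def atLeastAtMostSuc_conv)

lemma mem_line: "z \<in> line n \<longleftrightarrow> snd z = 0 \<and> 1 \<le> fst z \<and> fst z \<le> int n"
proof -
  have "z = line_site (nat (fst z))" if "snd z = 0" "1 \<le> fst z" using that by (simp add: prod_eq_iff)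
  then show ?thesis unfolding line_def by (auto simp: image_iff intro!: bexI[of _ "nat (fst z)"])
qed

lemma line_site_mem: "line_site k \<in> line n \<longleftrightarrow> 1 \<le> k \<and> k \<le> n"
  by (auto simp: mem_line)

lemma sum_line_matpow:
  assumes "finite W" "i \<in> W" "1 \<le> n"
  shows "(\<Sum>\<alpha>\<in>line n \<rightarrow>\<^sub>E W. if \<alpha> (line_site 1) = i
      then (\<Prod>k=1..<n. M (\<alpha> (line_site k)) (\<alpha> (line_site (Suc k)))) * M (\<alpha> (line_site n)) t else 0) =
    matpow W M n i t"
  using assms(3)
proof (induction n arbitrary: t rule: dec_induct)
  case base
  have line1: "line 1 = insert (line_site 1) {}" by (simp add: line_def)
  show ?case
    unfolding line1 using assms(1,2) matpow_1[OF assms(1,2), of M t]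
    by (subst sum_PiE_insert) simp_all
next
  case (step n)
  let ?F = "\<lambda>n \<alpha> t. if \<alpha> (line_site 1) = i
      then (\<Prod>k=1..<n. M (\<alpha> (line_site k)) (\<alpha> (line_site (Suc k)))) * M (\<alpha> (line_site n)) t else 0"
  have upd: "?F (Suc n) (\<eta>(line_site (Suc n) := s)) t = ?F n \<eta> s * M s t" for \<eta> s
  proof -
    have "(\<Prod>k=1..<n. M ((\<eta>(line_site (Suc n) := s)) (line_site k))
          ((\<eta>(line_site (Suc n) := s)) (line_site (Suc k)))) =
        (\<Prod>k=1..<n. M (\<eta> (line_site k)) (\<eta> (line_site (Suc k))))"
      by (intro prod.cong) auto
    then show ?thesis using step.hyps by (simp add: prod.atLeastLessThan_Suc)
  qed
  have "(\<Sum>\<alpha>\<in>line (Suc n) \<rightarrow>\<^sub>E W. ?F (Suc n) \<alpha> t) =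
      (\<Sum>\<eta>\<in>line n \<rightarrow>\<^sub>E W. \<Sum>s\<in>W. ?F (Suc n) (\<eta>(line_site (Suc n) := s)) t)"
    unfolding line_Suc by (rule sum_PiE_insert) (simp add: line_site_mem del: of_nat_Suc)
  also have "\<dots> = (\<Sum>\<eta>\<in>line n \<rightarrow>\<^sub>E W. \<Sum>s\<in>W. ?F n \<eta> s * M s t)" unfolding upd ..
  also have "\<dots> = (\<Sum>s\<in>W. (\<Sum>\<eta>\<in>line n \<rightarrow>\<^sub>E W. ?F n \<eta> s) * M s t)"
    unfolding sum_distrib_right by (rule sum.swap)
  finally show ?case unfolding step.IH by simp
qed

text \<open>Off the horizontal axis blockers and colour \<open>2\<close> alternate like a chessboard (two blockers may not
  be adjacent), with the parity of the lower half-plane shifted. So each site of the axis has one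
  blocker and one colour \<open>2\<close> as vertical neighbours, which leaves it the colours \<open>3, \<dots>, m + 1\<close>. On
  the axis \<open>t\<close> and \<open>e\<close> alternate: for even \<open>n\<close>, changing \<open>t\<close> changes the site to the right of
  \<open>line n\<close> and not the site to its left.\<close>
definition frame :: "nat \<Rightarrow> nat \<Rightarrow> site \<Rightarrow> nat" where
  "frame e t z = (if snd z = 0 then if odd (fst z) then t else e
     else if (0 < snd z) = even (fst z + snd z) then 1 else 2)"

lemma frame_points:
  assumes "t \<in> {3..<m + 2}" "e \<in> {3..<m + 2}" "t \<noteq> e"
  shows "frame e t \<in> points (blocked_clique m)"
  unfolding points_iff
proof (intro conjI allI impI)
  show "frame e t z \<in> nodes (blocked_clique m)" for z
    using assms by (auto simp: frame_def)
  fix y z assume "adj Z2 y z"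
  then have "z \<in> nbhd Z2 y" by (simp add: mem_nbhd_Z2 adj_Z2_sym)
  then show "adj (blocked_clique m) (frame e t y) (frame e t z)"
    using assms by (cases y) (auto simp: nbhd_Z2 frame_def adj_blocked_clique doubleton_eq_iff)
qed

text \<open>The weight of a colour on the axis together with its two vertical edges, whichever of them leads to
  the blocker.\<close>
definition site_factor :: "nat interaction \<Rightarrow> nat \<Rightarrow> real" where
  "site_factor \<Phi> v = exp (- (\<Phi> (Inl v) + \<Phi> (Inr {v, 1}) + \<Phi> (Inr {v, 2})))"

definition edge_factor :: "nat interaction \<Rightarrow> nat \<Rightarrow> nat \<Rightarrow> real" where
  "edge_factor \<Phi> u v = exp (- \<Phi> (Inr {u, v}))"

text \<open>Splitting the weight of a site evenly between the two edges of the axis that meet there makes the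
  transfer matrix symmetric. Its diagonal vanishes because equal colours are not adjacent.\<close>
definition transfer :: "nat interaction \<Rightarrow> nat set \<Rightarrow> nat \<Rightarrow> nat \<Rightarrow> real" where
  "transfer \<Phi> W u v = (if u \<in> W \<and> v \<in> W \<and> u \<noteq> v
     then sqrt (site_factor \<Phi> u) * sqrt (site_factor \<Phi> v) * edge_factor \<Phi> u v else 0)"

lemma transfer_sym: "transfer \<Phi> W u v = transfer \<Phi> W v u"
  by (auto simp: transfer_def edge_factor_def insert_commute)

lemma transfer_nonneg: "0 \<le> transfer \<Phi> W u v"
  by (simp add: transfer_def site_factor_def edge_factor_def)

lemma local_energy_line:
  assumes "\<And>z. snd z \<noteq> 0 \<Longrightarrow> \<tau> z = frame e t z"
  shows "exp (- local_energy \<Phi> (line (Suc n)) \<tau>) =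
    (\<Prod>k=1..Suc n. site_factor \<Phi> (\<tau> (line_site k))) *
    (\<Prod>k=0..Suc n. edge_factor \<Phi> (\<tau> (line_site k)) (\<tau> (line_site (Suc k))))"
proof (induction n)
  case 0
  have "local_energy \<Phi> (line (Suc 0)) \<tau> =
     \<Phi> (Inl (\<tau> (1, 0))) + (\<Sum>y\<in>nbhd Z2 (1, 0). \<Phi> (Inr {\<tau> (1, 0), \<tau> y}))"
    unfolding line_Suc line_0 by (subst local_energy_insert) (auto simp: local_energy_def)
  also have "\<dots> = \<Phi> (Inl (\<tau> (1, 0))) + \<Phi> (Inr {\<tau> (1, 0), 1}) + \<Phi> (Inr {\<tau> (1, 0), 2}) +
     \<Phi> (Inr {\<tau> (0, 0), \<tau> (1, 0)}) + \<Phi> (Inr {\<tau> (1, 0), \<tau> (2, 0)})"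
    by (simp add: nbhd_Z2 assms frame_def insert_commute)
  finally show ?case
    by (simp add: site_factor_def edge_factor_def flip: exp_add)
next
  case (Suc n)
  let ?x = "line_site (Suc (Suc n))"
  have out: "nbhd Z2 ?x - line (Suc n) =
      {line_site (Suc (Suc (Suc n))), (int (Suc (Suc n)), 1), (int (Suc (Suc n)), -1)}"
    by (auto simp: nbhd_Z2 mem_line)
  have "local_energy \<Phi> (line (Suc (Suc n))) \<tau> = local_energy \<Phi> (line (Suc n)) \<tau> + \<Phi> (Inl (\<tau> ?x)) +
      (\<Sum>y\<in>nbhd Z2 ?x - line (Suc n). \<Phi> (Inr {\<tau> ?x, \<tau> y}))"
    unfolding line_Suc[of "Suc n"] by (rule local_energy_insert) (simp_all add: mem_line)
  also have "(\<Sum>y\<in>nbhd Z2 ?x - line (Suc n). \<Phi> (Inr {\<tau> ?x, \<tau> y})) =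
      \<Phi> (Inr {\<tau> ?x, 1}) + \<Phi> (Inr {\<tau> ?x, 2}) + \<Phi> (Inr {\<tau> ?x, \<tau> (line_site (Suc (Suc (Suc n))))})"
    unfolding out using assms by (simp add: frame_def)
  finally have "exp (- local_energy \<Phi> (line (Suc (Suc n))) \<tau>) =
      exp (- local_energy \<Phi> (line (Suc n)) \<tau>) * site_factor \<Phi> (\<tau> ?x) *
      edge_factor \<Phi> (\<tau> ?x) (\<tau> (line_site (Suc (Suc (Suc n)))))"
    by (simp add: site_factor_def edge_factor_def flip: exp_add)
  then show ?case
    unfolding Suc.IH by (simp add: mult_ac)
qed

lemma transfer_telescope:
  assumes "\<And>k. 1 \<le> k \<Longrightarrow> k \<le> Suc n \<Longrightarrow> c k \<in> W" "\<And>k. 1 \<le> k \<Longrightarrow> k \<le> n \<Longrightarrow> c k \<noteq> c (Suc k)"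
  shows "sqrt (site_factor \<Phi> (c 1)) * (\<Prod>k=1..n. transfer \<Phi> W (c k) (c (Suc k))) =
    (\<Prod>k=1..n. site_factor \<Phi> (c k)) * (\<Prod>k=1..n. edge_factor \<Phi> (c k) (c (Suc k))) *
    sqrt (site_factor \<Phi> (c (Suc n)))"
  using assms
proof (induction n)
  case (Suc n)
  have "sqrt (site_factor \<Phi> (c 1)) * (\<Prod>k=1..Suc n. transfer \<Phi> W (c k) (c (Suc k))) =
      (sqrt (site_factor \<Phi> (c 1)) * (\<Prod>k=1..n. transfer \<Phi> W (c k) (c (Suc k)))) *
      transfer \<Phi> W (c (Suc n)) (c (Suc (Suc n)))"
    by (simp add: mult_ac)
  also have "sqrt (site_factor \<Phi> (c 1)) * (\<Prod>k=1..n. transfer \<Phi> W (c k) (c (Suc k))) =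
      (\<Prod>k=1..n. site_factor \<Phi> (c k)) * (\<Prod>k=1..n. edge_factor \<Phi> (c k) (c (Suc k))) *
      sqrt (site_factor \<Phi> (c (Suc n)))"
    using Suc by simp
  also have "transfer \<Phi> W (c (Suc n)) (c (Suc (Suc n))) = sqrt (site_factor \<Phi> (c (Suc n))) *
      sqrt (site_factor \<Phi> (c (Suc (Suc n)))) * edge_factor \<Phi> (c (Suc n)) (c (Suc (Suc n)))"
    using Suc.prems(1)[of "Suc n"] Suc.prems(1)[of "Suc (Suc n)"] Suc.prems(2)[of "Suc n"]
    by (simp add: transfer_def)
  also have "(\<Prod>k=1..n. site_factor \<Phi> (c k)) * (\<Prod>k=1..n. edge_factor \<Phi> (c k) (c (Suc k))) *
      sqrt (site_factor \<Phi> (c (Suc n))) * (sqrt (site_factor \<Phi> (c (Suc n))) *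
      sqrt (site_factor \<Phi> (c (Suc (Suc n)))) * edge_factor \<Phi> (c (Suc n)) (c (Suc (Suc n)))) =
      (\<Prod>k=1..n. site_factor \<Phi> (c k)) * (\<Prod>k=1..n. edge_factor \<Phi> (c k) (c (Suc k))) *
      (sqrt (site_factor \<Phi> (c (Suc n))) * sqrt (site_factor \<Phi> (c (Suc n)))) *
      sqrt (site_factor \<Phi> (c (Suc (Suc n)))) * edge_factor \<Phi> (c (Suc n)) (c (Suc (Suc n)))"
    by (simp only: mult_ac)
  also have "sqrt (site_factor \<Phi> (c (Suc n))) * sqrt (site_factor \<Phi> (c (Suc n))) = site_factor \<Phi> (c (Suc n))"
    by (simp add: site_factor_def)
  finally show ?case by (simp add: mult_ac)
qed simp

text \<open>The edge to the fixed colour \<open>e\<close> on the left, with the half of the first site weight that the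
  product of transfer matrix entries does not contain.\<close>
definition left_factor :: "nat interaction \<Rightarrow> nat \<Rightarrow> nat \<Rightarrow> real" where
  "left_factor \<Phi> e i = (if i = e then 0 else edge_factor \<Phi> e i * sqrt (site_factor \<Phi> i))"

lemma left_factor_nonneg: "0 \<le> left_factor \<Phi> e i"
  by (simp add: left_factor_def edge_factor_def site_factor_def)

text \<open>If two consecutive colours agree, both sides vanish: the zeros of the matrix and of the left factor
  encode the constraint. Otherwise half of each site weight goes to each adjacent edge, and the half
  that spills over to the right end \<open>t\<close> is divided out.\<close>
lemma gibbs_weight_line:
  assumes W: "W = {3..<m + 2}" and te: "t \<in> W" "e \<in> W" "t \<noteq> e" and n: "1 \<le> n" "even n"
    and \<alpha>: "\<alpha> \<in> line n \<rightarrow>\<^sub>E W"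
  shows "gibbs_weight (blocked_clique m) \<Phi> (line n) (frame e t) \<alpha> =
    left_factor \<Phi> e (\<alpha> (line_site 1)) *
    ((\<Prod>k=1..<n. transfer \<Phi> W (\<alpha> (line_site k)) (\<alpha> (line_site (Suc k)))) * transfer \<Phi> W (\<alpha> (line_site n)) t) /
    sqrt (site_factor \<Phi> t)"
proof -
  define \<tau> where "\<tau> = override_on (frame e t) \<alpha> (line n)"
  define c where "c k = \<tau> (line_site k)" for k
  have c_in: "c k = \<alpha> (line_site k)" if "1 \<le> k" "k \<le> n" for k
    using that by (simp add: c_def \<tau>_def line_site_mem)
  have c_end: "c 0 = e" "c (Suc n) = t"
    using n by (auto simp: c_def \<tau>_def mem_line frame_def override_on_def)
  have cW: "c k \<in> W" if "1 \<le> k" "k \<le> Suc n" for k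
  proof (cases "k = Suc n")
    case False
    then have "c k = \<alpha> (line_site k)" "line_site k \<in> line n" using that c_in by (auto simp: line_site_mem)
    then show ?thesis using PiE_mem[OF \<alpha>] by simp
  qed (use c_end te in simp)
  have \<tau>_off: "\<tau> z = frame e t z" if "z \<notin> line n" for z using that by (simp add: \<tau>_def)
  obtain n' where n': "n = Suc n'" using n(1) by (cases n) auto
  have prod_c: "(\<Prod>k=1..<n. transfer \<Phi> W (\<alpha> (line_site k)) (\<alpha> (line_site (Suc k)))) * transfer \<Phi> W (\<alpha> (line_site n)) t =
      (\<Prod>k=1..n. transfer \<Phi> W (c k) (c (Suc k)))"
  proof -
    have "(\<Prod>k=1..<n. transfer \<Phi> W (\<alpha> (line_site k)) (\<alpha> (line_site (Suc k)))) =
        (\<Prod>k=1..<n. transfer \<Phi> W (c k) (c (Suc k)))"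
      using c_in by (intro prod.cong) auto
    moreover have "{1..n} = insert n {1..<n}" using n by auto
    ultimately show ?thesis using c_in[of n] c_end n by (simp add: mult.commute)
  qed
  have colours: "adj (blocked_clique m) u v" "adj (blocked_clique m) u 1" "adj (blocked_clique m) u 2"
    if "u \<in> W" "v \<in> W" "u \<noteq> v" for u v
    using that W by (auto simp: adj_blocked_clique doubleton_eq_iff)
  show ?thesis
  proof (cases "\<forall>k\<le>n. c k \<noteq> c (Suc k)")
    case True
    have row: "adj (blocked_clique m) (\<tau> (line_site k)) (\<tau> z)"
      if k: "1 \<le> k" "k \<le> n" and z: "z \<in> nbhd Z2 (line_site k)" for k z
    proof -
      consider "z = line_site (Suc k)" | "z = line_site (k - 1)" | "z = (int k, 1)" | "z = (int k, -1)"
        using z k by (auto simp: nbhd_Z2)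
      then show ?thesis
      proof cases
        case 1
        then show ?thesis using colours(1) cW[of k] cW[of "Suc k"] True k by (simp add: c_def)
      next
        case 2
        have "c (k - 1) \<in> W" using cW[of "k - 1"] c_end te k by (cases "k = 1") auto
        moreover have "c (k - 1) \<noteq> c k" using True k by (metis Suc_diff_1 le_trans less_eq_Suc_le One_nat_def diff_le_self)
        ultimately show ?thesis using 2 colours(1)[of "c k" "c (k - 1)"] cW[of k] k by (simp add: c_def)
      next
        case 3
        then have "\<tau> z \<in> {1, 2}" by (subst \<tau>_off) (auto simp: mem_line frame_def)
        then show ?thesis using colours(2,3)[of "c k" "c (Suc k)"] cW[of k] cW[of "Suc k"] True k
          by (auto simp: c_def)
      next
        case 4
        then have "\<tau> z \<in> {1, 2}" by (subst \<tau>_off) (auto simp: mem_line frame_def)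
        then show ?thesis using colours(2,3)[of "c k" "c (Suc k)"] cW[of k] cW[of "Suc k"] True k
          by (auto simp: c_def)
      qed
    qed
    have fr: "frame e t \<in> points (blocked_clique m)" using te W by (intro frame_points) auto
    have pt: "\<tau> \<in> points (blocked_clique m)"
      unfolding points_iff
    proof (intro conjI allI impI)
      show "\<tau> z \<in> nodes (blocked_clique m)" for z
      proof (cases "z \<in> line n")
        case True
        then have "\<tau> z \<in> W" using PiE_mem[OF \<alpha>, of z] by (simp add: \<tau>_def)
        then show ?thesis using W by simp
      next
        case False
        then show ?thesis using point_node[OF fr, of z] by (simp add: \<tau>_off)
      qed
      show "adj (blocked_clique m) (\<tau> y) (\<tau> z)" if yz: "adj Z2 y z" for y z
      proof -
        have zy: "adj Z2 z y" using yz adj_Z2_sym by blast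
        consider "y \<in> line n" | "z \<in> line n" | "y \<notin> line n" "z \<notin> line n" by blast
        then show ?thesis
        proof cases
          case 1
          then show ?thesis using row[of _ z] zy by (auto simp: line_def mem_nbhd_Z2)
        next
          case 2
          then have "adj (blocked_clique m) (\<tau> z) (\<tau> y)"
            using row[of _ y] yz by (auto simp: line_def mem_nbhd_Z2)
          then show ?thesis using adj_blocked_clique_sym by blast
        next
          case 3
          then show ?thesis using point_edge[OF fr yz] by (simp add: \<tau>_off)
        qed
      qed
    qed
    have "exp (- energy \<Phi> (line n) (frame e t) \<alpha>) = exp (- local_energy \<Phi> (line n) \<tau>)"
      by (simp add: energy_eq_local_energy \<tau>_def)
    also have "\<dots> = (\<Prod>k=1..n. site_factor \<Phi> (c k)) * (\<Prod>k=0..n. edge_factor \<Phi> (c k) (c (Suc k)))"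
      unfolding n' c_def by (rule local_energy_line[of _ e t]) (simp add: \<tau>_off mem_line)
    also have "(\<Prod>k=0..n. edge_factor \<Phi> (c k) (c (Suc k))) =
        edge_factor \<Phi> e (c 1) * (\<Prod>k=1..n. edge_factor \<Phi> (c k) (c (Suc k)))"
      by (subst prod.atLeast_Suc_atMost) (simp_all add: c_end)
    finally have weight: "gibbs_weight (blocked_clique m) \<Phi> (line n) (frame e t) \<alpha> =
        (\<Prod>k=1..n. site_factor \<Phi> (c k)) *
        (edge_factor \<Phi> e (c 1) * (\<Prod>k=1..n. edge_factor \<Phi> (c k) (c (Suc k))))"
      using pt by (simp add: gibbs_weight_def \<tau>_def)
    have "sqrt (site_factor \<Phi> (c 1)) * (\<Prod>k=1..n. transfer \<Phi> W (c k) (c (Suc k))) =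
      (\<Prod>k=1..n. site_factor \<Phi> (c k)) * (\<Prod>k=1..n. edge_factor \<Phi> (c k) (c (Suc k))) *
      sqrt (site_factor \<Phi> (c (Suc n)))"
      using cW True by (intro transfer_telescope) auto
    moreover have "left_factor \<Phi> e (\<alpha> (line_site 1)) = edge_factor \<Phi> e (c 1) * sqrt (site_factor \<Phi> (c 1))"
      using True[rule_format, of 0] c_end c_in[of 1] n by (auto simp: left_factor_def)
    moreover have "sqrt (site_factor \<Phi> t) > 0" by (simp add: site_factor_def)
    ultimately show ?thesis
      unfolding weight prod_c by (simp add: c_end field_simps)
  next
    case False
    then obtain k where k: "k \<le> n" "c k = c (Suc k)" by blast
    have "\<tau> \<notin> points (blocked_clique m)"
    proof
      assume "\<tau> \<in> points (blocked_clique m)"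
      then have "adj (blocked_clique m) (c k) (c (Suc k))"
        unfolding c_def by (rule point_edge) (simp add: adj_Z2 l1_dist_def)
      moreover have "c (Suc k) \<in> W" using cW k by simp
      ultimately show False using k W by (auto simp: adj_blocked_clique)
    qed
    then have "gibbs_weight (blocked_clique m) \<Phi> (line n) (frame e t) \<alpha> = 0"
      by (simp add: gibbs_weight_def \<tau>_def)
    moreover have "left_factor \<Phi> e (\<alpha> (line_site 1)) * (\<Prod>k=1..n. transfer \<Phi> W (c k) (c (Suc k))) = 0"
    proof (cases "k = 0")
      case True
      then show ?thesis using k c_end c_in[of 1] n by (simp add: left_factor_def)
    next
      case False
      then have "transfer \<Phi> W (c k) (c (Suc k)) = 0" "k \<in> {1..n}" using k by (auto simp: transfer_def)
      then have "(\<Prod>k=1..n. transfer \<Phi> W (c k) (c (Suc k))) = 0" by (intro prod_zero) auto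
      then show ?thesis by simp
    qed
    ultimately show ?thesis unfolding prod_c by simp
  qed
qed

text \<open>A blocker and a colour \<open>2\<close> as neighbours exclude the values \<open>0\<close>, \<open>1\<close> and \<open>2\<close>.\<close>
lemma gibbs_weight_line_outside:
  assumes \<alpha>: "\<alpha> \<in> (line n \<rightarrow>\<^sub>E nodes (blocked_clique m)) - (line n \<rightarrow>\<^sub>E {3..<m + 2})"
  shows "gibbs_weight (blocked_clique m) \<Phi> (line n) (frame e t) \<alpha> = 0"
proof (rule ccontr)
  let ?\<tau> = "override_on (frame e t) \<alpha> (line n)"
  assume "gibbs_weight (blocked_clique m) \<Phi> (line n) (frame e t) \<alpha> \<noteq> 0"
  then have pt: "?\<tau> \<in> points (blocked_clique m)" by (simp add: gibbs_weight_def split: if_splits)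
  have "\<alpha> z \<in> {3..<m + 2}" if z: "z \<in> line n" for z
  proof -
    have "snd z = 0" using z by (simp add: mem_line)
    then have nb: "adj Z2 z (fst z, 1)" "adj Z2 z (fst z, -1)"
      "?\<tau> (fst z, 1) = frame e t (fst z, 1)" "?\<tau> (fst z, -1) = frame e t (fst z, -1)"
      by (auto simp: adj_Z2 l1_dist_def mem_line)
    have "adj (blocked_clique m) (\<alpha> z) (frame e t (fst z, 1))"
      "adj (blocked_clique m) (\<alpha> z) (frame e t (fst z, -1))"
      using point_edge[OF pt nb(1)] point_edge[OF pt nb(2)] z by (simp_all add: nb(3,4))
    then have "adj (blocked_clique m) (\<alpha> z) 1" "adj (blocked_clique m) (\<alpha> z) 2"
      by (auto simp: frame_def split: if_splits)
    then have "\<alpha> z < m + 2" "\<alpha> z \<noteq> 0" "\<alpha> z \<noteq> 1" "\<alpha> z \<noteq> 2"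
      by (auto simp: adj_blocked_clique doubleton_eq_iff)
    then show ?thesis by auto
  qed
  then show False using \<alpha> by (auto simp: PiE_def)
qed

lemma gibbs_marginal_line:
  fixes \<Phi> :: "nat interaction"
  assumes W: "W = {3..<m + 2}" and te: "t \<in> W" "e \<in> W" "t \<noteq> e" and n: "1 \<le> n" "even n"
    and i: "i \<in> W"
  defines "D \<equiv> \<Sum>k\<in>W. left_factor \<Phi> e k * matpow W (transfer \<Phi> W) n k t"
  shows "gibbs_marginal (blocked_clique m) \<Phi> (line n) (frame e t) {line_site 1}
      (restrict (\<lambda>_. i) {line_site 1}) = left_factor \<Phi> e i * matpow W (transfer \<Phi> W) n i t / D"
    and "0 < D"
proof -
  let ?w = "gibbs_weight (blocked_clique m) \<Phi> (line n) (frame e t)"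
  let ?C = "line n \<rightarrow>\<^sub>E nodes (blocked_clique m)" and ?CW = "line n \<rightarrow>\<^sub>E W"
  let ?s = "sqrt (site_factor \<Phi> t)"
  have s: "0 < ?s" by (simp add: site_factor_def)
  have finW: "finite W" using W by simp
  have fin: "finite ?C" by (intro finite_PiE) auto
  have sub: "?CW \<subseteq> ?C" using W by (intro PiE_mono) auto
  have zero: "?w \<alpha> = 0" if "\<alpha> \<in> ?C - ?CW" for \<alpha>
    using that W by (intro gibbs_weight_line_outside) simp
  have part: "(\<Sum>\<alpha>\<in>?CW. if \<alpha> (line_site 1) = k then ?w \<alpha> else 0) =
      left_factor \<Phi> e k * matpow W (transfer \<Phi> W) n k t / ?s" if k: "k \<in> W" for k
  proof -
    have "(\<Sum>\<alpha>\<in>?CW. if \<alpha> (line_site 1) = k then ?w \<alpha> else 0) =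
        (\<Sum>\<alpha>\<in>?CW. left_factor \<Phi> e k / ?s * (if \<alpha> (line_site 1) = k
          then (\<Prod>k=1..<n. transfer \<Phi> W (\<alpha> (line_site k)) (\<alpha> (line_site (Suc k)))) *
            transfer \<Phi> W (\<alpha> (line_site n)) t else 0))"
      using gibbs_weight_line[OF W te n] by (intro sum.cong) auto
    then show ?thesis
      unfolding sum_distrib_left[symmetric] sum_line_matpow[OF finW k n(1)] by simp
  qed
  have "(\<Sum>\<alpha>\<in>?C. ?w \<alpha>) = (\<Sum>\<alpha>\<in>?CW. ?w \<alpha>)"
    using fin sub zero by (intro sum.mono_neutral_right) auto
  also have "\<dots> = (\<Sum>\<alpha>\<in>?CW. \<Sum>k\<in>W. if \<alpha> (line_site 1) = k then ?w \<alpha> else 0)"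
  proof (intro sum.cong refl)
    fix \<alpha> assume "\<alpha> \<in> ?CW"
    from PiE_mem[OF this, of "line_site 1"] have "\<alpha> (line_site 1) \<in> W" using n by (simp add: mem_line)
    then show "?w \<alpha> = (\<Sum>k\<in>W. if \<alpha> (line_site 1) = k then ?w \<alpha> else 0)" using finW by simp
  qed
  also have "\<dots> = (\<Sum>k\<in>W. \<Sum>\<alpha>\<in>?CW. if \<alpha> (line_site 1) = k then ?w \<alpha> else 0)" by (rule sum.swap)
  also have "\<dots> = D / ?s" unfolding D_def sum_divide_distrib using part by (intro sum.cong) auto
  finally have Z: "(\<Sum>\<alpha>\<in>?C. ?w \<alpha>) = D / ?s" .
  have "frame e t \<in> points (blocked_clique m)" using te W by (intro frame_points) auto
  then have "0 < (\<Sum>\<alpha>\<in>?C. ?w \<alpha>)"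
    by (intro partition_function_pos constraint_graph_blocked_clique finite_line)
  then show "0 < D" unfolding Z using s by (simp add: zero_less_divide_iff)
  have "gibbs_marginal (blocked_clique m) \<Phi> (line n) (frame e t) {line_site 1}
      (restrict (\<lambda>_. i) {line_site 1}) =
      (\<Sum>\<alpha>\<in>{\<alpha> \<in> ?C. restrict \<alpha> {line_site 1} = restrict (\<lambda>_. i) {line_site 1}}. ?w \<alpha>) / (D / ?s)"
    unfolding gibbs_marginal_def gibbs_def Z sum_divide_distrib ..
  also have "(\<Sum>\<alpha>\<in>{\<alpha> \<in> ?C. restrict \<alpha> {line_site 1} = restrict (\<lambda>_. i) {line_site 1}}. ?w \<alpha>) =
      (\<Sum>\<alpha>\<in>?CW. if \<alpha> (line_site 1) = i then ?w \<alpha> else 0)"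
  proof -
    have "restrict \<alpha> {line_site 1} = restrict (\<lambda>_. i) {line_site 1} \<longleftrightarrow> \<alpha> (line_site 1) = i" for \<alpha> :: "site \<Rightarrow> nat"
      by (auto simp: restrict_def fun_eq_iff)
    then have "(\<Sum>\<alpha>\<in>{\<alpha> \<in> ?C. restrict \<alpha> {line_site 1} = restrict (\<lambda>_. i) {line_site 1}}. ?w \<alpha>) =
        (\<Sum>\<alpha>\<in>?C. if \<alpha> (line_site 1) = i then ?w \<alpha> else 0)"
      using fin by (intro sum.mono_neutral_cong_left) auto
    also have "\<dots> = (\<Sum>\<alpha>\<in>?CW. if \<alpha> (line_site 1) = i then ?w \<alpha> else 0)"
      using fin sub zero by (intro sum.mono_neutral_right) auto
    finally show ?thesis .
  qed
  also have "(\<Sum>\<alpha>\<in>?CW. if \<alpha> (line_site 1) = i then ?w \<alpha> else 0) / (D / ?s) =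
      left_factor \<Phi> e i * matpow W (transfer \<Phi> W) n i t / D"
    unfolding part[OF i] using s by simp
  finally show "gibbs_marginal (blocked_clique m) \<Phi> (line n) (frame e t) {line_site 1}
      (restrict (\<lambda>_. i) {line_site 1}) = left_factor \<Phi> e i * matpow W (transfer \<Phi> W) n i t / D" .
qed

section \<open>The rate of strong spatial mixing is bounded\<close>

lemma frame_disagreement_far:
  assumes "even n"
  shows "enat n \<le> set_gdist Z2 {line_site 1} (disagreement (bdry (line n)) (frame e t) (frame e t'))"
proof (rule set_gdist_ge)
  fix x z assume x: "x \<in> {line_site 1}" and z: "z \<in> disagreement (bdry (line n)) (frame e t) (frame e t')"
  then obtain y where y: "y \<in> line n" "adj Z2 y z" "z \<notin> line n" "frame e t z \<noteq> frame e t' z"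
    by (auto simp: disagreement_def bdry_eq)
  have "snd z = 0" "odd (fst z)" using y(4) by (auto simp: frame_def split: if_splits)
  moreover have "fst z = 0 \<or> fst z = int n + 1"
    using y(1-3) \<open>snd z = 0\<close> by (auto simp: mem_line adj_Z2 l1_dist_def nat_eq_iff abs_if split: if_splits)
  ultimately have "z = line_site (Suc n)" by (auto simp: prod_eq_iff)
  then show "enat n \<le> enat (l1_dist x z)" using x by (simp add: l1_dist_def)
qed

lemma exp_decay_le:
  assumes "0 < \<gamma>" "0 < C" "enat n \<le> d"
  shows "exp_decay C \<gamma> d \<le> C * exp (- \<gamma>) ^ n"
proof (cases d)
  case (enat k)
  have "exp (- \<gamma> * real k) \<le> exp (- \<gamma> * real n)" using assms enat by simp
  also have "\<dots> = exp (- \<gamma>) ^ n" by (metis exp_of_nat_mult mult.commute)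
  finally show ?thesis using enat assms(2) by (simp add: exp_decay_def)
next
  case infinity
  then show ?thesis using assms by (simp add: exp_decay_def)
qed

lemma product_difference_le:
  fixes a b a' b' :: real
  assumes "\<bar>a - b\<bar> \<le> \<epsilon>" "\<bar>a' - b'\<bar> \<le> \<epsilon>" "0 \<le> a'" "a' \<le> 1" "0 \<le> b" "b \<le> 1"
  shows "\<bar>a * a' - b * b'\<bar> \<le> 2 * \<epsilon>"
proof -
  have "a * a' - b * b' = (a - b) * a' + b * (a' - b')" by (simp add: algebra_simps)
  also have "\<bar>\<dots>\<bar> \<le> \<bar>a - b\<bar> * a' + b * \<bar>a' - b'\<bar>"
    using assms by (simp add: order.trans[OF abs_triangle_ineq] abs_mult)
  also have "\<dots> \<le> \<epsilon> * 1 + 1 * \<epsilon>"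
    using assms by (intro add_mono mult_mono) auto
  finally show ?thesis by simp
qed

text \<open>If the law at the left end of the line forgets the right end at rate \<open>exp (- \<gamma> n)\<close>, then the \<open>2 \<times> 2\<close>
  minors of the \<open>n\<close>-th power of the transfer matrix are smaller by this factor than the products of
  two column sums, which are at most \<open>(m \<mu>) ^ (2 n)\<close> up to constants, where \<open>\<mu>\<close> is the largest
  entry. For \<open>n\<close> a power of two one minor is at least \<open>\<mu> ^ (2 n)\<close>. The ratio per step, \<open>m ^ 2\<close>, depends
  neither on the interaction nor on \<open>\<mu>\<close>.\<close>
lemma SSM_rate_bounded:
  assumes m: "4 \<le> m" and \<gamma>: "2 * ln (real m) < \<gamma>"
  shows "\<not> exp_SSM (blocked_clique m) \<Phi> \<gamma>"
proof
  assume "exp_SSM (blocked_clique m) \<Phi> \<gamma>"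
  then obtain C where C: "0 < C" and ssm: "\<And>A B \<beta> \<omega>1 \<omega>2. finite A \<Longrightarrow> B \<subseteq> A \<Longrightarrow>
      \<beta> \<in> B \<rightarrow>\<^sub>E nodes (blocked_clique m) \<Longrightarrow> \<omega>1 \<in> points (blocked_clique m) \<Longrightarrow> \<omega>2 \<in> points (blocked_clique m) \<Longrightarrow>
      \<bar>gibbs_marginal (blocked_clique m) \<Phi> A \<omega>1 B \<beta> - gibbs_marginal (blocked_clique m) \<Phi> A \<omega>2 B \<beta>\<bar>
        \<le> real (card B) * exp_decay C \<gamma> (set_gdist Z2 B (disagreement (bdry A) \<omega>1 \<omega>2))"
    by (auto simp: exp_SSM_def)
  have m1: "1 < real m" using m by simp
  have \<gamma>0: "0 < \<gamma>" using \<gamma> m1 ln_gt_zero[of "real m"] by linarith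
  define W where "W = {3..<m + 2}"
  define M where "M = transfer \<Phi> W"
  have finW: "finite W" and cardW: "card W = m - 1" by (auto simp: W_def)
  define P where "P = {(u, v). u \<in> W \<and> v \<in> W \<and> u \<noteq> v}"
  have "P \<subseteq> W \<times> W" by (auto simp: P_def)
  then have P: "finite P" "(3, 4) \<in> P"
    using finite_subset finW m by (blast, simp add: P_def W_def)
  define \<mu> where "\<mu> = Max ((\<lambda>(u, v). M u v) ` P)"
  have "\<mu> \<in> (\<lambda>(u, v). M u v) ` P" unfolding \<mu>_def using P by (intro Max_in) auto
  then obtain i j where ij: "i \<in> W" "j \<in> W" "i \<noteq> j" "M i j = \<mu>" by (auto simp: P_def)
  have \<mu>: "0 < \<mu>"
    using ij by (auto simp: M_def transfer_def site_factor_def edge_factor_def)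
  have M_le: "M u v \<le> \<mu>" for u v
  proof (cases "(u, v) \<in> P")
    case True
    then show ?thesis unfolding \<mu>_def using P by (intro Max_ge) (auto intro!: image_eqI[of _ _ "(u, v)"])
  next
    case False
    then show ?thesis using \<mu> by (auto simp: P_def M_def transfer_def)
  qed
  have M_sym: "M u v = M v u" for u v by (simp add: M_def transfer_sym)
  have M_diag: "M u u = 0" for u by (simp add: M_def transfer_def)
  have M_nonneg: "0 \<le> M u v" for u v by (simp add: M_def transfer_nonneg)
  \<comment> \<open>A third colour for the left neighbour of the line, so that both \<open>i\<close> and \<open>j\<close> are possible at its first site.\<close>
  have "card {i, j} < card W" using cardW m ij by simp
  then have "\<not> W \<subseteq> {i, j}" using card_mono[of "{i, j}" W] by auto
  then obtain e where e: "e \<in> W" "e \<noteq> i" "e \<noteq> j" by auto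
  let ?c = "left_factor \<Phi> e"
  have c_pos: "0 < ?c i" "0 < ?c j" using e by (simp_all add: left_factor_def edge_factor_def site_factor_def)
  define S where "S = (\<Sum>k\<in>W. ?c k)"
  define K where "K = 2 * C * S\<^sup>2 / (?c i * ?c j)"
  define r where "r = (real m)\<^sup>2 * exp (- \<gamma>)"
  have S0: "0 \<le> S" unfolding S_def by (intro sum_nonneg left_factor_nonneg)
  have main: "1 \<le> K * r ^ n" if n: "n = 2 ^ k" "1 \<le> k" for n k
  proof -
    have n1: "1 \<le> n" "even n" using n by auto
    define D where "D t = (\<Sum>k\<in>W. ?c k * matpow W M n k t)" for t
    define p where "p u t = ?c u * matpow W M n u t / D t" for u t
    have D_pos: "0 < D t" if "t \<in> {i, j}" for t
      unfolding D_def M_def using that ij e n1 by (intro gibbs_marginal_line(2)[OF W_def]) auto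
    have marg: "gibbs_marginal (blocked_clique m) \<Phi> (line n) (frame e t) {line_site 1}
      (restrict (\<lambda>_. u) {line_site 1}) = p u t" if "t \<in> {i, j}" "u \<in> {i, j}" for t u
      unfolding p_def D_def M_def using that ij e n1 by (intro gibbs_marginal_line(1)[OF W_def]) auto
    have summand: "0 \<le> ?c u * matpow W M n u t" for u t
      by (intro mult_nonneg_nonneg left_factor_nonneg matpow_nonneg M_nonneg)
    have p01: "0 \<le> p u t" "p u t \<le> 1" if "t \<in> {i, j}" "u \<in> {i, j}" for u t
    proof -
      have "?c u * matpow W M n u t \<le> D t"
        unfolding D_def using that ij finW summand by (intro member_le_sum) auto
      then show "0 \<le> p u t" "p u t \<le> 1" using D_pos[OF that(1)] summand by (auto simp: p_def)
    qed
    have close: "\<bar>p u i - p u j\<bar> \<le> C * exp (- \<gamma>) ^ n" if u: "u \<in> {i, j}" for u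
    proof -
      have "\<bar>p u i - p u j\<bar> \<le> real (card {line_site 1}) *
          exp_decay C \<gamma> (set_gdist Z2 {line_site 1} (disagreement (bdry (line n)) (frame e i) (frame e j)))"
        unfolding marg[OF insertI1 u, symmetric] marg[OF insertI2[OF singletonI] u, symmetric]
        using u ij e n1 by (intro ssm frame_points) (auto simp: mem_line W_def)
      also have "\<dots> \<le> C * exp (- \<gamma>) ^ n"
        using exp_decay_le[OF \<gamma>0 C frame_disagreement_far[OF n1(2)]] by simp
      finally show ?thesis .
    qed
    have "\<bar>p i i * p j j - p i j * p j i\<bar> \<le> 2 * (C * exp (- \<gamma>) ^ n)"
      using close[of i] close[of j] p01 by (intro product_difference_le) (auto simp: abs_minus_commute)
    moreover have "p i i * p j j - p i j * p j i =
        ?c i * ?c j * principal_minor W M n i j / (D i * D j)"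
      using D_pos[of i] D_pos[of j] matpow_sym[OF finW M_sym ij(2,1), where n = n]
      by (simp add: p_def principal_minor_def power2_eq_square field_simps)
    ultimately have "\<bar>?c i * ?c j * principal_minor W M n i j / (D i * D j)\<bar> \<le> 2 * (C * exp (- \<gamma>) ^ n)"
      by simp
    then have "?c i * ?c j * \<bar>principal_minor W M n i j\<bar> / (D i * D j) \<le> 2 * (C * exp (- \<gamma>) ^ n)"
      using c_pos D_pos[of i] D_pos[of j] by (simp add: abs_mult)
    then have upper: "?c i * ?c j * \<bar>principal_minor W M n i j\<bar> \<le> 2 * (C * exp (- \<gamma>) ^ n) * (D i * D j)"
      using D_pos[of i] D_pos[of j] by (simp add: pos_divide_le_eq)
    have D_le: "D t \<le> S * (m * \<mu>) ^ n" for t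
    proof -
      have "matpow W M n k t \<le> (m * \<mu>) ^ n" for k
      proof -
        have "matpow W M n k t \<le> (card W * \<mu>) ^ n" by (rule matpow_le[OF M_nonneg M_le])
        also have "\<dots> \<le> (m * \<mu>) ^ n" using \<mu> cardW by (intro power_mono mult_right_mono) auto
        finally show ?thesis .
      qed
      then show ?thesis unfolding D_def S_def sum_distrib_right
        by (intro sum_mono mult_left_mono left_factor_nonneg)
    qed
    have "(\<mu>\<^sup>2) ^ n \<le> \<bar>principal_minor W M n i j\<bar>"
      using principal_minor_power_of_two[where M = M and k = k, OF finW ij(1,2,3) M_sym M_diag]
      by (simp add: n(1) ij(4))
    then have "?c i * ?c j * (\<mu>\<^sup>2) ^ n \<le> ?c i * ?c j * \<bar>principal_minor W M n i j\<bar>"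
      using c_pos by (intro mult_left_mono) auto
    also note upper
    also have "2 * (C * exp (- \<gamma>) ^ n) * (D i * D j) \<le>
        2 * (C * exp (- \<gamma>) ^ n) * ((S * (m * \<mu>) ^ n) * (S * (m * \<mu>) ^ n))"
      using C D_pos[of i] D_pos[of j] S0 \<mu> by (intro mult_left_mono mult_mono D_le) auto
    also have "\<dots> = (2 * C * S\<^sup>2 * r ^ n) * (\<mu>\<^sup>2) ^ n"
      by (simp add: r_def power_mult_distrib power2_eq_square mult_ac)
    finally have "?c i * ?c j \<le> 2 * C * S\<^sup>2 * r ^ n" using \<mu> by simp
    then show ?thesis using c_pos by (simp add: K_def field_simps)
  qed
  have r: "0 \<le> r" "r < 1"
  proof -
    have "(real m)\<^sup>2 = exp (2 * ln (real m))" using m1 by (simp add: exp_double)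
    also have "\<dots> < exp \<gamma>" using \<gamma> by simp
    finally show "r < 1" by (simp add: r_def exp_minus field_simps)
  qed (simp add: r_def)
  have K0: "0 \<le> K" using C S0 c_pos by (simp add: K_def)
  have "K \<noteq> 0" using main[OF refl, of 1] by auto
  then have "0 < 1 / K" using K0 by simp
  then obtain k where "r ^ k < 1 / K" using real_arch_pow_inv r(2) by blast
  moreover have "r ^ (2 ^ Suc k) \<le> r ^ k"
    using r less_exp[of "Suc k"] by (intro power_decreasing) auto
  ultimately have "r ^ (2 ^ Suc k) < 1 / K" by linarith
  then have "K * r ^ (2 ^ Suc k) < 1" using \<open>0 < 1 / K\<close> by (simp add: field_simps)
  then show False using main[OF refl, of "Suc k"] by simp
qed

lemma bounded_SSM_rate_blocked_clique:
  assumes "12 \<le> m"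
  shows "bounded_SSM_rate (blocked_clique m) (2 * ln (real m))"
  unfolding bounded_SSM_rate_def
proof (intro conjI allI impI)
  have "hub_interaction m (120 * (real m + 1)) \<in> nn_interactions (blocked_clique m)"
    by (rule hub_interaction_nn) simp
  moreover have "exp_SSM (blocked_clique m) (hub_interaction m (120 * (real m + 1))) (ln (5/4))"
    using assms by (intro exp_SSM_hub_interaction) auto
  ultimately show "{\<Phi> \<in> nn_interactions (blocked_clique m). \<exists>\<gamma>. exp_SSM (blocked_clique m) \<Phi> \<gamma>} \<noteq> {}"
    by blast
  show "\<not> (\<exists>\<Phi>\<in>nn_interactions (blocked_clique m). \<exists>\<gamma>>2 * ln (real m). exp_SSM (blocked_clique m) \<Phi> \<gamma>)"
    using SSM_rate_bounded[of m] assms by auto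
  show "SSF (blocked_clique m)" "TSSM (blocked_clique m)"
    using assms by (auto intro: SSF_blocked_clique TSSM_blocked_clique)
  show "\<exists>\<Phi>\<in>nn_interactions (blocked_clique m). exp_WSM (blocked_clique m) \<Phi> \<gamma>" if "0 < \<gamma>" for \<gamma>
    using exp_WSM_hub_interaction[OF that, of m] hub_interaction_nn by blast
qed

theorem proposition9p3:
  "(\<exists>(H :: nat ugraph) \<gamma>0::real.
      constraint_graph H \<and> dismantlable H \<and> \<gamma>0 > 0 \<and> bounded_SSM_rate H \<gamma>0) \<and>
   (\<exists>Hq :: nat \<Rightarrow> nat ugraph.
      (\<forall>q. constraint_graph (Hq q) \<and> dismantlable (Hq q) \<and>
           (\<exists>\<gamma>0::real. \<gamma>0 > 0 \<and> bounded_SSM_rate (Hq q) \<gamma>0)) \<and>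
      filterlim (\<lambda>q. card (nodes (Hq q))) at_top sequentially)"
proof -
  have H: "constraint_graph (blocked_clique m) \<and> dismantlable (blocked_clique m) \<and>
      (\<exists>\<gamma>0::real. \<gamma>0 > 0 \<and> bounded_SSM_rate (blocked_clique m) \<gamma>0)" if "12 \<le> m" for m
    using that bounded_SSM_rate_blocked_clique[OF that] constraint_graph_blocked_clique
      dismantlable_blocked_clique by (intro conjI exI[of _ "2 * ln (real m)"]) auto
  have "filterlim (\<lambda>q. card (nodes (blocked_clique (q + 12)))) at_top sequentially"
    unfolding filterlim_at_top
  proof
    fix Z
    show "eventually (\<lambda>q. Z \<le> card (nodes (blocked_clique (q + 12)))) sequentially"
      using eventually_ge_at_top[of Z] by eventually_elim simp
  qed
  then have "\<exists>Hq :: nat \<Rightarrow> nat ugraph.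
      (\<forall>q. constraint_graph (Hq q) \<and> dismantlable (Hq q) \<and>
           (\<exists>\<gamma>0::real. \<gamma>0 > 0 \<and> bounded_SSM_rate (Hq q) \<gamma>0)) \<and>
      filterlim (\<lambda>q. card (nodes (Hq q))) at_top sequentially"
    using H by (intro exI[of _ "\<lambda>q. blocked_clique (q + 12)"]) simp
  then show ?thesis using H[of 12] by blast
qed

end
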